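(* Let $\mathcal{F}$ be a fixed (finite or infinite) family of graphs. If $G$ is a graph with $n$ vertices, then $\nu^*_{\mathcal{F}}(G)-\nu_{\mathcal{F}}(G)=o(n^2)$. That is, for every $\epsilon>0$ there exists $N=N(\mathcal{F},\epsilon)$ such that for all $n>N$ and every graph $G$ with $n$ vertices, $\nu^*_{\mathcal{F}}(G)-\nu_{\mathcal{F}}(G)<\epsilon n^2$.
   Context: All graphs are finite, with no loops, multiple edges or isolated vertices (and with nonempty vertex set). A copy of an element of $\mathcal{F}$ in $G$ is a (not necessarily induced) subgraph of $G$ isomorphic to some member of $\mathcal{F}$; $\binom{G}{\mathcal{F}}$ denotes the set of all such copies. The $\mathcal{F}$-packing number $\nu_{\mathcal{F}}(G)$ is the maximum number of pairwise edge-disjoint copies of elements of $\mathcal{F}$ in $G$. A fractional $\mathcal{F}$-packing of $G$ is a function $\psi:\binom{G}{\mathcal{F}}\to[0,1]$ such that for every $e\in E(G)$ the sum of $\psi(H)$ over all $H\in\binom{G}{\mathcal{F}}$ containing $e$ is at most $1$. Its weight is $w(\psi)=\sum_{H\in\binom{G}{\mathcal{F}}}\psi(H)$. The fractional $\mathcal{F}$-packing number $\nu^*_{\mathcal{F}}(G)$ is the maximum of $w(\psi)$ over all fractional $\mathcal{F}$-packings $\psi$ of $G$. *)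

theory Defs
  imports "HOL-Analysis.Analysis"
begin

type_synonym 'a ugraph = "'a set \<times> 'a set set"

abbreviation verts :: "'a ugraph \<Rightarrow> 'a set" where
  "verts \<equiv> fst"

abbreviation edges :: "'a ugraph \<Rightarrow> 'a set set" where
  "edges \<equiv> snd"

text \<open>Edges are two-element subsets of the vertex set, which excludes loops and multiple edges.
  The last conjunct excludes isolated vertices.\<close>

definition is_graph :: "'a ugraph \<Rightarrow> bool" where
  "is_graph G \<longleftrightarrow>
     finite (verts G) \<and> verts G \<noteq> {} \<and>
     (\<forall>e\<in>edges G. e \<subseteq> verts G \<and> card e = 2) \<and>
     (\<forall>v\<in>verts G. \<exists>e\<in>edges G. v \<in> e)"

definition subgraph :: "'a ugraph \<Rightarrow> 'a ugraph \<Rightarrow> bool" where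
  "subgraph H G \<longleftrightarrow> is_graph H \<and> verts H \<subseteq> verts G \<and> edges H \<subseteq> edges G"

definition graph_iso :: "'a ugraph \<Rightarrow> 'b ugraph \<Rightarrow> bool" where
  "graph_iso H K \<longleftrightarrow>
     (\<exists>f. bij_betw f (verts H) (verts K) \<and>
          (\<forall>u\<in>verts H. \<forall>v\<in>verts H. {u, v} \<in> edges H \<longleftrightarrow> {f u, f v} \<in> edges K))"

definition copies :: "'b ugraph set \<Rightarrow> 'a ugraph \<Rightarrow> 'a ugraph set" where
  "copies F G = {H. subgraph H G \<and> (\<exists>K\<in>F. graph_iso H K)}"

definition is_packing :: "'b ugraph set \<Rightarrow> 'a ugraph \<Rightarrow> 'a ugraph set \<Rightarrow> bool" where
  "is_packing F G P \<longleftrightarrow>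
     P \<subseteq> copies F G \<and> pairwise (\<lambda>H H'. edges H \<inter> edges H' = {}) P"

definition packing_number :: "'b ugraph set \<Rightarrow> 'a ugraph \<Rightarrow> nat" where
  "packing_number F G = Max {card P | P. is_packing F G P}"

text \<open>Only the values on \<open>copies F G\<close> matter; elsewhere the total function is arbitrary.\<close>

definition is_fractional_packing ::
    "'b ugraph set \<Rightarrow> 'a ugraph \<Rightarrow> ('a ugraph \<Rightarrow> real) \<Rightarrow> bool" where
  "is_fractional_packing F G \<psi> \<longleftrightarrow>
     \<psi> \<in> copies F G \<rightarrow> {0..1} \<and>
     (\<forall>e\<in>edges G. (\<Sum>H\<in>{H \<in> copies F G. e \<in> edges H}. \<psi> H) \<le> 1)"

definition weight :: "'b ugraph set \<Rightarrow> 'a ugraph \<Rightarrow> ('a ugraph \<Rightarrow> real) \<Rightarrow> real" where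
  "weight F G \<psi> = (\<Sum>H\<in>copies F G. \<psi> H)"

text \<open>The supremum is a maximum; see \<open>fractional_packing_number_attained\<close> below.\<close>

definition fractional_packing_number :: "'b ugraph set \<Rightarrow> 'a ugraph \<Rightarrow> real" where
  "fractional_packing_number F G = (SUP \<psi>\<in>{\<psi>. is_fractional_packing F G \<psi>}. weight F G \<psi>)"

lemma finite_copies:
  assumes "is_graph G"
  shows "finite (copies F G)"
proof -
  have "finite (verts G)" and "edges G \<subseteq> Pow (verts G)"
    using assms by (auto simp: is_graph_def)
  then have "finite (Pow (verts G) \<times> Pow (edges G))"
    by (meson finite_Pow_iff finite_SigmaI finite_subset)
  moreover have "copies F G \<subseteq> Pow (verts G) \<times> Pow (edges G)"
    by (auto simp: copies_def subgraph_def)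
  ultimately show ?thesis
    by (rule finite_subset[rotated])
qed

lemma packing_number_attained:
  assumes "is_graph G"
  shows "\<exists>P. is_packing F G P \<and> card P = packing_number F G"
    and "is_packing F G P \<Longrightarrow> card P \<le> packing_number F G"
proof -
  let ?A = "{card P | P. is_packing F G P}"
  have "?A \<subseteq> card ` Pow (copies F G)"
    by (auto simp: is_packing_def)
  then have fin: "finite ?A"
    by (meson assms finite_Pow_iff finite_copies finite_imageI finite_subset)
  have "is_packing F G {}"
    by (simp add: is_packing_def)
  then have "?A \<noteq> {}"
    by blast
  with fin have "packing_number F G \<in> ?A"
    unfolding packing_number_def by (rule Max_in)
  then show "\<exists>P. is_packing F G P \<and> card P = packing_number F G"
    by auto
  show "is_packing F G P \<Longrightarrow> card P \<le> packing_number F G"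
    unfolding packing_number_def using fin by (intro Max_ge) auto
qed

lemma fractional_packing_number_attained:
  assumes "is_graph G"
  shows "\<exists>\<psi>. is_fractional_packing F G \<psi> \<and> weight F G \<psi> = fractional_packing_number F G"
    and "is_fractional_packing F G \<psi> \<Longrightarrow> weight F G \<psi> \<le> fractional_packing_number F G"
proof -
  define C where "C = copies F G"
  let ?B = "Pi\<^sub>E UNIV (\<lambda>H. if H \<in> C then {0..1} else {0::real})"
  let ?S = "?B \<inter> (\<Inter>e\<in>edges G. {\<psi>. (\<Sum>H\<in>{H \<in> C. e \<in> edges H}. \<psi> H) \<le> 1})"
  let ?W = "weight F G ` {\<psi>. is_fractional_packing F G \<psi>}"
  have "compactin (product_topology (\<lambda>_. euclidean) UNIV) ?B"
    by (subst compactin_PiE) auto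
  then have "compact ?B"
    by (simp add: euclidean_product_topology)
  moreover have "closed (\<Inter>e\<in>edges G. {\<psi>. (\<Sum>H\<in>{H \<in> C. e \<in> edges H}. \<psi> H) \<le> (1::real)})"
    by (intro closed_INT ballI closed_Collect_le continuous_intros) auto
  ultimately have "compact ?S"
    by (rule compact_Int_closed)
  moreover have "continuous_on ?S (weight F G)"
    unfolding weight_def
    by (intro continuous_intros continuous_on_subset[OF continuous_on_product_coordinates]) auto
  ultimately have comp: "compact (weight F G ` ?S)"
    by (rule compact_continuous_image[rotated])
  have "weight F G \<psi> \<in> weight F G ` ?S" if "is_fractional_packing F G \<psi>" for \<psi>
  proof -
    let ?\<phi> = "\<lambda>H. if H \<in> C then \<psi> H else 0"
    have sums: "(\<Sum>H\<in>{H \<in> C. e \<in> edges H}. ?\<phi> H) = (\<Sum>H\<in>{H \<in> C. e \<in> edges H}. \<psi> H)" for e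
      by (rule sum.cong) auto
    have "?\<phi> \<in> ?B"
      using that by (auto simp: is_fractional_packing_def C_def Pi_iff)
    then have "?\<phi> \<in> ?S"
      using that sums by (auto simp: is_fractional_packing_def C_def)
    moreover have "weight F G ?\<phi> = weight F G \<psi>"
      unfolding weight_def C_def by (rule sum.cong) auto
    ultimately show ?thesis
      using imageI[of ?\<phi> ?S "weight F G"] by simp
  qed
  moreover have "is_fractional_packing F G \<psi>" if "\<psi> \<in> ?S" for \<psi>
  proof -
    from that have "\<psi> \<in> ?B"
      by (rule IntD1)
    from PiE_mem[OF this UNIV_I] have "\<psi> H \<in> {0..1}" if "H \<in> C" for H
      using that by (metis (full_types))
    moreover from that have "(\<Sum>H\<in>{H \<in> C. e \<in> edges H}. \<psi> H) \<le> 1" if "e \<in> edges G" for e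
      using that by blast
    ultimately show ?thesis
      unfolding is_fractional_packing_def C_def by blast
  qed
  ultimately have "?W = weight F G ` ?S"
    by blast
  moreover have "is_fractional_packing F G (\<lambda>_. 0)"
    by (simp add: is_fractional_packing_def)
  then have "?W \<noteq> {}"
    by blast
  ultimately have "compact ?W" and "?W \<noteq> {}"
    using comp by simp_all
  from compact_attains_sup[OF this]
  obtain m where m: "m \<in> ?W" "\<And>t. t \<in> ?W \<Longrightarrow> t \<le> m"
    by blast
  then have eq: "fractional_packing_number F G = m"
    unfolding fractional_packing_number_def by (rule cSup_eq_maximum)
  show "\<exists>\<psi>. is_fractional_packing F G \<psi> \<and> weight F G \<psi> = fractional_packing_number F G"
    using m(1) eq by auto
  show "is_fractional_packing F G \<psi> \<Longrightarrow> weight F G \<psi> \<le> fractional_packing_number F G"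
    using m(2) eq by auto
qed

end

theory Submission
  imports Defs
begin

text \<open>Copies with more than \<open>M\<close> edges carry fractional weight at most \<open>n\<^sup>2 / M\<close>, so only copies with at
  most \<open>M\<close> edges matter, even for an infinite family. Among these, minimise over \<open>y \<in> [0,1]\<close> the
  value \<open>\<Sum>\<^sub>e y e\<close> of a fractional edge cover plus the penalty \<open>\<Sum>\<^sub>H cap H / 2 * (1 - y(H))\<^sub>+\<^sup>2\<close>, where
  \<open>cap H\<close> is a constant times \<open>n\<close> to the power \<open>2 - k\<close>, \<open>k\<close> being the number of vertices of \<open>H\<close>.
  Stationarity says that \<open>\<psi> H = cap H * (1 - y(H))\<^sub>+\<close> is a fractional packing of weight at least
  \<open>\<Sum>\<^sub>e y e\<close>. On the one hand, few copies have \<open>y(H)\<close> bounded away from \<open>1\<close>, so after rounding \<open>y\<close> to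
  finitely many colours the coloured removal lemma turns \<open>y\<close> into a fractional cover at additional
  cost \<open>o(n\<^sup>2)\<close>; hence \<open>\<psi>\<close> is nearly optimal. On the other hand, \<open>\<psi> \<le> cap\<close> makes the total weight of
  the copies through any two given edges \<open>O(1/n)\<close>, so a nibble argument rounds \<open>\<psi>\<close> to an integral
  packing at a loss of \<open>o(n\<^sup>2)\<close>.\<close>

section \<open>Spread-out fractional matchings\<close>

text \<open>An optimal fractional packing may sit on few copies, and then no nibble can round it;
  the obstacle is to find one that is both nearly optimal and spread out. Linear duality under the
  constraint \<open>\<psi> \<le> cap\<close> would lead to the penalty
  \<open>cap H * max 0 (1 - y(H))\<close>. Squaring the positive part smooths it, so that
  \<open>\<psi>\<close> is an explicit function of the minimiser and no duality theorem is invoked.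
  The exponent \<open>2 - k\<close> meets two needs. Two given edges lie in
  \<open>O(n^(k-3))\<close> copies on \<open>k\<close> vertices, which makes codegrees small. And a
  copy with \<open>y(H)\<close> below \<open>1 - \<gamma> / 2\<close> has weight at least a constant
  times \<open>\<kappa> * n^(2-k)\<close>, while the total is at most \<open>n^2\<close>; so there
  are \<open>O(n^k / \<kappa>)\<close> such copies, the order of magnitude in which the removal
  lemma counts. Hence \<open>\<kappa>\<close> is chosen after the removal constant, and
  \<open>n\<close> last. The nibble needs no probability space: the mean over one step is an
  explicit finite sum, the induction runs over single steps, and a second moment of the degrees
  takes the place of concentration.\<close>

lemma pos_part_square_diff_le:
  fixes a t :: real
  shows "(max 0 (a - t))\<^sup>2 \<le> (max 0 a)\<^sup>2 - 2 * t * max 0 a + t\<^sup>2"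
proof (cases "0 \<le> a")
  case True
  have "(max 0 (a - t))\<^sup>2 \<le> (a - t)\<^sup>2" by (cases "0 \<le> a - t") auto
  then show ?thesis using True by (simp add: power2_diff algebra_simps)
next
  case False
  have "(max 0 (a - t))\<^sup>2 \<le> (- t)\<^sup>2"
  proof (cases "0 \<le> a - t")
    case True
    then show ?thesis using False by (simp only: max_absorb2, intro power_mono) auto
  qed simp
  then show ?thesis using False by simp
qed

lemma sum_of_bool_filter:
  fixes f :: "'h \<Rightarrow> real"
  assumes "finite C"
  shows "(\<Sum>h\<in>C. of_bool (P h) * f h) = sum f {h \<in> C. P h}"
  unfolding sum.inter_filter[OF assms] by (rule sum.cong) auto

text \<open>These are the optimality conditions at a minimiser \<open>y\<close>. Minimality excludes
  \<open>\<Psi> e > 1\<close> where \<open>y e\<close> can grow and \<open>\<Psi> e < 1\<close>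
  where it can shrink; at \<open>y e = 1\<close> every \<open>h\<close> through \<open>e\<close> has
  \<open>\<psi> h = 0\<close>. So \<open>y e \<le> y e * \<Psi> e\<close>, and exchanging sums gives
  the last claim because \<open>\<psi> h\<close> vanishes as soon as \<open>sum y (S h)\<close>
  reaches \<open>1\<close>.\<close>

lemma capped_fractional_matching:
  fixes X :: "'e set" and C :: "'h set" and S :: "'h \<Rightarrow> 'e set" and \<kappa> :: "'h \<Rightarrow> real"
  assumes fX: "finite X" and fC: "finite C" and S: "\<And>h. h \<in> C \<Longrightarrow> S h \<subseteq> X"
    and \<kappa>: "\<And>h. h \<in> C \<Longrightarrow> 0 \<le> \<kappa> h"
  obtains y :: "'e \<Rightarrow> real" where "\<And>e. 0 \<le> y e" "\<And>e. y e \<le> 1"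
    "\<And>e. e \<in> X \<Longrightarrow> (\<Sum>h\<in>{h \<in> C. e \<in> S h}. \<kappa> h * max 0 (1 - sum y (S h))) \<le> 1"
    "sum y X \<le> (\<Sum>h\<in>C. \<kappa> h * max 0 (1 - sum y (S h)))"
proof -
  \<comment> \<open>Coordinates outside \<open>X\<close> are pinned to \<open>0\<close>, so that the
    box is compact in the product topology on all functions.\<close>
  define K where "K = Pi\<^sub>E UNIV (\<lambda>e. if e \<in> X then {0..1} else {0::real})"
  \<comment> \<open>The derivative of the penalty with respect to \<open>y e\<close> is minus the weight of \<open>\<psi>\<close> at \<open>e\<close>.\<close>
  define g where "g y = sum y X + (\<Sum>h\<in>C. \<kappa> h / 2 * (max 0 (1 - sum y (S h)))\<^sup>2)" for y :: "'e \<Rightarrow> real"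
  have "compactin (product_topology (\<lambda>_. euclidean) UNIV) K"
    unfolding K_def by (subst compactin_PiE) auto
  then have "compact K" by (simp add: euclidean_product_topology)
  moreover have "K \<noteq> {}" by (auto simp: K_def PiE_eq_empty_iff)
  moreover have "continuous_on K g"
    unfolding g_def
    by (intro continuous_intros continuous_on_max continuous_on_subset[OF continuous_on_product_coordinates]) auto
  ultimately obtain y where y: "y \<in> K" and min: "\<And>y'. y' \<in> K \<Longrightarrow> g y \<le> g y'"
    using continuous_attains_inf by metis
  have K_iff: "z \<in> K \<longleftrightarrow> (\<forall>e. (e \<in> X \<longrightarrow> 0 \<le> z e \<and> z e \<le> 1) \<and> (e \<notin> X \<longrightarrow> z e = 0))" for z
    by (auto simp: K_def PiE_def Pi_def split: if_splits)
  have y01: "0 \<le> y e" "y e \<le> 1" for e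
    using y K_iff[of y] by (cases "e \<in> X"; auto)+
  define \<psi> where "\<psi> h = \<kappa> h * max 0 (1 - sum y (S h))" for h
  define \<Psi> where "\<Psi> e = (\<Sum>h\<in>{h \<in> C. e \<in> S h}. \<psi> h)" for e
  define A where "A e = (\<Sum>h\<in>{h \<in> C. e \<in> S h}. \<kappa> h / 2)" for e
  have A0: "0 \<le> A e" for e unfolding A_def using \<kappa> by (intro sum_nonneg) auto
  have \<psi>0: "0 \<le> \<psi> h" if "h \<in> C" for h using \<kappa>[OF that] by (simp add: \<psi>_def)
  \<comment> \<open>Moving one coordinate by \<open>t\<close> raises \<open>g\<close> by at most
    this amount, which minimality makes nonnegative. Small \<open>t\<close> of either sign then
    decides the sign of \<open>1 - \<Psi> e\<close>.\<close>
  have var: "0 \<le> t * (1 - \<Psi> e + t * A e)" if e: "e \<in> X" and t: "0 \<le> y e + t" "y e + t \<le> 1" for e t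
  proof -
    let ?y = "y(e := y e + t)"
    have "?y \<in> K" using y t e by (auto simp: K_iff)
    from min[OF this] have "g y \<le> g ?y" .
    have sumy: "sum ?y T = sum y T + t * of_bool (e \<in> T)" if "T \<subseteq> X" for T
    proof (cases "e \<in> T")
      case True
      then have "sum ?y T = ?y e + sum ?y (T - {e})" "sum y T = y e + sum y (T - {e})"
        using finite_subset[OF that fX] sum.remove[of T e ?y] sum.remove[of T e y] by (simp_all only:)
      moreover have "sum ?y (T - {e}) = sum y (T - {e})" by (rule sum.cong) auto
      ultimately show ?thesis using True by simp
    next
      case False
      then show ?thesis by (auto intro!: sum.cong)
    qed
    have "(\<Sum>h\<in>C. \<kappa> h / 2 * (max 0 (1 - sum ?y (S h)))\<^sup>2) \<le>
      (\<Sum>h\<in>C. \<kappa> h / 2 * (max 0 (1 - sum y (S h)))\<^sup>2 + of_bool (e \<in> S h) * (- t * \<psi> h + t * t * (\<kappa> h / 2)))"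
    proof (rule sum_mono)
      fix h assume h: "h \<in> C"
      let ?a = "1 - sum y (S h)"
      show "\<kappa> h / 2 * (max 0 (1 - sum ?y (S h)))\<^sup>2 \<le>
         \<kappa> h / 2 * (max 0 ?a)\<^sup>2 + of_bool (e \<in> S h) * (- t * \<psi> h + t * t * (\<kappa> h / 2))"
      proof (cases "e \<in> S h")
        case True
        have "1 - sum ?y (S h) = ?a - t" using sumy[OF S[OF h]] True by simp
        \<comment> \<open>The squared positive part has a 2-Lipschitz derivative, so it lies below
          its tangent plus \<open>t\<^sup>2\<close>; this bound replaces differentiation.\<close>
        have "\<kappa> h / 2 * (max 0 (1 - sum ?y (S h)))\<^sup>2 \<le> \<kappa> h / 2 * ((max 0 ?a)\<^sup>2 - 2 * t * max 0 ?a + t\<^sup>2)"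
          unfolding \<open>1 - sum ?y (S h) = ?a - t\<close>
          using pos_part_square_diff_le[of ?a t] \<kappa>[OF h] by (intro mult_left_mono) auto
        also have "\<dots> = \<kappa> h / 2 * (max 0 ?a)\<^sup>2 + (- t * \<psi> h + t * t * (\<kappa> h / 2))"
          unfolding \<psi>_def by (simp add: algebra_simps power2_eq_square)
        finally show ?thesis using True by simp
      qed (use sumy[OF S[OF h]] in simp)
    qed
    also have "\<dots> = (\<Sum>h\<in>C. \<kappa> h / 2 * (max 0 (1 - sum y (S h)))\<^sup>2) + (\<Sum>h\<in>{h \<in> C. e \<in> S h}. - t * \<psi> h + t * t * (\<kappa> h / 2))"
      unfolding sum.distrib[of _ _ C] sum_of_bool_filter[OF fC] ..
    also have "(\<Sum>h\<in>{h \<in> C. e \<in> S h}. - t * \<psi> h + t * t * (\<kappa> h / 2)) = - t * \<Psi> e + t * t * A e"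
      unfolding \<Psi>_def A_def sum.distrib sum_distrib_left ..
    finally have "g ?y \<le> g y + (t - t * \<Psi> e + t * t * A e)"
      unfolding g_def using sumy[of X] e by simp
    with \<open>g y \<le> g ?y\<close> show ?thesis by (simp add: algebra_simps)
  qed
  have le1: "\<Psi> e \<le> 1" if e: "e \<in> X" for e
  proof (rule ccontr)
    assume gt: "\<not> \<Psi> e \<le> 1"
    have "y e \<noteq> 1"
    proof
      assume ye: "y e = 1"
      have "\<psi> h = 0" if h: "h \<in> C" "e \<in> S h" for h
      proof -
        have "y e \<le> sum y (S h)"
          using h S finite_subset[OF _ fX] y01 by (intro member_le_sum) auto
        then show ?thesis by (simp add: \<psi>_def ye)
      qed
      then have "\<Psi> e = 0" unfolding \<Psi>_def by (intro sum.neutral) auto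
      with gt show False by simp
    qed
    with y01(2)[of e] have ye: "y e < 1" by simp
    \<comment> \<open>Small enough that \<open>t * A e\<close> uses at most half of the gap
      \<open>\<Psi> e - 1\<close>; the \<open>+ 1\<close> guards against
      \<open>A e = 0\<close>.\<close>
    define t where "t = min (1 - y e) ((\<Psi> e - 1) / (2 * (A e + 1)))"
    have t: "0 < t" "t \<le> 1 - y e" "t \<le> (\<Psi> e - 1) / (2 * (A e + 1))"
      using ye gt A0[of e] by (auto simp: t_def)
    have "t * (A e + 1) \<le> (\<Psi> e - 1) / 2" using t(3) A0[of e] by (simp add: field_simps)
    moreover have "t * A e \<le> t * (A e + 1)" using t by simp
    ultimately have "1 - \<Psi> e + t * A e < 0" using gt by simp
    then have "t * (1 - \<Psi> e + t * A e) < 0" using t(1) by (simp add: mult_pos_neg)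
    then show False using var[OF e, of t] t y01(1)[of e] by auto
  qed
  have ge1: "1 \<le> \<Psi> e" if e: "e \<in> X" and ye: "0 < y e" for e
  proof (rule ccontr)
    assume lt: "\<not> 1 \<le> \<Psi> e"
    define t where "t = min (y e) ((1 - \<Psi> e) / (2 * (A e + 1)))"
    have t: "0 < t" "t \<le> y e" "t \<le> (1 - \<Psi> e) / (2 * (A e + 1))"
      using ye lt A0[of e] by (auto simp: t_def)
    have "t * (A e + 1) \<le> (1 - \<Psi> e) / 2" using t(3) A0[of e] by (simp add: field_simps)
    moreover have "t * A e \<le> t * (A e + 1)" using t by simp
    ultimately have "0 < 1 - \<Psi> e + (- t) * A e" using lt by simp
    then have "(- t) * (1 - \<Psi> e + (- t) * A e) < 0" using t(1) by (simp add: mult_neg_pos)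
    moreover have "0 \<le> (- t) * (1 - \<Psi> e + (- t) * A e)"
      using t y01(2)[of e] by (intro var[OF e]) auto
    ultimately show False by simp
  qed
  \<comment> \<open>Complementary slackness: either \<open>y e = 0\<close> or
    \<open>1 \<le> \<Psi> e\<close>.\<close>
  have "sum y X \<le> (\<Sum>e\<in>X. y e * \<Psi> e)"
    using ge1 y01(1) by (intro sum_mono) (metis less_eq_real_def mult.right_neutral mult_left_mono mult_zero_left)
  also have "\<dots> = (\<Sum>e\<in>X. \<Sum>h\<in>C. of_bool (e \<in> S h) * (y e * \<psi> h))"
    unfolding \<Psi>_def sum_of_bool_filter[OF fC] by (simp add: sum_distrib_left)
  also have "\<dots> = (\<Sum>h\<in>C. \<psi> h * sum y (S h))"
  proof (subst sum.swap, rule sum.cong[OF refl])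
    fix h assume h: "h \<in> C"
    have "(\<Sum>e\<in>X. of_bool (e \<in> S h) * (y e * \<psi> h)) = (\<Sum>e\<in>S h. y e * \<psi> h)"
      using S[OF h] fX by (intro sum.mono_neutral_cong_right) auto
    then show "(\<Sum>e\<in>X. of_bool (e \<in> S h) * (y e * \<psi> h)) = \<psi> h * sum y (S h)"
      by (simp add: sum_distrib_left mult.commute)
  qed
  also have "\<dots> \<le> (\<Sum>h\<in>C. \<psi> h)"
  proof (rule sum_mono)
    fix h assume h: "h \<in> C"
    show "\<psi> h * sum y (S h) \<le> \<psi> h"
    proof (cases "sum y (S h) \<le> 1")
      case True
      then show ?thesis using \<psi>0[OF h] by (rule mult_left_le)
    qed (simp add: \<psi>_def)
  qed
  finally have "sum y X \<le> (\<Sum>h\<in>C. \<psi> h)" .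
  with le1 show ?thesis
    unfolding \<Psi>_def \<psi>_def by (intro that[of y]) (use y01 in simp_all)
qed

section \<open>A nibble by averaging over single steps\<close>

lemma sum_of_bool_mem:
  fixes c :: real
  assumes "finite A"
  shows "(\<Sum>v\<in>A. of_bool (v \<in> e) * c) = real (card (e \<inter> A)) * c"
proof -
  have "(\<Sum>v\<in>A. of_bool (v \<in> e) * c) = (\<Sum>v\<in>A \<inter> {v. v \<in> e}. c)"
    by (subst sum.inter_restrict[OF assms]) (auto intro!: sum.cong)
  then show ?thesis by (simp add: Int_commute)
qed

section \<open>Scalar estimates for the survival of vertices in one step\<close>

lemma power_inverse_one_minus_ge:
  fixes x :: real
  assumes "0 \<le> x" "x < 1"
  shows "1 + real j * x \<le> (1 / (1 - x)) ^ j"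
proof -
  have "1 + real j * x \<le> (1 + x) ^ j"
    using assms Bernoulli_inequality[of x j] by simp
  also have "\<dots> \<le> (1 / (1 - x)) ^ j"
    using assms by (intro power_mono) (auto simp: field_simps)
  finally show ?thesis .
qed

lemma power_inverse_one_minus_le:
  fixes x :: real
  assumes "0 \<le> x" "x < 1" "2 * real n * x \<le> 1" "j \<le> n"
  shows "(1 / (1 - x)) ^ j \<le> 1 + 2 * real n * x"
proof -
  have 1: "1 - real n * x \<le> (1 - x) ^ n"
    using assms Bernoulli_inequality[of "-x" n] by simp
  have 2: "1 - real n * x > 0" using assms by (auto simp: mult_ac)
  have "(1 / (1 - x)) ^ j \<le> (1 / (1 - x)) ^ n"
    using assms by (intro power_increasing) (auto simp: field_simps)
  also have "\<dots> = 1 / (1 - x) ^ n" by (simp add: power_one_over)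
  also have "\<dots> \<le> 1 / (1 - real n * x)"
    using 1 2 by (intro divide_left_mono mult_pos_pos) auto
  also have "\<dots> \<le> 1 + 2 * real n * x"
  proof -
    have "0 \<le> (real n * x) * (1 - 2 * (real n * x))" using assms by (intro mult_nonneg_nonneg) auto
    then have "1 \<le> (1 + 2 * real n * x) * (1 - real n * x)" by (simp add: algebra_simps)
    then show ?thesis using 2 by (simp add: pos_divide_le_eq)
  qed
  finally show ?thesis .
qed

text \<open>An edge of size \<open>m\<close> survives with probability about
  \<open>1 - m * x\<close> and its weight is then multiplied by the power of
  \<open>1 / (1 - x)\<close>. The product is the survival probability \<open>1 - x\<close> of a
  single vertex up to second order, which is harmless over \<open>O(N)\<close> steps with
  \<open>x = 1 / N\<close>.\<close>

lemma edge_survival_rescaled_ge: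
  fixes x :: real
  assumes "0 \<le> x" "x < 1" "real k * x \<le> 1" "1 \<le> m" "m \<le> k"
  shows "1 - x - (real k * x)\<^sup>2 \<le> (1 / (1 - x)) ^ (m - 1) * (1 - real m * x)"
proof -
  have mx: "real m * x \<le> real k * x" using assms by (intro mult_right_mono) auto
  have "1 - x - (real k * x)\<^sup>2 \<le> 1 - x - (real m * x)\<^sup>2"
    using assms mx power_mono[OF mx, of 2] by auto
  also have "\<dots> \<le> (1 + real (m - 1) * x) * (1 - real m * x)"
    using assms by (simp add: of_nat_diff algebra_simps power2_eq_square)
  also have "\<dots> \<le> (1 / (1 - x)) ^ (m - 1) * (1 - real m * x)"
    using power_inverse_one_minus_ge[OF assms(1,2), of "m - 1"] mx assms by (intro mult_right_mono) auto
  finally show ?thesis .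
qed

text \<open>For two edges meeting in exactly one vertex, the rescaling exponents add up to
  \<open>s - 1\<close>, where \<open>s\<close> is the size of the union, so the product is again
  close to \<open>1 - x\<close>. The correction is of first order in \<open>x\<close> but carries
  the small codegree \<open>\<delta>\<close>.\<close>

lemma pair_survival_rescaled_le:
  fixes x :: real
  assumes "0 \<le> x" "x < 1" "4 * real k * x \<le> 1" "1 \<le> s" "s \<le> 2 * k" "0 \<le> \<delta>"
  shows "(1 / (1 - x)) ^ (s - 1) * (1 - real s * x + real s * (real s - 1) * \<delta> * x)
     \<le> (1 - x) + 8 * (real k)\<^sup>2 * \<delta> * x"
proof -
  have pos: "0 < 1 - x" using assms by auto
  have "1 - real s * x \<le> (1 - x) ^ s"
    using assms Bernoulli_inequality[of "-x" s] by simp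
  also have "\<dots> = (1 - x) * (1 - x) ^ (s - 1)"
    using assms(4) by (metis Suc_diff_1 less_eq_Suc_le One_nat_def power_Suc)
  finally have "(1 / (1 - x)) ^ (s - 1) * (1 - real s * x) \<le> (1 / (1 - x)) ^ (s - 1) * ((1 - x) * (1 - x) ^ (s - 1))"
    using pos by (intro mult_left_mono) auto
  also have "\<dots> = 1 - x" using pos by (simp add: power_one_over)
  finally have 1: "(1 / (1 - x)) ^ (s - 1) * (1 - real s * x) \<le> 1 - x" .
  have "(1 / (1 - x)) ^ (s - 1) \<le> 1 + 2 * real (2 * k) * x"
    using assms by (intro power_inverse_one_minus_le) auto
  then have 2: "(1 / (1 - x)) ^ (s - 1) \<le> 2" using assms by simp
  have "real s * (real s - 1) \<le> (2 * real k) * (2 * real k)"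
    using assms by (intro mult_mono) auto
  then have 3: "real s * (real s - 1) * \<delta> * x \<le> 4 * (real k)\<^sup>2 * \<delta> * x"
    using assms by (intro mult_right_mono) (auto simp: power2_eq_square)
  have 4: "0 \<le> real s * (real s - 1) * \<delta> * x" using assms by simp
  have "(1 / (1 - x)) ^ (s - 1) * (real s * (real s - 1) * \<delta> * x) \<le> 2 * (4 * (real k)\<^sup>2 * \<delta> * x)"
    by (rule mult_mono[OF 2 3 _ 4]) simp
  then show ?thesis using 1 by (simp add: distrib_left)
qed

text \<open>A fractional matching \<open>w\<close> with small codegrees. Edge sizes are bounded but
  not equal, because the copies to be packed may have different numbers of edges.\<close>

locale weighted_hypergraph =
  fixes V :: "'v set" and E :: "'v set set" and w :: "'v set \<Rightarrow> real" and k :: nat and \<delta> :: real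
  assumes fin_V: "finite V"
    and edge_sub: "e \<in> E \<Longrightarrow> e \<subseteq> V"
    and edge_ne: "e \<in> E \<Longrightarrow> e \<noteq> {}"
    and card_edge: "e \<in> E \<Longrightarrow> card e \<le> k"
    and w_nonneg: "e \<in> E \<Longrightarrow> 0 \<le> w e"
    and degree_le: "v \<in> V \<Longrightarrow> (\<Sum>e\<in>E. of_bool (v \<in> e) * w e) \<le> 1"
    and codegree_le: "u \<in> V \<Longrightarrow> v \<in> V \<Longrightarrow> u \<noteq> v \<Longrightarrow>
        (\<Sum>e\<in>E. of_bool (u \<in> e \<and> v \<in> e) * w e) \<le> \<delta>"
begin

lemma fin_E: "finite E"
  by (rule finite_subset[of _ "Pow V"]) (use edge_sub fin_V in auto)

lemma fin_edge: "e \<in> E \<Longrightarrow> finite e"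
  using edge_sub fin_V finite_subset by blast

lemma card_edge_pos: "e \<in> E \<Longrightarrow> 1 \<le> card e"
  using edge_ne fin_edge by (simp add: Suc_le_eq card_gt_0_iff)

section \<open>Matchings inside a set of surviving vertices\<close>

definition matchings :: "'v set \<Rightarrow> 'v set set set" where
  "matchings U = {M. M \<subseteq> E \<and> pairwise disjnt M \<and> \<Union>M \<subseteq> U}"

definition matching_number :: "'v set \<Rightarrow> nat" where
  "matching_number U = Max (card ` matchings U)"

lemma fin_matchings: "finite (matchings U)"
  by (rule finite_subset[of _ "Pow E"]) (use fin_E in \<open>auto simp: matchings_def\<close>)

lemma empty_matching: "{} \<in> matchings U"
  by (simp add: matchings_def)

lemma matching_number_ge: "M \<in> matchings U \<Longrightarrow> card M \<le> matching_number U"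
  unfolding matching_number_def using fin_matchings by (intro Max_ge) auto

lemma matching_number_attained: "\<exists>M\<in>matchings U. card M = matching_number U"
proof -
  have "matching_number U \<in> card ` matchings U"
    unfolding matching_number_def using fin_matchings empty_matching by (intro Max_in) auto
  then show ?thesis by auto
qed

lemma matching_number_mono: "U \<subseteq> U' \<Longrightarrow> matching_number U \<le> matching_number U'"
proof -
  assume "U \<subseteq> U'"
  then have "matchings U \<subseteq> matchings U'" by (auto simp: matchings_def)
  then show "matching_number U \<le> matching_number U'"
    using matching_number_attained[of U] matching_number_ge[of _ U'] by (metis subsetD)
qed

lemma matching_number_remove_edge:
  assumes "e \<in> E" "e \<subseteq> U"
  shows "matching_number (U - e) + 1 \<le> matching_number U"
proof -
  obtain M where M: "M \<in> matchings (U - e)" "card M = matching_number (U - e)"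
    using matching_number_attained by blast
  have fM: "finite M" using M(1) fin_E finite_subset by (auto simp: matchings_def)
  have notin: "e \<notin> M" using M(1) edge_ne[OF assms(1)] by (auto simp: matchings_def)
  have "insert e M \<in> matchings U"
    using M(1) assms by (auto simp: matchings_def pairwise_insert disjnt_def)
  from matching_number_ge[OF this] show ?thesis
    using fM notin M(2) by simp
qed

text \<open>Weights are rescaled by \<open>b\<close> to the power \<open>card e - 1\<close>, where \<open>1 / b\<close> is the survival
  probability of a vertex: conditionally on the survival of \<open>v\<close>, the expected rescaled degree of
  \<open>v\<close> stays constant.\<close>

definition wt :: "real \<Rightarrow> 'v set \<Rightarrow> real" where
  "wt b e = w e * b ^ (card e - 1)"

definition deg0 :: "'v \<Rightarrow> real" where
  "deg0 v = (\<Sum>e\<in>E. of_bool (v \<in> e) * w e)"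

definition deg :: "real \<Rightarrow> 'v set \<Rightarrow> 'v \<Rightarrow> real" where
  "deg b U v = (\<Sum>e\<in>E. of_bool (v \<in> e) * wt b e * of_bool (e \<subseteq> U))"

definition total_weight :: "real \<Rightarrow> 'v set \<Rightarrow> real" where
  "total_weight b U = (\<Sum>e\<in>E. wt b e * of_bool (e \<subseteq> U))"

text \<open>The second moment that stands in for concentration: only its mean is followed, and a
  Chebyshev-type bound turns it into control of the vertices of large degree.\<close>

definition deviation :: "real \<Rightarrow> 'v set \<Rightarrow> real" where
  "deviation b U = (\<Sum>v\<in>U. (deg b U v - deg0 v)\<^sup>2)"

lemma wt_nonneg: "e \<in> E \<Longrightarrow> 0 \<le> b \<Longrightarrow> 0 \<le> wt b e"
  by (simp add: wt_def w_nonneg)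

lemma deg0_bounds: "v \<in> V \<Longrightarrow> 0 \<le> deg0 v \<and> deg0 v \<le> 1"
  unfolding deg0_def using degree_le by (auto intro!: sum_nonneg simp: w_nonneg)

lemma deviation_nonneg: "0 \<le> deviation b U"
  by (simp add: deviation_def sum_nonneg)

lemma deg_nonneg: "0 \<le> b \<Longrightarrow> 0 \<le> deg b U v"
  unfolding deg_def by (intro sum_nonneg) (simp add: wt_nonneg)

lemma wt_le:
  assumes "e \<in> E" "1 \<le> b" "b ^ k \<le> B"
  shows "wt b e \<le> B * w e"
proof -
  have "b ^ (card e - 1) \<le> b ^ k"
    using card_edge[OF assms(1)] assms(2) by (intro power_increasing) auto
  then have "w e * b ^ (card e - 1) \<le> w e * B"
    using assms w_nonneg by (intro mult_left_mono) auto
  then show ?thesis by (simp add: wt_def mult.commute)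
qed

lemma deg_le:
  assumes "v \<in> V" "1 \<le> b" "b ^ k \<le> B"
  shows "deg b U v \<le> B"
proof -
  have B: "0 \<le> B" using assms by (smt (verit) one_le_power)
  have "deg b U v \<le> (\<Sum>e\<in>E. B * (of_bool (v \<in> e) * w e))"
    unfolding deg_def
    using wt_le[OF _ assms(2,3)] B w_nonneg wt_nonneg assms
    by (intro sum_mono) (auto simp: of_bool_def)
  also have "\<dots> = B * deg0 v" by (simp add: deg0_def sum_distrib_left)
  also have "\<dots> \<le> B * 1" using B deg0_bounds[OF assms(1)] by (intro mult_left_mono) auto
  finally show ?thesis by simp
qed

lemma codegree_wt_le:
  assumes "u \<in> V" "v \<in> V" "u \<noteq> v" "1 \<le> b" "b ^ k \<le> B"
  shows "(\<Sum>e\<in>E. of_bool (u \<in> e \<and> v \<in> e) * wt b e) \<le> B * \<delta>"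
proof -
  have B: "0 \<le> B" using assms by (smt (verit) one_le_power)
  have "(\<Sum>e\<in>E. of_bool (u \<in> e \<and> v \<in> e) * wt b e)
      \<le> (\<Sum>e\<in>E. B * (of_bool (u \<in> e \<and> v \<in> e) * w e))"
    using wt_le[OF _ assms(4,5)] by (intro sum_mono) (auto simp: of_bool_def)
  also have "\<dots> = B * (\<Sum>e\<in>E. of_bool (u \<in> e \<and> v \<in> e) * w e)" by (simp add: sum_distrib_left)
  also have "\<dots> \<le> B * \<delta>" using B codegree_le[OF assms(1-3)] by (intro mult_left_mono) auto
  finally show ?thesis .
qed

lemma sum_deg_eq:
  assumes "U \<subseteq> V"
  shows "(\<Sum>v\<in>U. deg b U v) = (\<Sum>e\<in>E. real (card e) * (wt b e * of_bool (e \<subseteq> U)))"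
proof -
  have fU: "finite U" using assms fin_V finite_subset by blast
  have "(\<Sum>v\<in>U. deg b U v) = (\<Sum>e\<in>E. \<Sum>v\<in>U. of_bool (v \<in> e) * (wt b e * of_bool (e \<subseteq> U)))"
    unfolding deg_def by (subst sum.swap) (simp add: mult.assoc)
  also have "\<dots> = (\<Sum>e\<in>E. real (card (e \<inter> U)) * (wt b e * of_bool (e \<subseteq> U)))"
    by (simp only: sum_of_bool_mem[OF fU])
  also have "\<dots> = (\<Sum>e\<in>E. real (card e) * (wt b e * of_bool (e \<subseteq> U)))"
    by (rule sum.cong) (auto simp: of_bool_def Int_absorb2)
  finally show ?thesis .
qed

lemma total_le_sum_deg:
  assumes "U \<subseteq> V" "0 \<le> b"
  shows "total_weight b U \<le> (\<Sum>v\<in>U. deg b U v)"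
  unfolding sum_deg_eq[OF assms(1)] total_weight_def
proof (rule sum_mono)
  fix e assume "e \<in> E"
  then show "wt b e * of_bool (e \<subseteq> U) \<le> real (card e) * (wt b e * of_bool (e \<subseteq> U))"
    using card_edge_pos[of e] wt_nonneg[OF _ assms(2), of e]
    by (intro mult_le_cancel_right1[THEN iffD2]) (auto simp: of_bool_def)
qed

lemma sum_deg_le:
  assumes "U \<subseteq> V" "1 \<le> b" "b ^ k \<le> B" "real (card V) \<le> N"
  shows "(\<Sum>v\<in>U. deg b U v) \<le> B * N"
proof -
  have "(\<Sum>v\<in>U. deg b U v) \<le> (\<Sum>v\<in>U. B)"
    using assms deg_le by (intro sum_mono) auto
  also have "\<dots> = real (card U) * B" by simp
  also have "\<dots> \<le> N * B"
  proof (rule mult_right_mono)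
    show "real (card U) \<le> N" using assms card_mono[OF fin_V assms(1)] by linarith
    show "0 \<le> B" using assms one_le_power[OF assms(2), of k] by linarith
  qed
  finally show ?thesis by (simp add: mult.commute)
qed

text \<open>One step picks the edge \<open>e\<close> with probability \<open>c e / N\<close>, the single vertex \<open>v\<close> with the
  probability that raises the chance of its removal to exactly \<open>1 / N\<close>, and nothing otherwise.\<close>

definition slack :: "('v set \<Rightarrow> real) \<Rightarrow> 'v \<Rightarrow> real" where
  "slack c v = 1 - (\<Sum>e\<in>E. of_bool (v \<in> e) * c e)"

definition step_mean :: "real \<Rightarrow> ('v set \<Rightarrow> real) \<Rightarrow> 'v set \<Rightarrow> ('v set \<Rightarrow> real) \<Rightarrow> real" where
  "step_mean N c U \<Phi> = ((\<Sum>e\<in>E. c e * \<Phi> (U - e)) + (\<Sum>v\<in>U. slack c v * \<Phi> (U - {v})) +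
     (N - (\<Sum>e\<in>E. c e) - (\<Sum>v\<in>U. slack c v)) * \<Phi> U) / N"

definition step_weights :: "'v set \<Rightarrow> ('v set \<Rightarrow> real) \<Rightarrow> bool" where
  "step_weights U c \<longleftrightarrow> U \<subseteq> V \<and> (\<forall>e\<in>E. 0 \<le> c e \<and> (\<not> e \<subseteq> U \<longrightarrow> c e = 0)) \<and>
     (\<forall>v\<in>U. (\<Sum>e\<in>E. of_bool (v \<in> e) * c e) \<le> 1)"

section \<open>Means over one step: monotonicity, gain and survival\<close>

lemma step_mean_sum:
  "step_mean N c U (\<lambda>U'. \<Sum>i\<in>I. a i * \<Phi> i U') = (\<Sum>i\<in>I. a i * step_mean N c U (\<Phi> i))"
proof -
  have 1: "(\<Sum>e\<in>E. c e * (\<Sum>i\<in>I. a i * \<Phi> i (U - e))) = (\<Sum>i\<in>I. a i * (\<Sum>e\<in>E. c e * \<Phi> i (U - e)))"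
    by (simp add: sum_distrib_left) (subst sum.swap, simp add: mult_ac)
  have 2: "(\<Sum>v\<in>U. slack c v * (\<Sum>i\<in>I. a i * \<Phi> i (U - {v}))) =
      (\<Sum>i\<in>I. a i * (\<Sum>v\<in>U. slack c v * \<Phi> i (U - {v})))"
    by (simp add: sum_distrib_left) (subst sum.swap, simp add: mult_ac)
  have 3: "(N - (\<Sum>e\<in>E. c e) - (\<Sum>v\<in>U. slack c v)) * (\<Sum>i\<in>I. a i * \<Phi> i U) =
      (\<Sum>i\<in>I. a i * ((N - (\<Sum>e\<in>E. c e) - (\<Sum>v\<in>U. slack c v)) * \<Phi> i U))"
    unfolding sum_distrib_left by (rule sum.cong[OF refl]) (rule mult.left_commute)
  show ?thesis
    unfolding step_mean_def 1 2 3
    by (simp only: sum.distrib[symmetric] sum_divide_distrib distrib_left[symmetric] times_divide_eq_right)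
qed

lemma step_mean_add: "step_mean N c U (\<lambda>U'. \<Phi> U' + \<Phi>' U') = step_mean N c U \<Phi> + step_mean N c U \<Phi>'"
  by (simp add: step_mean_def sum.distrib distrib_left add_divide_distrib)

lemma step_mean_cmult: "step_mean N c U (\<lambda>U'. r * \<Phi> U') = r * step_mean N c U \<Phi>"
  using step_mean_sum[of N c U "\<lambda>_. r" "\<lambda>_. \<Phi>" "{()}"] by simp

lemma step_mean_const: "N \<noteq> 0 \<Longrightarrow> step_mean N c U (\<lambda>_. r) = r"
  unfolding step_mean_def sum_distrib_right[symmetric] distrib_right[symmetric] by simp

text \<open>Every edge has a vertex, so the choices of an edge or of a single vertex have total mass
  at most \<open>card U\<close>, hence at most \<open>N\<close>. All coefficients of
  \<open>step_mean\<close> are then nonnegative, which makes it a genuine average.\<close>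

lemma
  assumes "step_weights U c" "real (card V) \<le> N"
  shows rest_nonneg: "0 \<le> N - (\<Sum>e\<in>E. c e) - (\<Sum>v\<in>U. slack c v)"
    and slack_nonneg: "\<And>v. v \<in> U \<Longrightarrow> 0 \<le> slack c v"
proof -
  have UV: "U \<subseteq> V" and c: "\<And>e. e \<in> E \<Longrightarrow> 0 \<le> c e" "\<And>e. e \<in> E \<Longrightarrow> \<not> e \<subseteq> U \<Longrightarrow> c e = 0"
    using assms by (auto simp: step_weights_def)
  have fU: "finite U" using UV fin_V finite_subset by blast
  have "(\<Sum>v\<in>U. \<Sum>e\<in>E. of_bool (v \<in> e) * c e) = (\<Sum>e\<in>E. real (card (e \<inter> U)) * c e)"
    by (subst sum.swap) (simp only: sum_of_bool_mem[OF fU])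
  also have "\<dots> \<ge> (\<Sum>e\<in>E. c e)"
  proof (rule sum_mono)
    fix e assume e: "e \<in> E"
    show "c e \<le> real (card (e \<inter> U)) * c e"
    proof (cases "e \<subseteq> U")
      case True
      then show ?thesis using card_edge_pos[OF e] c(1)[OF e]
        by (simp add: Int_absorb2 mult_le_cancel_right1)
    qed (use c e in auto)
  qed
  finally have "(\<Sum>e\<in>E. c e) + (\<Sum>v\<in>U. slack c v) \<le> card U"
    by (simp add: slack_def sum_subtractf)
  also have "\<dots> \<le> N" using card_mono[OF fin_V UV] assms(2) by linarith
  finally show "0 \<le> N - (\<Sum>e\<in>E. c e) - (\<Sum>v\<in>U. slack c v)" by simp
  show "0 \<le> slack c v" if "v \<in> U" for v
    using assms that by (simp add: slack_def step_weights_def)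
qed

lemma step_mean_mono:
  assumes "step_weights U c" "real (card V) \<le> N" "0 < N"
    and "\<And>U'. U' \<subseteq> V \<Longrightarrow> \<Phi> U' \<le> \<Phi>' U'"
  shows "step_mean N c U \<Phi> \<le> step_mean N c U \<Phi>'"
proof -
  have "U \<subseteq> V" using assms by (auto simp: step_weights_def)
  then have le: "\<Phi> (U - X) \<le> \<Phi>' (U - X)" for X using assms(4) by blast
  have le0: "\<Phi> U \<le> \<Phi>' U" using le[of "{}"] by simp
  show ?thesis
    unfolding step_mean_def
    using assms(1,3) le le0 rest_nonneg[OF assms(1,2)] slack_nonneg[OF assms(1,2)]
    by (intro divide_right_mono add_mono sum_mono mult_left_mono) (auto simp: step_weights_def)
qed

text \<open>A matching that avoids the chosen edge can be extended by it, so a gain of one occurs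
  with probability \<open>(\<Sum>e\<in>E. c e) / N\<close>; the other outcomes do not raise the
  matching number.\<close>

lemma matching_number_step:
  assumes sw: "step_weights U c" and "real (card V) \<le> N" "0 < N"
  shows "step_mean N c U (\<lambda>U'. real (matching_number U')) + (\<Sum>e\<in>E. c e) / N \<le> real (matching_number U)"
proof -
  let ?\<nu> = "\<lambda>U. real (matching_number U)"
  have "(\<Sum>e\<in>E. c e * (?\<nu> (U - e) + 1)) \<le> (\<Sum>e\<in>E. c e * ?\<nu> U)"
  proof (rule sum_mono)
    fix e assume e: "e \<in> E"
    show "c e * (?\<nu> (U - e) + 1) \<le> c e * ?\<nu> U"
    proof (cases "e \<subseteq> U")
      case True
      then show ?thesis using matching_number_remove_edge[OF e True] sw e
        by (intro mult_left_mono) (auto simp: step_weights_def)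
    qed (use sw e in \<open>auto simp: step_weights_def\<close>)
  qed
  then have 1: "(\<Sum>e\<in>E. c e * ?\<nu> (U - e)) + (\<Sum>e\<in>E. c e) \<le> (\<Sum>e\<in>E. c e) * ?\<nu> U"
    by (simp add: distrib_left sum.distrib sum_distrib_right)
  have 2: "(\<Sum>v\<in>U. slack c v * ?\<nu> (U - {v})) \<le> (\<Sum>v\<in>U. slack c v) * ?\<nu> U"
    unfolding sum_distrib_right using slack_nonneg[OF assms(1,2)] matching_number_mono[of "U - {_}" U]
    by (intro sum_mono mult_left_mono) auto
  show ?thesis
    unfolding step_mean_def add_divide_distrib[symmetric]
    using 1 2 assms(3) by (subst pos_divide_le_eq) (auto simp: algebra_simps)
qed

text \<open>The slack makes each vertex disappear with probability exactly \<open>1 / N\<close>, so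
  \<open>card S / N\<close> is the union bound for losing a vertex of \<open>S\<close>. It counts an
  edge once for each vertex that it has in \<open>S\<close>; the last sum gives back this
  overcount.\<close>

lemma step_mean_survival:
  assumes sw: "step_weights U c" and "0 < N" and S: "S \<subseteq> U"
  shows "step_mean N c U (\<lambda>U'. of_bool (S \<subseteq> U')) =
     1 - real (card S) / N + (\<Sum>e\<in>E. c e * (real (card (e \<inter> S)) - of_bool (e \<inter> S \<noteq> {}))) / N"
proof -
  have UV: "U \<subseteq> V" using sw by (auto simp: step_weights_def)
  have fU: "finite U" using UV fin_V finite_subset by blast
  have fS: "finite S" using S fU finite_subset by blast
  have 1: "(\<Sum>e\<in>E. c e * of_bool (S \<subseteq> U - e)) = (\<Sum>e\<in>E. c e) - (\<Sum>e\<in>E. c e * of_bool (e \<inter> S \<noteq> {}))"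
    unfolding sum_subtractf[symmetric] using S by (intro sum.cong) (auto simp: of_bool_def)
  have "(\<Sum>v\<in>U. slack c v * of_bool (S \<subseteq> U - {v})) = (\<Sum>v\<in>U. slack c v - slack c v * of_bool (v \<in> S))"
    using S by (intro sum.cong) (auto simp: of_bool_def)
  also have "\<dots> = (\<Sum>v\<in>U. slack c v) - (\<Sum>v\<in>S. slack c v)"
  proof -
    have "(\<Sum>v\<in>U. slack c v * of_bool (v \<in> S)) = (\<Sum>v\<in>S. slack c v)"
      using S fU by (intro sum.mono_neutral_cong_right) auto
    then show ?thesis by (simp add: sum_subtractf)
  qed
  also have "(\<Sum>v\<in>S. slack c v) = card S - (\<Sum>e\<in>E. real (card (e \<inter> S)) * c e)"
  proof -
    have "(\<Sum>v\<in>S. \<Sum>e\<in>E. of_bool (v \<in> e) * c e) = (\<Sum>e\<in>E. real (card (e \<inter> S)) * c e)"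
      by (subst sum.swap) (simp only: sum_of_bool_mem[OF fS])
    then show ?thesis by (simp add: slack_def sum_subtractf)
  qed
  finally have 2: "(\<Sum>v\<in>U. slack c v * of_bool (S \<subseteq> U - {v})) =
     (\<Sum>v\<in>U. slack c v) - (card S - (\<Sum>e\<in>E. real (card (e \<inter> S)) * c e))" .
  have "step_mean N c U (\<lambda>U'. of_bool (S \<subseteq> U')) =
     (N - real (card S) + ((\<Sum>e\<in>E. real (card (e \<inter> S)) * c e) - (\<Sum>e\<in>E. c e * of_bool (e \<inter> S \<noteq> {})))) / N"
    unfolding step_mean_def 1 2 using S by simp
  also have "(\<Sum>e\<in>E. real (card (e \<inter> S)) * c e) - (\<Sum>e\<in>E. c e * of_bool (e \<inter> S \<noteq> {})) =
     (\<Sum>e\<in>E. c e * (real (card (e \<inter> S)) - of_bool (e \<inter> S \<noteq> {})))"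
    by (simp add: sum_subtractf right_diff_distrib mult.commute)
  finally show ?thesis using assms(2) by (simp add: add_divide_distrib diff_divide_distrib)
qed

lemma step_mean_not_survival:
  assumes "\<not> S \<subseteq> U"
  shows "step_mean N c U (\<lambda>U'. of_bool (S \<subseteq> U')) = 0"
proof -
  have "\<not> S \<subseteq> U - X" for X using assms by blast
  then show ?thesis using assms by (simp add: step_mean_def)
qed

lemma survival_lower:
  assumes sw: "step_weights U c" and "0 < N" and S: "S \<subseteq> U"
  shows "1 - real (card S) / N \<le> step_mean N c U (\<lambda>U'. of_bool (S \<subseteq> U'))"
proof -
  have fS: "finite S" using S sw fin_V by (meson finite_subset step_weights_def)
  have "0 \<le> (\<Sum>e\<in>E. c e * (real (card (e \<inter> S)) - of_bool (e \<inter> S \<noteq> {})))"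
  proof (intro sum_nonneg mult_nonneg_nonneg)
    fix e assume "e \<in> E"
    have "e \<inter> S \<noteq> {} \<Longrightarrow> 1 \<le> card (e \<inter> S)" using fS by (simp add: Suc_le_eq card_gt_0_iff)
    then show "0 \<le> real (card (e \<inter> S)) - of_bool (e \<inter> S \<noteq> {})" by (auto simp: of_bool_def)
  qed (use sw in \<open>auto simp: step_weights_def\<close>)
  then show ?thesis unfolding step_mean_survival[OF assms] using assms(2) by simp
qed

text \<open>The overcount \<open>m - 1\<close> of an edge with \<open>m \<ge> 1\<close> vertices in
  \<open>S\<close> is at most \<open>m * (m - 1)\<close>, the number of ordered pairs of distinct
  vertices of \<open>S\<close> in that edge. Summing over pairs first brings in the
  codegrees.\<close>

lemma survival_upper:
  assumes sw: "step_weights U c" and "0 < N" and S: "S \<subseteq> U"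
    and cod: "\<And>u v. u \<in> V \<Longrightarrow> v \<in> V \<Longrightarrow> u \<noteq> v \<Longrightarrow> (\<Sum>e\<in>E. of_bool (u \<in> e \<and> v \<in> e) * c e) \<le> \<delta>'"
  shows "step_mean N c U (\<lambda>U'. of_bool (S \<subseteq> U')) \<le>
     1 - real (card S) / N + real (card S) * (real (card S) - 1) * \<delta>' / N"
proof -
  have SV: "S \<subseteq> V" using S sw by (auto simp: step_weights_def)
  have fS: "finite S" using SV fin_V finite_subset by blast
  have "(\<Sum>e\<in>E. c e * (real (card (e \<inter> S)) - of_bool (e \<inter> S \<noteq> {})))
      \<le> (\<Sum>e\<in>E. \<Sum>u\<in>S. \<Sum>v\<in>S-{u}. of_bool (u \<in> e \<and> v \<in> e) * c e)"
  proof (rule sum_mono)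
    fix e assume e: "e \<in> E"
    let ?m = "card (e \<inter> S)"
    have "(\<Sum>u\<in>S. \<Sum>v\<in>S-{u}. of_bool (u \<in> e \<and> v \<in> e) * c e) =
       (\<Sum>u\<in>S. of_bool (u \<in> e) * ((real ?m - 1) * c e))"
    proof (rule sum.cong[OF refl])
      fix u assume u: "u \<in> S"
      have "(\<Sum>v\<in>S-{u}. of_bool (u \<in> e \<and> v \<in> e) * c e) = of_bool (u \<in> e) * (\<Sum>v\<in>S-{u}. of_bool (v \<in> e) * c e)"
        by (simp add: sum_distrib_left of_bool_conj mult.assoc)
      also have "\<dots> = of_bool (u \<in> e) * (real (card (e \<inter> (S - {u}))) * c e)"
        using fS by (subst sum_of_bool_mem) auto
      also have "\<dots> = of_bool (u \<in> e) * ((real ?m - 1) * c e)"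
      proof (cases "u \<in> e")
        case True
        then have "e \<inter> (S - {u}) = (e \<inter> S) - {u}" "u \<in> e \<inter> S" using u by auto
        moreover have "card ((e \<inter> S) - {u}) = card (e \<inter> S) - 1" "1 \<le> card (e \<inter> S)"
          using \<open>u \<in> e \<inter> S\<close> fS by (auto simp: Suc_le_eq card_gt_0_iff)
        ultimately show ?thesis by (simp add: of_nat_diff)
      qed simp
      finally show "(\<Sum>v\<in>S-{u}. of_bool (u \<in> e \<and> v \<in> e) * c e) = of_bool (u \<in> e) * ((real ?m - 1) * c e)" .
    qed
    also have "\<dots> = real ?m * ((real ?m - 1) * c e)" by (rule sum_of_bool_mem[OF fS])
    also have "\<dots> \<ge> c e * (real ?m - of_bool (e \<inter> S \<noteq> {}))"
    proof (cases "e \<inter> S = {}")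
      case False
      then have "1 \<le> ?m" using fS by (simp add: Suc_le_eq card_gt_0_iff)
      then have "(real ?m - 1) * 1 \<le> (real ?m - 1) * real ?m" by (intro mult_left_mono) auto
      then have "c e * (real ?m - 1) \<le> c e * ((real ?m - 1) * real ?m)"
        using sw e by (intro mult_left_mono) (auto simp: step_weights_def)
      then show ?thesis using False by (simp add: mult_ac)
    qed simp
    finally show "c e * (real ?m - of_bool (e \<inter> S \<noteq> {})) \<le>
       (\<Sum>u\<in>S. \<Sum>v\<in>S-{u}. of_bool (u \<in> e \<and> v \<in> e) * c e)" .
  qed
  also have "\<dots> = (\<Sum>u\<in>S. \<Sum>v\<in>S-{u}. \<Sum>e\<in>E. of_bool (u \<in> e \<and> v \<in> e) * c e)"
    by (subst sum.swap, rule sum.cong[OF refl], subst sum.swap, rule refl)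
  also have "\<dots> \<le> (\<Sum>u\<in>S. \<Sum>v\<in>S-{u}. \<delta>')"
    using SV cod by (intro sum_mono) auto
  also have "\<dots> = real (card S) * (real (card S) - 1) * \<delta>'"
    using fS by (cases "S = {}") (auto simp: of_nat_diff Suc_le_eq card_gt_0_iff)
  finally have "(\<Sum>e\<in>E. c e * (real (card (e \<inter> S)) - of_bool (e \<inter> S \<noteq> {}))) / N \<le>
     real (card S) * (real (card S) - 1) * \<delta>' / N"
    using assms(2) by (intro divide_right_mono) auto
  then show ?thesis unfolding step_mean_survival[OF assms(1-3)] by simp
qed


text \<open>Passing from \<open>b\<close> to \<open>b / (1 - 1 / N)\<close> offsets the loss of
  edges up to the factor of a single vertex. The coefficients \<open>a\<close> let one statement
  serve both the total weight and \<open>cross_sum\<close>.\<close>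

lemma weighted_total_step:
  assumes sw: "step_weights U c" and N: "0 < N" "1 < N" "real k \<le> N" and b: "0 \<le> b"
    and a: "\<And>e. e \<in> E \<Longrightarrow> 0 \<le> a e"
  shows "(1 - 1 / N - (real k / N)\<^sup>2) * (\<Sum>e\<in>E. a e * wt b e * of_bool (e \<subseteq> U)) \<le>
    step_mean N c U (\<lambda>U'. \<Sum>e\<in>E. a e * wt (b / (1 - 1 / N)) e * of_bool (e \<subseteq> U'))"
  unfolding step_mean_sum sum_distrib_left
proof (rule sum_mono)
  fix e assume e: "e \<in> E"
  show "(1 - 1 / N - (real k / N)\<^sup>2) * (a e * wt b e * of_bool (e \<subseteq> U))
     \<le> a e * wt (b / (1 - 1 / N)) e * step_mean N c U (\<lambda>U'. of_bool (e \<subseteq> U'))"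
  proof (cases "e \<subseteq> U")
    case True
    let ?m = "card e" and ?\<beta> = "1 / (1 - 1 / N)"
    have "1 - 1 / N - (real k * (1 / N))\<^sup>2 \<le> ?\<beta> ^ (?m - 1) * (1 - real ?m * (1 / N))"
      using N card_edge_pos[OF e] card_edge[OF e] by (intro edge_survival_rescaled_ge) auto
    also have "\<dots> \<le> ?\<beta> ^ (?m - 1) * step_mean N c U (\<lambda>U'. of_bool (e \<subseteq> U'))"
      using survival_lower[OF sw N(1) True] N by (intro mult_left_mono) auto
    finally have "(a e * wt b e) * (1 - 1 / N - (real k * (1 / N))\<^sup>2) \<le>
       (a e * wt b e) * (?\<beta> ^ (?m - 1) * step_mean N c U (\<lambda>U'. of_bool (e \<subseteq> U')))"
      using a[OF e] wt_nonneg[OF e b] by (intro mult_left_mono) auto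
    moreover have "wt (b / (1 - 1 / N)) e = wt b e * ?\<beta> ^ (?m - 1)"
      by (simp add: wt_def power_divide)
    ultimately show ?thesis using True by (simp add: mult_ac)
  qed (simp add: step_mean_not_survival)
qed

section \<open>One step of the degree deviation\<close>

lemma deg_eq_0: "v \<notin> U \<Longrightarrow> deg b U v = 0"
  unfolding deg_def by (rule sum.neutral) (auto simp: of_bool_def)

text \<open>Expanding the square in \<open>deviation\<close> gives sums over index sets that do not
  depend on \<open>U\<close>, where \<open>U\<close> enters only through indicators of survival;
  means over a step can then be taken term by term.\<close>

definition pair_sum :: "real \<Rightarrow> 'v set \<Rightarrow> real" where
  "pair_sum b U = (\<Sum>(v, e, e')\<in>V \<times> E \<times> E. of_bool (v \<in> e \<and> v \<in> e') * wt b e * wt b e' * of_bool (e \<union> e' \<subseteq> U))"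

definition cross_sum :: "real \<Rightarrow> 'v set \<Rightarrow> real" where
  "cross_sum b U = (\<Sum>e\<in>E. (\<Sum>v\<in>V. of_bool (v \<in> e) * deg0 v) * wt b e * of_bool (e \<subseteq> U))"

lemma pair_sum_eq: "pair_sum b U = (\<Sum>v\<in>V. (deg b U v)\<^sup>2)"
proof -
  have "(\<Sum>v\<in>V. (deg b U v)\<^sup>2) = (\<Sum>v\<in>V. \<Sum>e\<in>E. \<Sum>e'\<in>E.
     of_bool (v \<in> e \<and> v \<in> e') * wt b e * wt b e' * of_bool (e \<union> e' \<subseteq> U))"
    unfolding deg_def power2_eq_square sum_product
    by (intro sum.cong refl) (auto simp: of_bool_def)
  then show ?thesis by (simp add: pair_sum_def sum.cartesian_product)
qed

lemma cross_sum_eq: "cross_sum b U = (\<Sum>v\<in>V. deg0 v * deg b U v)"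
  unfolding cross_sum_def deg_def sum_distrib_left sum_distrib_right
  by (subst sum.swap) (simp add: mult_ac)

lemma deviation_eq:
  assumes "U \<subseteq> V"
  shows "deviation b U = pair_sum b U - 2 * cross_sum b U + (\<Sum>v\<in>V. (deg0 v)\<^sup>2 * of_bool ({v} \<subseteq> U))"
proof -
  have "deviation b U = (\<Sum>v\<in>V. of_bool (v \<in> U) * (deg b U v - deg0 v)\<^sup>2)"
    unfolding deviation_def using assms fin_V by (intro sum.mono_neutral_cong_left) auto
  also have "\<dots> = (\<Sum>v\<in>V. (deg b U v)\<^sup>2 - 2 * (deg0 v * deg b U v) + (deg0 v)\<^sup>2 * of_bool ({v} \<subseteq> U))"
    by (intro sum.cong refl) (auto simp: of_bool_def deg_eq_0 power2_diff)
  finally show ?thesis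
    by (simp add: pair_sum_eq cross_sum_eq sum.distrib sum_subtractf sum_distrib_left)
qed

text \<open>For fixed \<open>v\<close> and \<open>e\<close>, an edge \<open>e'\<close> through
  \<open>v\<close> with a larger intersection passes through another vertex of \<open>e\<close>.
  There are fewer than \<open>k\<close> of these, and each contributes one codegree. The diagonal
  case \<open>e' = e\<close> is included when \<open>e\<close> has further vertices.\<close>

lemma pair_overlap_le:
  assumes U: "U \<subseteq> V" and b: "1 \<le> b" "b ^ k \<le> B" and N: "real (card V) \<le> N" and \<delta>: "0 \<le> \<delta>"
  shows "(\<Sum>(v, e, e')\<in>V \<times> E \<times> E. of_bool (v \<in> e \<and> v \<in> e') * wt b e * wt b e' * of_bool (e \<union> e' \<subseteq> U)
      * of_bool (e \<inter> e' \<noteq> {v})) \<le> real k * (B * \<delta>) * (B * N)"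
proof -
  have B: "0 \<le> B" using b by (smt (verit) one_le_power)
  have "(\<Sum>(v, e, e')\<in>V \<times> E \<times> E. of_bool (v \<in> e \<and> v \<in> e') * wt b e * wt b e' * of_bool (e \<union> e' \<subseteq> U)
      * of_bool (e \<inter> e' \<noteq> {v})) =
    (\<Sum>v\<in>V. \<Sum>e\<in>E. of_bool (v \<in> e) * wt b e * of_bool (e \<subseteq> U) *
       (\<Sum>e'\<in>E. of_bool (v \<in> e') * wt b e' * of_bool (e' \<subseteq> U) * of_bool (e \<inter> e' \<noteq> {v})))"
    unfolding sum.cartesian_product[symmetric] sum_distrib_left
    by (intro sum.cong refl) (auto simp: of_bool_def)
  also have "\<dots> \<le> (\<Sum>v\<in>V. \<Sum>e\<in>E. of_bool (v \<in> e) * wt b e * of_bool (e \<subseteq> U) * (real k * (B * \<delta>)))"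
  proof (intro sum_mono)
    fix v e assume v: "v \<in> V" and e: "e \<in> E"
    show "of_bool (v \<in> e) * wt b e * of_bool (e \<subseteq> U) *
       (\<Sum>e'\<in>E. of_bool (v \<in> e') * wt b e' * of_bool (e' \<subseteq> U) * of_bool (e \<inter> e' \<noteq> {v}))
       \<le> of_bool (v \<in> e) * wt b e * of_bool (e \<subseteq> U) * (real k * (B * \<delta>))"
    proof (cases "v \<in> e")
      case True
      have "(\<Sum>e'\<in>E. of_bool (v \<in> e') * wt b e' * of_bool (e' \<subseteq> U) * of_bool (e \<inter> e' \<noteq> {v}))
        \<le> (\<Sum>e'\<in>E. \<Sum>u\<in>e - {v}. of_bool (u \<in> e' \<and> v \<in> e') * wt b e')"
      proof (rule sum_mono)
        fix e' assume e': "e' \<in> E"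
        have w: "0 \<le> wt b e'" using wt_nonneg[OF e'] b by simp
        show "of_bool (v \<in> e') * wt b e' * of_bool (e' \<subseteq> U) * of_bool (e \<inter> e' \<noteq> {v})
          \<le> (\<Sum>u\<in>e - {v}. of_bool (u \<in> e' \<and> v \<in> e') * wt b e')"
        proof (cases "v \<in> e' \<and> e \<inter> e' \<noteq> {v}")
          case t: True
          then obtain u where u: "u \<in> e - {v}" "u \<in> e'" using True by auto
          have "wt b e' \<le> (\<Sum>u\<in>e - {v}. of_bool (u \<in> e' \<and> v \<in> e') * wt b e')"
            using member_le_sum[of u "e - {v}" "\<lambda>u. of_bool (u \<in> e' \<and> v \<in> e') * wt b e'"] u t w fin_edge[OF e]
            by simp
          moreover have "of_bool (v \<in> e') * wt b e' * of_bool (e' \<subseteq> U) * of_bool (e \<inter> e' \<noteq> {v}) \<le> wt b e'"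
            using w by (simp add: of_bool_def)
          ultimately show ?thesis by (rule order_trans[rotated])
        next
          case False
          then have "of_bool (v \<in> e') * wt b e' * of_bool (e' \<subseteq> U) * of_bool (e \<inter> e' \<noteq> {v}) = 0"
            by auto
          moreover have "0 \<le> (\<Sum>u\<in>e - {v}. of_bool (u \<in> e' \<and> v \<in> e') * wt b e')"
            by (intro sum_nonneg mult_nonneg_nonneg) (simp_all add: w)
          ultimately show ?thesis by (simp only:)
        qed
      qed
      also have "\<dots> = (\<Sum>u\<in>e - {v}. \<Sum>e'\<in>E. of_bool (u \<in> e' \<and> v \<in> e') * wt b e')"
        by (rule sum.swap)
      also have "\<dots> \<le> (\<Sum>u\<in>e - {v}. B * \<delta>)"
        using v edge_sub[OF e] b by (intro sum_mono codegree_wt_le) auto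
      also have "\<dots> = real (card (e - {v})) * (B * \<delta>)" by simp
      also have "\<dots> \<le> real k * (B * \<delta>)"
        using card_edge[OF e] card_mono[OF fin_edge[OF e], of "e - {v}"] B \<delta>
        by (intro mult_right_mono) auto
      finally show ?thesis using wt_nonneg[OF e, of b] b by (intro mult_left_mono) auto
    qed simp
  qed
  also have "\<dots> = real k * (B * \<delta>) * (\<Sum>v\<in>V. deg b U v)"
    unfolding deg_def by (simp add: sum_distrib_left sum_distrib_right mult_ac)
  also have "(\<Sum>v\<in>V. deg b U v) = (\<Sum>v\<in>U. deg b U v)"
    using U fin_V deg_eq_0 by (intro sum.mono_neutral_right) auto
  also have "real k * (B * \<delta>) * \<dots> \<le> real k * (B * \<delta>) * (B * N)"
    using sum_deg_le[OF U b N] B \<delta> by (intro mult_left_mono) auto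
  finally show ?thesis .
qed

lemma pair_sum_le:
  assumes U: "U \<subseteq> V" and b: "1 \<le> b" "b ^ k \<le> B" and N: "real (card V) \<le> N"
  shows "pair_sum b U \<le> B\<^sup>2 * N"
proof -
  have "pair_sum b U \<le> (\<Sum>v\<in>V. B\<^sup>2)"
    unfolding pair_sum_eq using deg_le[OF _ b] deg_nonneg b by (intro sum_mono power_mono) auto
  also have "\<dots> = B\<^sup>2 * real (card V)" by simp
  also have "\<dots> \<le> B\<^sup>2 * N" using N by (intro mult_left_mono) auto
  finally show ?thesis .
qed

lemma cross_sum_le:
  assumes U: "U \<subseteq> V" and b: "1 \<le> b" "b ^ k \<le> B" and N: "real (card V) \<le> N"
  shows "cross_sum b U \<le> B * N"
proof -
  have B: "0 \<le> B" using b by (smt (verit) one_le_power)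
  have "cross_sum b U \<le> (\<Sum>v\<in>V. 1 * B)"
    unfolding cross_sum_eq using deg_le[OF _ b] deg_nonneg b deg0_bounds by (intro sum_mono mult_mono) auto
  also have "\<dots> = B * real (card V)" by simp
  also have "\<dots> \<le> B * N" using N B by (intro mult_left_mono) auto
  finally show ?thesis .
qed

text \<open>Pairs of edges meeting only in \<open>v\<close> get the sharp survival bound. For the
  others survival is bounded by \<open>1\<close>, a relative error \<open>O(1/N)\<close> on a total
  weight of only \<open>O(\<delta> * N)\<close>. For fixed \<open>k\<close> and \<open>B\<close> the
  additive error per step is thus \<open>O(\<delta>)\<close>.\<close>

lemma pair_sum_step:
  assumes sw: "step_weights U c" and N: "1 < N" "4 * real k \<le> N" "real (card V) \<le> N"
    and b: "1 \<le> b" "b ^ k \<le> B" and \<delta>: "0 \<le> \<delta>"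
    and c_le: "\<And>e. e \<in> E \<Longrightarrow> c e \<le> wt b e"
  shows "step_mean N c U (pair_sum (b / (1 - 1 / N))) \<le>
    (1 - 1 / N) * pair_sum b U + (8 * (real k)\<^sup>2 * (B * \<delta>) * B\<^sup>2 + (4 * real k + 1) * (real k * (B * \<delta>) * B))"
proof -
  let ?\<beta> = "1 / (1 - 1 / N)" and ?x = "1 / N" and ?\<delta> = "B * \<delta>"
  have U: "U \<subseteq> V" using sw by (simp add: step_weights_def)
  have N0: "0 < N" using N by simp
  have B: "0 \<le> B" using b by (smt (verit) one_le_power)
  have cod: "(\<Sum>e\<in>E. of_bool (u \<in> e \<and> v \<in> e) * c e) \<le> ?\<delta>" if "u \<in> V" "v \<in> V" "u \<noteq> v" for u v
  proof -
    have "(\<Sum>e\<in>E. of_bool (u \<in> e \<and> v \<in> e) * c e) \<le> (\<Sum>e\<in>E. of_bool (u \<in> e \<and> v \<in> e) * wt b e)"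
      using c_le by (intro sum_mono mult_left_mono) auto
    also have "\<dots> \<le> ?\<delta>" using codegree_wt_le[OF that b] .
    finally show ?thesis .
  qed
  define p where "p = (\<lambda>(v, e, e'). of_bool (v \<in> e \<and> v \<in> e') * wt b e * wt b e' :: real)"
  define p' where "p' = (\<lambda>(v, e, e'). of_bool (v \<in> e \<and> v \<in> e') * wt (b * ?\<beta>) e * wt (b * ?\<beta>) e' :: real)"
  define S where "S = (\<lambda>(v :: 'v, e, e'). e \<union> e' :: 'v set)"
  define T where "T = V \<times> E \<times> E"
  have ps: "pair_sum b U' = (\<Sum>i\<in>T. p i * of_bool (S i \<subseteq> U'))" for U'
    unfolding pair_sum_def p_def S_def T_def by (intro sum.cong) auto
  have ps': "pair_sum (b / (1 - 1 / N)) = (\<lambda>U'. \<Sum>i\<in>T. p' i * of_bool (S i \<subseteq> U'))"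
    unfolding pair_sum_def p'_def S_def T_def by (intro ext sum.cong) auto
  have "step_mean N c U (pair_sum (b / (1 - 1 / N))) = (\<Sum>i\<in>T. p' i * step_mean N c U (\<lambda>U'. of_bool (S i \<subseteq> U')))"
    unfolding ps' by (rule step_mean_sum)
  also have "\<dots> \<le> (\<Sum>i\<in>T. p i * of_bool (S i \<subseteq> U) * ((1 - ?x) + 8 * (real k)\<^sup>2 * ?\<delta> * ?x
      + (4 * real k + 1) * ?x * of_bool (fst (snd i) \<inter> snd (snd i) \<noteq> {fst i})))"
  proof (rule sum_mono)
    fix i assume "i \<in> T"
    then obtain v e e' where i: "i = (v, e, e')" and v: "v \<in> V" and e: "e \<in> E" and e': "e' \<in> E"
      unfolding T_def by auto
    define A where "A = step_mean N c U (\<lambda>U'. of_bool (e \<union> e' \<subseteq> U'))"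
    show "p' i * step_mean N c U (\<lambda>U'. of_bool (S i \<subseteq> U')) \<le> p i * of_bool (S i \<subseteq> U) * ((1 - ?x) + 8 * (real k)\<^sup>2 * ?\<delta> * ?x
      + (4 * real k + 1) * ?x * of_bool (fst (snd i) \<inter> snd (snd i) \<noteq> {fst i}))"
    proof (cases "v \<in> e \<and> v \<in> e' \<and> e \<union> e' \<subseteq> U")
      case False
      have "step_mean N c U (\<lambda>U'. of_bool (S i \<subseteq> U')) = 0 \<or> p' i = 0" "p i * of_bool (S i \<subseteq> U) = 0"
        using False step_mean_not_survival[of "S i" U N c] by (auto simp: i p_def p'_def S_def)
      then show ?thesis by auto
    next
      case True
      have pos: "1 \<le> card e" "1 \<le> card e'" using card_edge_pos e e' by auto
      have le: "card e \<le> k" "card e' \<le> k" using card_edge e e' by auto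
      have "?\<beta> ^ (card e - 1 + (card e' - 1)) * A \<le> (1 - ?x) + 8 * (real k)\<^sup>2 * ?\<delta> * ?x
           + (4 * real k + 1) * ?x * of_bool (e \<inter> e' \<noteq> {v})"
      proof (cases "e \<inter> e' = {v}")
        case one: True
        have "card e + card e' = card (e \<union> e') + 1"
          using card_Un_Int[OF fin_edge[OF e] fin_edge[OF e']] one by simp
        then have s: "card e - 1 + (card e' - 1) = card (e \<union> e') - 1" "1 \<le> card (e \<union> e')" "card (e \<union> e') \<le> 2 * k"
          using pos le by auto
        have "?\<beta> ^ (card (e \<union> e') - 1) * A \<le> ?\<beta> ^ (card (e \<union> e') - 1) *
            (1 - real (card (e \<union> e')) * ?x + real (card (e \<union> e')) * (real (card (e \<union> e')) - 1) * ?\<delta> * ?x)"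
          using survival_upper[OF sw N0 _ cod, of "e \<union> e'"] True N
          unfolding A_def by (intro mult_left_mono) auto
        also have "\<dots> \<le> (1 - ?x) + 8 * (real k)\<^sup>2 * ?\<delta> * ?x"
          using N s B \<delta> by (intro pair_survival_rescaled_le) auto
        finally show ?thesis using one s by simp
      next
        case two: False
        have "A \<le> step_mean N c U (\<lambda>_. 1)"
          unfolding A_def using N N0 by (intro step_mean_mono[OF sw]) auto
        then have "A \<le> 1" using N0 by (simp add: step_mean_const)
        have "?\<beta> ^ (card e - 1 + (card e' - 1)) * A \<le> ?\<beta> ^ (card e - 1 + (card e' - 1)) * 1"
          using \<open>A \<le> 1\<close> N by (intro mult_left_mono) auto
        also have "\<dots> \<le> 1 + 2 * real (2 * k) * ?x"
          unfolding mult_1_right using N le by (intro power_inverse_one_minus_le) auto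
        also have "\<dots> \<le> (1 - ?x) + 8 * (real k)\<^sup>2 * ?\<delta> * ?x + (4 * real k + 1) * ?x"
          using B \<delta> N0 by (simp add: field_simps)
        finally show ?thesis using two by simp
      qed
      then have "wt b e * wt b e' * (?\<beta> ^ (card e - 1 + (card e' - 1)) * A) \<le> wt b e * wt b e' * ((1 - ?x) + 8 * (real k)\<^sup>2 * ?\<delta> * ?x
           + (4 * real k + 1) * ?x * of_bool (e \<inter> e' \<noteq> {v}))"
        using wt_nonneg[OF e, of b] wt_nonneg[OF e', of b] b by (intro mult_left_mono) auto
      moreover have "wt (b * ?\<beta>) e'' = wt b e'' * ?\<beta> ^ (card e'' - 1)" for e''
        by (simp add: wt_def power_divide)
      ultimately show ?thesis
        using True by (simp add: i p_def p'_def S_def A_def power_add mult_ac)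
    qed
  qed
  also have "\<dots> = ((1 - ?x) + 8 * (real k)\<^sup>2 * ?\<delta> * ?x) * pair_sum b U
     + (4 * real k + 1) * ?x * (\<Sum>i\<in>T. p i * of_bool (S i \<subseteq> U) * of_bool (fst (snd i) \<inter> snd (snd i) \<noteq> {fst i}))"
    unfolding ps by (simp only: distrib_left sum.distrib sum_distrib_left mult_ac)
  also have "(\<Sum>i\<in>T. p i * of_bool (S i \<subseteq> U) * of_bool (fst (snd i) \<inter> snd (snd i) \<noteq> {fst i})) =
     (\<Sum>(v, e, e')\<in>V \<times> E \<times> E. of_bool (v \<in> e \<and> v \<in> e') * wt b e * wt b e' * of_bool (e \<union> e' \<subseteq> U)
      * of_bool (e \<inter> e' \<noteq> {v}))"
    unfolding p_def S_def T_def by (intro sum.cong) auto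
  also have "((1 - ?x) + 8 * (real k)\<^sup>2 * ?\<delta> * ?x) * pair_sum b U + (4 * real k + 1) * ?x * \<dots>
    \<le> ((1 - ?x) * pair_sum b U + 8 * (real k)\<^sup>2 * ?\<delta> * ?x * (B\<^sup>2 * N)) + (4 * real k + 1) * ?x * (real k * ?\<delta> * (B * N))"
    using pair_overlap_le[OF U b N(3) \<delta>] pair_sum_le[OF U b N(3)] N0 B \<delta>
    unfolding distrib_right by (intro add_mono mult_left_mono order_refl) auto
  also have "\<dots> = (1 - ?x) * pair_sum b U + (8 * (real k)\<^sup>2 * ?\<delta> * B\<^sup>2 + (4 * real k + 1) * (real k * ?\<delta> * B))"
    using N0 by (simp add: field_simps)
  finally show ?thesis .
qed

lemma card_step:
  assumes sw: "step_weights U c" and N: "0 < N"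
  shows "step_mean N c U (\<lambda>U'. \<Sum>v\<in>V. a v * of_bool ({v} \<subseteq> U')) = (1 - 1 / N) * (\<Sum>v\<in>V. a v * of_bool ({v} \<subseteq> U))"
  unfolding step_mean_sum sum_distrib_left
proof (rule sum.cong[OF refl])
  fix v
  show "a v * step_mean N c U (\<lambda>U'. of_bool ({v} \<subseteq> U')) = (1 - 1 / N) * (a v * of_bool ({v} \<subseteq> U))"
  proof (cases "v \<in> U")
    case True
    have "real (card (e \<inter> {v})) - of_bool (e \<inter> {v} \<noteq> {}) = 0" for e :: "'v set"
      by (cases "v \<in> e") auto
    then show ?thesis using step_mean_survival[OF sw N, of "{v}"] True by simp
  qed (use step_mean_not_survival[of "{v}" U N c] in simp)
qed

text \<open>The pair term is bounded above, the cross term below, and the term with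
  \<open>deg0\<close> is computed exactly. Up to errors all three contract by the same factor
  \<open>1 - 1 / N\<close>, so they recombine into a multiple of the deviation.\<close>

lemma deviation_step:
  assumes sw: "step_weights U c" and N: "1 < N" "4 * real k \<le> N" "real (card V) \<le> N"
    and b: "1 \<le> b" "b ^ k \<le> B" and \<delta>: "0 \<le> \<delta>"
    and c_le: "\<And>e. e \<in> E \<Longrightarrow> c e \<le> wt b e"
  shows "step_mean N c U (deviation (b / (1 - 1 / N))) \<le> (1 - 1 / N) * deviation b U +
    (8 * (real k)\<^sup>2 * (B * \<delta>) * B\<^sup>2 + (4 * real k + 1) * (real k * (B * \<delta>) * B) + 2 * (real k)\<^sup>2 * B / N)"
proof -
  let ?b = "b / (1 - 1 / N)" and ?D0 = "\<lambda>U'. \<Sum>v\<in>V. (deg0 v)\<^sup>2 * of_bool ({v} \<subseteq> U')"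
  have U: "U \<subseteq> V" using sw by (simp add: step_weights_def)
  have N0: "0 < N" using N by simp
  have "step_mean N c U (deviation ?b) \<le> step_mean N c U (\<lambda>U'. pair_sum ?b U' + ((-2) * cross_sum ?b U' + ?D0 U'))"
    using N N0 by (intro step_mean_mono[OF sw]) (auto simp: deviation_eq)
  also have "\<dots> = step_mean N c U (pair_sum ?b) - 2 * step_mean N c U (cross_sum ?b) + (1 - 1 / N) * ?D0 U"
    by (simp only: step_mean_add step_mean_cmult card_step[OF sw N0])
  finally have 1: "step_mean N c U (deviation ?b) \<le> \<dots>" .
  have "(1 - 1 / N - (real k / N)\<^sup>2) * cross_sum b U \<le> step_mean N c U (cross_sum ?b)"
    unfolding cross_sum_def[abs_def] using N N0 b deg0_bounds
    by (intro weighted_total_step[OF sw]) (auto intro!: sum_nonneg)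
  moreover have "(real k / N)\<^sup>2 * cross_sum b U \<le> (real k / N)\<^sup>2 * (B * N)"
    using cross_sum_le[OF U b N(3)] by (intro mult_left_mono) auto
  moreover have "(real k / N)\<^sup>2 * (B * N) = (real k)\<^sup>2 * B / N"
    using N0 by (simp add: power2_eq_square field_simps)
  ultimately have 2: "(1 - 1 / N) * cross_sum b U - (real k)\<^sup>2 * B / N \<le> step_mean N c U (cross_sum ?b)"
    by (simp add: left_diff_distrib)
  have "(1 - 1 / N) * deviation b U = (1 - 1 / N) * pair_sum b U - 2 * ((1 - 1 / N) * cross_sum b U) + (1 - 1 / N) * ?D0 U"
    unfolding deviation_eq[OF U] by (simp only: distrib_left right_diff_distrib mult_ac)
  then show ?thesis using 1 2 pair_sum_step[OF assms] by (simp add: mult.assoc)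
qed

end

section \<open>The potential function and its iteration\<close>

context weighted_hypergraph begin

text \<open>The induction hypothesis is averaged over one step. The expected gain of about
  \<open>total_weight b U / N\<close> pays for the contraction of the total weight, and the
  contraction of the deviation pays for the edges discarded at vertices of large degree. The term
  with \<open>\<kappa>\<close> has constant mean, since the growth of \<open>b\<close> cancels the
  expected loss of vertices.\<close>

lemma nibble_step:
  assumes U: "U \<subseteq> V" and N: "1 < N" "4 * real k \<le> N" "real (card V) \<le> N"
    and b: "1 \<le> b" "b ^ k \<le> B" and \<delta>: "0 \<le> \<delta>" and \<xi>: "0 < \<xi>"
    and IH: "\<And>U'. U' \<subseteq> V \<Longrightarrow> total_weight (b / (1 - 1 / N)) U' - B / \<xi>\<^sup>2 * deviation (b / (1 - 1 / N)) U'
        - \<kappa> * (b / (1 - 1 / N)) * real (card U') - r \<le> real (matching_number U')"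
  shows "total_weight b U - B / \<xi>\<^sup>2 * deviation b U - \<kappa> * b * real (card U) - r
     - (\<xi> * B + B / \<xi>\<^sup>2 * (8 * (real k)\<^sup>2 * (B * \<delta>) * B\<^sup>2 + (4 * real k + 1) * (real k * (B * \<delta>) * B) + 2 * (real k)\<^sup>2 * B / N)
        + (real k)\<^sup>2 * B / N) \<le> real (matching_number U)"
proof -
  let ?b = "b / (1 - 1 / N)" and ?l = "B / \<xi>\<^sup>2"
  have N0: "0 < N" using N by simp
  have B: "1 \<le> B" using b by (smt (verit) one_le_power)
  have fU: "finite U" using U fin_V finite_subset by blast
  \<comment> \<open>Excluding the edges through vertices of large degree costs at most the deviation term.\<close>
  define good where "good v \<longleftrightarrow> deg b U v \<le> 1 + \<xi>" for v
  define c where "c e = (if e \<subseteq> U \<and> (\<forall>v\<in>e. good v) then wt b e / (1 + \<xi>) else 0)" for e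
  have wt0: "0 \<le> wt b e" if "e \<in> E" for e using wt_nonneg[OF that] b by simp
  have c0: "0 \<le> c e" if "e \<in> E" for e using wt0[OF that] \<xi> by (simp add: c_def)
  have c_le: "c e \<le> wt b e" if "e \<in> E" for e
    using wt0[OF that] \<xi> by (simp add: c_def pos_divide_le_eq mult_le_cancel_left1)
  have c_deg: "(\<Sum>e\<in>E. of_bool (v \<in> e) * c e) \<le> 1" for v
  proof (cases "good v")
    case True
    have "(\<Sum>e\<in>E. of_bool (v \<in> e) * c e) \<le> (\<Sum>e\<in>E. of_bool (v \<in> e) * wt b e * of_bool (e \<subseteq> U) / (1 + \<xi>))"
      using wt0 \<xi> by (intro sum_mono) (simp add: c_def of_bool_def)
    also have "\<dots> = deg b U v / (1 + \<xi>)" by (simp add: deg_def sum_divide_distrib)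
    also have "\<dots> \<le> 1" using True \<xi> by (simp add: good_def)
    finally show ?thesis .
  next
    case False
    then have "(\<Sum>e\<in>E. of_bool (v \<in> e) * c e) = 0" by (intro sum.neutral) (auto simp: c_def)
    then show ?thesis by simp
  qed
  have sw: "step_weights U c"
    using U c0 c_deg by (auto simp: step_weights_def c_def)
  have "total_weight b U - \<xi> * total_weight b U - (\<Sum>v\<in>U. of_bool (\<not> good v) * deg b U v) \<le> (\<Sum>e\<in>E. c e)"
  proof -
    have "(\<Sum>v\<in>U. of_bool (\<not> good v) * deg b U v) =
      (\<Sum>e\<in>E. wt b e * of_bool (e \<subseteq> U) * (\<Sum>v\<in>U. of_bool (\<not> good v \<and> v \<in> e)))"
      unfolding deg_def sum_distrib_left
      by (subst sum.swap) (intro sum.cong refl, auto simp: of_bool_def)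
    then have "total_weight b U - \<xi> * total_weight b U - (\<Sum>v\<in>U. of_bool (\<not> good v) * deg b U v) =
      (\<Sum>e\<in>E. wt b e * of_bool (e \<subseteq> U) * (1 - \<xi> - (\<Sum>v\<in>U. of_bool (\<not> good v \<and> v \<in> e))))"
      by (simp add: total_weight_def sum_subtractf right_diff_distrib left_diff_distrib sum_distrib_left mult_ac)
    also have "\<dots> \<le> (\<Sum>e\<in>E. c e)"
    proof (rule sum_mono)
      fix e assume e: "e \<in> E"
      let ?s = "\<Sum>v\<in>U. of_bool (\<not> good v \<and> v \<in> e) :: real"
      have s0: "0 \<le> ?s" by (intro sum_nonneg) simp
      show "wt b e * of_bool (e \<subseteq> U) * (1 - \<xi> - ?s) \<le> c e"
      proof (cases "e \<subseteq> U \<and> (\<forall>v\<in>e. good v)")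
        case True
        have "(1 - \<xi>) * (1 + \<xi>) \<le> 1" by (simp add: algebra_simps)
        then have "1 - \<xi> \<le> 1 / (1 + \<xi>)" using \<xi> by (simp add: pos_le_divide_eq)
        then have "wt b e * (1 - \<xi> - ?s) \<le> wt b e * (1 / (1 + \<xi>))"
          using s0 wt0[OF e] by (intro mult_left_mono) auto
        then show ?thesis using True by (simp add: c_def)
      next
        case False
        show ?thesis
        proof (cases "e \<subseteq> U")
          case True
          then obtain v where v: "v \<in> U" "v \<in> e" "\<not> good v" using False by auto
          have "of_bool (\<not> good v \<and> v \<in> e) \<le> ?s" using fU v(1) by (intro member_le_sum) auto
          then have "1 \<le> ?s" using v by simp
          then have "wt b e * (1 - \<xi> - ?s) \<le> 0" using wt0[OF e] \<xi> by (intro mult_nonneg_nonpos) auto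
          then show ?thesis using False True by (auto simp: c_def)
        qed (use c0[OF e] in simp)
      qed
    qed
    finally show ?thesis .
  qed
  \<comment> \<open>A vertex that is not good differs from its initial degree by at least
    \<open>\<xi>\<close> and has degree at most \<open>B\<close>; hence the coefficient
    \<open>B / \<xi>\<^sup>2\<close>.\<close>
  moreover have "(\<Sum>v\<in>U. of_bool (\<not> good v) * deg b U v) \<le> ?l * deviation b U"
    unfolding deviation_def sum_distrib_left
  proof (rule sum_mono)
    fix v assume v: "v \<in> U"
    show "of_bool (\<not> good v) * deg b U v \<le> ?l * (deg b U v - deg0 v)\<^sup>2"
    proof (cases "good v")
      case False
      have "deg0 v \<le> 1" using deg0_bounds v U by auto
      then have "\<xi>\<^sup>2 \<le> (deg b U v - deg0 v)\<^sup>2" using False \<xi> by (intro power_mono) (auto simp: good_def)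
      then have "B * 1 \<le> B * ((deg b U v - deg0 v)\<^sup>2 / \<xi>\<^sup>2)"
        using B \<xi> by (intro mult_left_mono) (auto simp: le_divide_eq)
      moreover have "deg b U v \<le> B" using deg_le[OF _ b] v U by auto
      ultimately show ?thesis using False by simp
    qed (use B in simp)
  qed
  moreover have "\<xi> * total_weight b U \<le> \<xi> * (B * N)"
    using total_le_sum_deg[OF U, of b] sum_deg_le[OF U b N(3)] b \<xi> by (intro mult_left_mono) auto
  ultimately have "total_weight b U - \<xi> * (B * N) - ?l * deviation b U \<le> (\<Sum>e\<in>E. c e)" by linarith
  then have "(total_weight b U - \<xi> * (B * N) - ?l * deviation b U) / N \<le> (\<Sum>e\<in>E. c e) / N"
    using N0 by (intro divide_right_mono) auto
  then have gain: "total_weight b U / N - \<xi> * B - ?l * deviation b U / N \<le> (\<Sum>e\<in>E. c e) / N"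
    using N0 by (simp add: diff_divide_distrib)
  have "step_mean N c U (\<lambda>U'. (\<Sum>e\<in>E. 1 * wt ?b e * of_bool (e \<subseteq> U')) + ((- ?l) * deviation ?b U'
      + ((- (\<kappa> * ?b)) * (\<Sum>v\<in>V. 1 * of_bool ({v} \<subseteq> U')) + (- r)))) \<le>
     step_mean N c U (\<lambda>U'. real (matching_number U'))"
  proof (rule step_mean_mono[OF sw N(3) N0])
    fix U' assume U': "U' \<subseteq> V"
    have "(\<Sum>v\<in>V. 1 * of_bool ({v} \<subseteq> U')) = real (card U')"
      using U' fin_V by (simp add: Int_absorb1)
    then show "(\<Sum>e\<in>E. 1 * wt ?b e * of_bool (e \<subseteq> U')) + ((- ?l) * deviation ?b U'
      + ((- (\<kappa> * ?b)) * (\<Sum>v\<in>V. 1 * of_bool ({v} \<subseteq> U')) + (- r))) \<le> real (matching_number U')"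
      using IH[OF U'] by (simp only: total_weight_def) simp
  qed
  then have mean: "step_mean N c U (\<lambda>U'. (\<Sum>e\<in>E. 1 * wt ?b e * of_bool (e \<subseteq> U'))) - ?l * step_mean N c U (deviation ?b)
     - \<kappa> * ?b * ((1 - 1 / N) * (\<Sum>v\<in>V. 1 * of_bool ({v} \<subseteq> U))) - r \<le> step_mean N c U (\<lambda>U'. real (matching_number U'))"
    unfolding step_mean_add step_mean_cmult card_step[OF sw N0] step_mean_const[OF less_imp_neq[OF N0, symmetric]]
    by simp
  have k2: "\<kappa> * ?b * ((1 - 1 / N) * (\<Sum>v\<in>V. 1 * of_bool ({v} \<subseteq> U))) = \<kappa> * b * real (card U)"
    using U fin_V N by (simp add: Int_absorb1)
  have "(1 - 1 / N - (real k / N)\<^sup>2) * (\<Sum>e\<in>E. 1 * wt b e * of_bool (e \<subseteq> U)) \<le>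
    step_mean N c U (\<lambda>U'. \<Sum>e\<in>E. 1 * wt ?b e * of_bool (e \<subseteq> U'))"
    using N N0 b by (intro weighted_total_step[OF sw]) auto
  moreover have "(real k / N)\<^sup>2 * total_weight b U \<le> (real k / N)\<^sup>2 * (B * N)"
    using total_le_sum_deg[OF U, of b] sum_deg_le[OF U b N(3)] b by (intro mult_left_mono) auto
  moreover have "(real k / N)\<^sup>2 * (B * N) = (real k)\<^sup>2 * B / N"
    using N0 by (simp add: power2_eq_square field_simps)
  ultimately have tot: "total_weight b U - total_weight b U / N - (real k)\<^sup>2 * B / N \<le>
     step_mean N c U (\<lambda>U'. \<Sum>e\<in>E. 1 * wt ?b e * of_bool (e \<subseteq> U'))"
    by (simp add: left_diff_distrib total_weight_def)
  have "?l * step_mean N c U (deviation ?b) \<le> ?l * ((1 - 1 / N) * deviation b U +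
    (8 * (real k)\<^sup>2 * (B * \<delta>) * B\<^sup>2 + (4 * real k + 1) * (real k * (B * \<delta>) * B) + 2 * (real k)\<^sup>2 * B / N))"
    using B by (intro mult_left_mono deviation_step[OF sw N b \<delta> c_le]) auto
  also have "\<dots> = ?l * deviation b U - ?l * deviation b U / N +
    ?l * (8 * (real k)\<^sup>2 * (B * \<delta>) * B\<^sup>2 + (4 * real k + 1) * (real k * (B * \<delta>) * B) + 2 * (real k)\<^sup>2 * B / N)"
    unfolding distrib_left left_diff_distrib right_diff_distrib by simp
  finally show ?thesis
    using matching_number_step[OF sw N(3) N0] gain mean tot unfolding k2 by linarith
qed

text \<open>Induction on the number \<open>j\<close> of remaining steps, for all \<open>b\<close>
  and \<open>U\<close>. The last hypothesis says that \<open>b\<close> ends at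
  \<open>1 / \<kappa>\<close> or above, that is, a vertex has been kept so far with probability at
  most about \<open>\<kappa>\<close>; stopping there costs the term with
  \<open>\<kappa>\<close>.\<close>

lemma nibble_iterate:
  assumes N: "1 < N" "4 * real k \<le> N" "real (card V) \<le> N"
    and \<delta>: "0 \<le> \<delta>" and \<xi>: "0 < \<xi>" "\<xi> \<le> 1" and \<kappa>: "0 \<le> \<kappa>" and b': "b' ^ k \<le> B"
    and \<eta>: "\<eta> = \<xi> * B + B / \<xi>\<^sup>2 * (8 * (real k)\<^sup>2 * (B * \<delta>) * B\<^sup>2 + (4 * real k + 1) * (real k * (B * \<delta>) * B) + 2 * (real k)\<^sup>2 * B / N)
        + (real k)\<^sup>2 * B / N"
  shows "U \<subseteq> V \<Longrightarrow> 1 \<le> b \<Longrightarrow> b * (1 / (1 - 1 / N)) ^ j \<le> b' \<Longrightarrow> 1 \<le> \<kappa> * (b * (1 / (1 - 1 / N)) ^ j) \<Longrightarrow>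
    total_weight b U - B / \<xi>\<^sup>2 * deviation b U - \<kappa> * b * real (card U) - (\<xi> * N + real j * \<eta>) \<le> real (matching_number U)"
proof (induction j arbitrary: b U)
  \<comment> \<open>At the end nothing more is gained: since \<open>1 \<le> \<kappa> * b\<close>,
    the left side is at most \<open>0\<close>.\<close>
  case 0
  have fU: "finite U" using 0 fin_V finite_subset by blast
  have "b ^ k \<le> b' ^ k" using 0 by (intro power_mono) auto
  then have bB: "b ^ k \<le> B" using b' by simp
  then have B: "1 \<le> B" using one_le_power[OF 0(2), of k] by linarith
  have "total_weight b U \<le> (\<Sum>v\<in>U. deg b U v)" using total_le_sum_deg 0 by simp
  also have "\<dots> \<le> (\<Sum>v\<in>U. 1 + \<xi> + (deg b U v - deg0 v)\<^sup>2 / \<xi>)"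
  proof (rule sum_mono)
    fix v assume v: "v \<in> U"
    let ?t = "deg b U v - deg0 v"
    have "\<xi> * ?t \<le> \<xi> * \<xi> + ?t * ?t"
    proof -
      have "0 \<le> (\<xi> - ?t / 2) * (\<xi> - ?t / 2) + 3 / 4 * (?t * ?t)" by simp
      also have "\<dots> = \<xi> * \<xi> + ?t * ?t - \<xi> * ?t" by (simp add: field_simps)
      finally show ?thesis by simp
    qed
    then have "?t \<le> \<xi> + ?t\<^sup>2 / \<xi>" using \<xi> by (simp add: field_simps power2_eq_square)
    then show "deg b U v \<le> 1 + \<xi> + ?t\<^sup>2 / \<xi>" using deg0_bounds[of v] v 0(1) by auto
  qed
  also have "\<dots> = real (card U) + \<xi> * real (card U) + deviation b U / \<xi>"
    by (simp add: deviation_def sum.distrib sum_divide_distrib distrib_left)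
  also have "\<dots> \<le> \<kappa> * b * real (card U) + \<xi> * N + B / \<xi>\<^sup>2 * deviation b U"
  proof (intro add_mono)
    have "1 * real (card U) \<le> \<kappa> * b * real (card U)" using 0 by (intro mult_right_mono) auto
    then show "real (card U) \<le> \<kappa> * b * real (card U)" by simp
    show "\<xi> * real (card U) \<le> \<xi> * N"
      using N card_mono[OF fin_V 0(1)] \<xi> by (intro mult_left_mono) auto
    have "1 / \<xi> \<le> B / \<xi>\<^sup>2"
    proof -
      have "\<xi> * 1 \<le> 1 * B" using \<xi> B by (intro mult_mono) auto
      then show ?thesis using \<xi> by (simp add: field_simps power2_eq_square)
    qed
    from mult_right_mono[OF this deviation_nonneg]
    show "deviation b U / \<xi> \<le> B / \<xi>\<^sup>2 * deviation b U" by simp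
  qed
  finally show ?case by simp
next
  case (Suc j)
  let ?\<beta> = "1 / (1 - 1 / N)"
  have \<beta>: "1 \<le> ?\<beta>" using N by (simp add: field_simps)
  have eq: "b / (1 - 1 / N) * ?\<beta> ^ j = b * ?\<beta> ^ Suc j" by simp
  have "b * 1 \<le> b * ?\<beta> ^ Suc j" using one_le_power[OF \<beta>, of "Suc j"] Suc.prems by (intro mult_left_mono) auto
  then have "b ^ k \<le> b' ^ k" using Suc.prems by (intro power_mono) auto
  then have bB: "b ^ k \<le> B" using b' by simp
  have b1: "1 \<le> b / (1 - 1 / N)"
    using mult_mono[OF Suc.prems(2) \<beta>] Suc.prems by simp
  have "total_weight (b / (1 - 1 / N)) U' - B / \<xi>\<^sup>2 * deviation (b / (1 - 1 / N)) U' - \<kappa> * (b / (1 - 1 / N)) * real (card U')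
      - (\<xi> * N + real j * \<eta>) \<le> real (matching_number U')" if "U' \<subseteq> V" for U'
    using Suc.IH[OF that b1] Suc.prems unfolding eq by blast
  from nibble_step[OF Suc.prems(1) N Suc.prems(2) bB \<delta> \<xi>(1) this]
  have "total_weight b U - B / \<xi>\<^sup>2 * deviation b U - \<kappa> * b * real (card U) - (\<xi> * N + real j * \<eta>) - \<eta> \<le> real (matching_number U)"
    unfolding \<eta> .
  then show ?case by (simp add: distrib_right)
qed

end

text \<open>\<open>N\<close> steps multiply \<open>b\<close> by a factor between \<open>2\<close>
  and \<open>exp 2\<close>. So \<open>N * C\<close> steps bring \<open>b\<close> to at least
  \<open>2 ^ C\<close> while keeping it bounded independently of \<open>N\<close>.\<close>

lemma power_inverse_one_minus_inverse_bounds: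
  assumes "2 \<le> N"
  shows "2 \<le> (1 / (1 - 1 / real N)) ^ N" "(1 / (1 - 1 / real N)) ^ N \<le> exp 2"
proof -
  let ?x = "1 / real N"
  have x: "0 \<le> ?x" "?x < 1" "?x \<le> 1 / 2" using assms by auto
  show "2 \<le> (1 / (1 - ?x)) ^ N"
    using power_inverse_one_minus_ge[OF x(1,2), of N] assms by simp
  have "1 / (1 - ?x) = 1 + ?x / (1 - ?x)" using assms by (simp add: field_simps)
  also have "\<dots> \<le> exp (?x / (1 - ?x))" by (rule exp_ge_add_one_self)
  finally have "(1 / (1 - ?x)) ^ N \<le> exp (?x / (1 - ?x)) ^ N" using x by (intro power_mono) auto
  also have "\<dots> = exp (real N * (?x / (1 - ?x)))" by (simp only: exp_of_nat_mult)
  also have "\<dots> \<le> exp 2"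
  proof -
    have "real N * (?x / (1 - ?x)) = 1 / (1 - ?x)" using assms by (simp add: field_simps)
    also have "\<dots> \<le> 2" using x by (simp add: field_simps)
    finally show ?thesis by simp
  qed
  finally show "(1 / (1 - ?x)) ^ N \<le> exp 2" .
qed

text \<open>The error is measured against \<open>N\<close> instead of \<open>card V\<close>: the
  estimates need \<open>N\<close> large, whereas \<open>V\<close>, later the edge set of a graph,
  may be small.\<close>

theorem nibble:
  fixes k :: nat and \<epsilon> :: real
  assumes \<epsilon>: "0 < \<epsilon>"
  shows "\<exists>\<delta>>0. \<exists>N\<^sub>0. \<forall>(V :: 'v set) E w N. weighted_hypergraph V E w k \<delta> \<longrightarrow> card V \<le> N \<longrightarrow> N\<^sub>0 \<le> N \<longrightarrow>
     (\<exists>M\<subseteq>E. pairwise disjnt M \<and> sum w E - \<epsilon> * real N \<le> real (card M))"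
proof -
  define \<kappa> where "\<kappa> = \<epsilon> / 4"
  have \<kappa>: "0 < \<kappa>" using \<epsilon> by (simp add: \<kappa>_def)
  obtain C :: nat where C: "1 / \<kappa> < 2 ^ C" using real_arch_pow[of 2 "1 / \<kappa>"] by auto
  define B :: real where "B = (exp 2 ^ C) ^ k"
  have B: "1 \<le> B" unfolding B_def by (intro one_le_power) simp
  \<comment> \<open>\<open>\<xi> * B\<close> is lost in each of the \<open>N * C\<close> steps and
    \<open>\<xi> * N\<close> once more at the end, at most \<open>\<epsilon> / 8 * N\<close>
    together.\<close>
  define \<xi> where "\<xi> = min 1 (\<epsilon> / (8 * (real C + 1) * B))"
  have \<xi>: "0 < \<xi>" "\<xi> \<le> 1" using \<epsilon> B by (auto simp: \<xi>_def)
  define lam where "lam = B / \<xi>\<^sup>2"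
  have lam: "0 < lam" using B \<xi> by (simp add: lam_def)
  define K where "K = 8 * (real k)\<^sup>2 * B\<^sup>2 + (4 * real k + 1) * (real k * B)"
  have K: "0 \<le> K" using B by (simp add: K_def)
  \<comment> \<open>\<open>\<delta>\<close> comes after \<open>\<xi>\<close>, because the codegree
    error is amplified by \<open>lam\<close>, which grows as \<open>\<xi>\<close> shrinks.\<close>
  define \<delta> where "\<delta> = \<epsilon> / (8 * (real C * lam * B * K + 1))"
  have \<delta>: "0 < \<delta>" using \<epsilon> lam B K by (auto simp: \<delta>_def intro!: divide_pos_pos add_nonneg_pos)
  define J where "J = real C * (2 * lam + 1) * (real k)\<^sup>2 * B"
  have J: "0 \<le> J" using lam B by (simp add: J_def)
  obtain N1 :: nat where N1: "8 * J / \<epsilon> < real N1" using reals_Archimedean2 by blast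
  define N\<^sub>0 where "N\<^sub>0 = max (4 * k + 2) N1"
  show ?thesis
  proof (intro exI[of _ \<delta>] exI[of _ N\<^sub>0] conjI \<delta> allI impI)
    fix V :: "'v set" and E w N
    assume wh: "weighted_hypergraph V E w k \<delta>" and cV: "card V \<le> N" and N0: "N\<^sub>0 \<le> N"
    interpret weighted_hypergraph V E w k \<delta> by (rule wh)
    have N: "1 < real N" "4 * real k \<le> real N" "real (card V) \<le> real N" "2 \<le> N" "N1 \<le> N"
      using N0 cV by (auto simp: N\<^sub>0_def)
    let ?\<beta> = "1 / (1 - 1 / real N)"
    define \<eta> where "\<eta> = \<xi> * B + B / \<xi>\<^sup>2 * (8 * (real k)\<^sup>2 * (B * \<delta>) * B\<^sup>2 + (4 * real k + 1) * (real k * (B * \<delta>) * B)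
       + 2 * (real k)\<^sup>2 * B / real N) + (real k)\<^sup>2 * B / real N"
    have \<eta>': "\<eta> = \<xi> * B + lam * B * K * \<delta> + (2 * lam + 1) * (real k)\<^sup>2 * B / real N"
      unfolding \<eta>_def K_def lam_def[symmetric] by (simp add: algebra_simps add_divide_distrib)
    have pw: "1 * ?\<beta> ^ (N * C) = (?\<beta> ^ N) ^ C" by (simp add: power_mult)
    have up: "(?\<beta> ^ N) ^ C \<le> exp 2 ^ C"
      using power_inverse_one_minus_inverse_bounds[OF N(4)] by (intro power_mono) auto
    have "2 ^ C \<le> (?\<beta> ^ N) ^ C"
      using power_inverse_one_minus_inverse_bounds[OF N(4)] by (intro power_mono) auto
    then have "1 / \<kappa> \<le> (?\<beta> ^ N) ^ C" using C by linarith
    then have low: "1 \<le> \<kappa> * (?\<beta> ^ N) ^ C" using \<kappa> by (simp add: divide_le_eq mult.commute)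
    have main: "total_weight 1 V - B / \<xi>\<^sup>2 * deviation 1 V - \<kappa> * 1 * real (card V) - (\<xi> * real N + real (N * C) * \<eta>)
        \<le> real (matching_number V)"
      using up low unfolding pw[symmetric]
      by (intro nibble_iterate[OF N(1,2,3) _ \<xi> _ _ \<eta>_def, where b' = "exp 2 ^ C"]) (use \<delta> \<kappa> in \<open>auto simp: B_def\<close>)
    have "total_weight 1 V = sum w E"
      unfolding total_weight_def wt_def using edge_sub by (intro sum.cong) auto
    moreover have "deviation 1 V = 0"
    proof -
      have "deg 1 V v = deg0 v" for v
        unfolding deg_def deg0_def wt_def using edge_sub by (intro sum.cong) auto
      then show ?thesis by (simp add: deviation_def)
    qed
    moreover have "\<kappa> * real (card V) \<le> \<epsilon> / 4 * real N" using cV \<epsilon> by (simp add: \<kappa>_def)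
    moreover have "\<xi> * real N + real (N * C) * \<eta> \<le> \<epsilon> / 2 * real N"
    proof -
      have "\<xi> * ((real C + 1) * B) \<le> \<epsilon> / (8 * (real C + 1) * B) * ((real C + 1) * B)"
        unfolding \<xi>_def using B by (intro mult_right_mono) auto
      also have "\<dots> = \<epsilon> / 8"
      proof -
        have "\<epsilon> / (8 * q) * q = \<epsilon> / 8" if "q \<noteq> 0" for q :: real using that by simp
        moreover have "(real C + 1) * B \<noteq> 0" using B by auto
        ultimately show ?thesis unfolding mult.assoc .
      qed
      finally have 1: "\<xi> * ((real C + 1) * B) \<le> \<epsilon> / 8" .
      have 2: "real C * (lam * B * K * \<delta>) \<le> \<epsilon> / 8"
      proof -
        have p: "0 \<le> real C * lam * B * K" using lam B K by simp
        have "real C * (lam * B * K * \<delta>) = (real C * lam * B * K) * \<delta>" by simp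
        also have "\<dots> \<le> (real C * lam * B * K + 1) * \<delta>" using \<delta> by (intro mult_right_mono) auto
        also have "\<dots> = \<epsilon> / 8"
        proof -
          have "q * (\<epsilon> / (8 * q)) = \<epsilon> / 8" if "q \<noteq> 0" for q :: real using that by simp
          moreover have "real C * lam * B * K + 1 \<noteq> 0" using p by linarith
          ultimately show ?thesis unfolding \<delta>_def .
        qed
        finally show ?thesis .
      qed
      have 3: "J / real N \<le> \<epsilon> / 8"
      proof -
        have "8 * J / \<epsilon> \<le> real N" using N1 N(5) by linarith
        then show ?thesis using \<epsilon> N by (simp add: field_simps)
      qed
      have "\<xi> + real C * \<eta> = \<xi> + real C * (\<xi> * B) + real C * (lam * B * K * \<delta>) + J / real N"
        unfolding \<eta>' J_def by (simp add: algebra_simps)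
      also have "\<xi> + real C * (\<xi> * B) \<le> \<xi> * ((real C + 1) * B)"
        using B \<xi> by (simp add: algebra_simps)
      finally have "\<xi> + real C * \<eta> \<le> \<epsilon> / 2" using 1 2 3 \<epsilon> by linarith
      from mult_right_mono[OF this, of "real N"] show ?thesis by (simp add: algebra_simps)
    qed
    ultimately have "sum w E - \<epsilon> * real N \<le> real (matching_number V)"
    proof -
      assume *: "total_weight 1 V = sum w E" "deviation 1 V = 0" "\<kappa> * real (card V) \<le> \<epsilon> / 4 * real N"
        "\<xi> * real N + real (N * C) * \<eta> \<le> \<epsilon> / 2 * real N"
      have "0 \<le> \<epsilon> * real N" using \<epsilon> by simp
      then show ?thesis using main * unfolding *(1,2) mult_1_right mult_zero_right by linarith
    qed
    moreover obtain M where "M \<in> matchings V" "card M = matching_number V"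
      using matching_number_attained by blast
    ultimately show "\<exists>M\<subseteq>E. pairwise disjnt M \<and> sum w E - \<epsilon> * real N \<le> real (card M)"
      by (auto simp: matchings_def)
  qed
qed

section \<open>Regularity\<close>

definition cond_mean :: "'w set \<Rightarrow> ('w \<Rightarrow> 'l) \<Rightarrow> ('w \<Rightarrow> real) \<Rightarrow> 'w \<Rightarrow> real" where
  "cond_mean \<Omega> l g \<omega> = sum g {\<omega>' \<in> \<Omega>. l \<omega>' = l \<omega>} / real (card {\<omega>' \<in> \<Omega>. l \<omega>' = l \<omega>})"

lemma cond_mean_cong: "l \<omega> = l \<omega>' \<Longrightarrow> cond_mean \<Omega> l g \<omega> = cond_mean \<Omega> l g \<omega>'"
  by (simp add: cond_mean_def)

text \<open>Conditional means form an orthogonal projection: inner products with functions constant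
  on the fibres of \<open>l\<close> do not change.\<close>

lemma sum_cond_mean_mult:
  assumes fin: "finite \<Omega>" and h: "\<And>\<omega> \<omega>'. \<omega> \<in> \<Omega> \<Longrightarrow> \<omega>' \<in> \<Omega> \<Longrightarrow> l \<omega> = l \<omega>' \<Longrightarrow> h \<omega> = h \<omega>'"
  shows "(\<Sum>\<omega>\<in>\<Omega>. cond_mean \<Omega> l g \<omega> * h \<omega>) = (\<Sum>\<omega>\<in>\<Omega>. g \<omega> * h \<omega>)"
  unfolding sum.image_gen[OF fin, of _ l]
proof (rule sum.cong[OF refl])
  fix c assume "c \<in> l ` \<Omega>"
  then obtain \<omega>0 where \<omega>0: "\<omega>0 \<in> \<Omega>" "c = l \<omega>0" by auto
  let ?P = "{\<omega> \<in> \<Omega>. l \<omega> = c}"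
  have ne: "card ?P \<noteq> 0" using fin \<omega>0 by auto
  have hc: "h \<omega> = h \<omega>0" if "\<omega> \<in> ?P" for \<omega>
    using that h[of \<omega> \<omega>0] \<omega>0 by simp
  have "(\<Sum>\<omega>\<in>?P. cond_mean \<Omega> l g \<omega> * h \<omega>) = (\<Sum>\<omega>\<in>?P. sum g ?P / card ?P * h \<omega>0)"
  proof (rule sum.cong[OF refl])
    fix \<omega> assume "\<omega> \<in> ?P"
    then show "cond_mean \<Omega> l g \<omega> * h \<omega> = sum g ?P / card ?P * h \<omega>0"
      using hc[of \<omega>] by (simp add: cond_mean_def)
  qed
  also have "\<dots> = sum g ?P * h \<omega>0" using ne by simp
  also have "\<dots> = (\<Sum>\<omega>\<in>?P. g \<omega> * h \<omega>)"
    unfolding sum_distrib_right by (intro sum.cong refl) (simp only: hc)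
  finally show "(\<Sum>\<omega>\<in>?P. cond_mean \<Omega> l g \<omega> * h \<omega>) = (\<Sum>\<omega>\<in>?P. g \<omega> * h \<omega>)" .
qed

text \<open>Pythagoras: the mean over the coarser partition is the projection of the mean over the
  finer one.\<close>

lemma sum_cond_mean_square_refine:
  assumes fin: "finite \<Omega>" and ref: "\<And>\<omega> \<omega>'. \<omega> \<in> \<Omega> \<Longrightarrow> \<omega>' \<in> \<Omega> \<Longrightarrow> l' \<omega> = l' \<omega>' \<Longrightarrow> l \<omega> = l \<omega>'"
  shows "(\<Sum>\<omega>\<in>\<Omega>. (cond_mean \<Omega> l' g \<omega>)\<^sup>2) =
    (\<Sum>\<omega>\<in>\<Omega>. (cond_mean \<Omega> l g \<omega>)\<^sup>2) + (\<Sum>\<omega>\<in>\<Omega>. (cond_mean \<Omega> l' g \<omega> - cond_mean \<Omega> l g \<omega>)\<^sup>2)"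
proof -
  let ?c = "cond_mean \<Omega> l g" and ?c' = "cond_mean \<Omega> l' g"
  have "(\<Sum>\<omega>\<in>\<Omega>. ?c' \<omega> * ?c \<omega>) = (\<Sum>\<omega>\<in>\<Omega>. g \<omega> * ?c \<omega>)"
    by (rule sum_cond_mean_mult[OF fin]) (use ref cond_mean_cong in metis)
  also have "\<dots> = (\<Sum>\<omega>\<in>\<Omega>. ?c \<omega> * ?c \<omega>)"
    by (rule sum_cond_mean_mult[OF fin, symmetric]) (use cond_mean_cong in metis)
  finally have *: "(\<Sum>\<omega>\<in>\<Omega>. ?c' \<omega> * ?c \<omega>) = (\<Sum>\<omega>\<in>\<Omega>. (?c \<omega>)\<^sup>2)" by (simp add: power2_eq_square)
  have "(\<Sum>\<omega>\<in>\<Omega>. (?c' \<omega> - ?c \<omega>)\<^sup>2) = (\<Sum>\<omega>\<in>\<Omega>. (?c' \<omega>)\<^sup>2) + (\<Sum>\<omega>\<in>\<Omega>. (?c \<omega>)\<^sup>2) - 2 * (\<Sum>\<omega>\<in>\<Omega>. ?c' \<omega> * ?c \<omega>)"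
    by (simp add: power2_diff sum.distrib sum_subtractf sum_distrib_left mult.assoc)
  with * show ?thesis by simp
qed

lemma cond_mean_01:
  assumes "finite \<Omega>" "\<omega> \<in> \<Omega>" "\<And>\<omega>. \<omega> \<in> \<Omega> \<Longrightarrow> 0 \<le> g \<omega> \<and> g \<omega> \<le> 1"
  shows "0 \<le> cond_mean \<Omega> l g \<omega>" "cond_mean \<Omega> l g \<omega> \<le> 1"
proof -
  let ?P = "{\<omega>' \<in> \<Omega>. l \<omega>' = l \<omega>}"
  show "0 \<le> cond_mean \<Omega> l g \<omega>"
    unfolding cond_mean_def using assms by (intro divide_nonneg_nonneg sum_nonneg) auto
  have "sum g ?P \<le> (\<Sum>\<omega>\<in>?P. 1)" using assms by (intro sum_mono) auto
  moreover have "0 < card ?P" using assms by (auto simp: card_gt_0_iff)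
  ultimately show "cond_mean \<Omega> l g \<omega> \<le> 1" unfolding cond_mean_def by simp
qed

section \<open>Regular pairs and energy increments\<close>

definition pair_density :: "('v \<times> 'v \<Rightarrow> real) \<Rightarrow> 'v set \<Rightarrow> 'v set \<Rightarrow> real" where
  "pair_density f A B = sum f (A \<times> B) / (real (card A) * real (card B))"

definition regular_pair :: "real \<Rightarrow> ('v \<times> 'v \<Rightarrow> real) \<Rightarrow> 'v set \<Rightarrow> 'v set \<Rightarrow> bool" where
  "regular_pair \<eta> f A B \<longleftrightarrow> (\<forall>X\<subseteq>A. \<forall>Y\<subseteq>B.
     \<bar>sum f (X \<times> Y) - pair_density f A B * (real (card X) * real (card Y))\<bar> \<le> \<eta> * (real (card A) * real (card B)))"

text \<open>A partition of \<open>V\<close> is represented by a set \<open>S\<close> of generators; its parts are the atoms of the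
  Boolean algebra that \<open>S\<close> generates.\<close>

definition atom :: "'v set \<Rightarrow> 'v set set \<Rightarrow> 'v \<Rightarrow> 'v set" where
  "atom V S v = {u \<in> V. {s \<in> S. u \<in> s} = {s \<in> S. v \<in> s}}"

definition pair_label :: "'v set set \<Rightarrow> 'v \<times> 'v \<Rightarrow> 'v set set \<times> 'v set set" where
  "pair_label S = (\<lambda>(u, v). ({s \<in> S. u \<in> s}, {s \<in> S. v \<in> s}))"

lemma atom_sub: "atom V S v \<subseteq> V" and atom_self: "v \<in> V \<Longrightarrow> v \<in> atom V S v"
  by (auto simp: atom_def)

lemma atom_eq: "u \<in> atom V S v \<Longrightarrow> atom V S u = atom V S v"
  by (auto simp: atom_def)

lemma card_atoms_le:
  assumes "finite S"
  shows "card (atom V S ` V) \<le> 2 ^ card S"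
proof -
  have "atom V S ` V = (\<lambda>T. {u \<in> V. {s \<in> S. u \<in> s} = T}) ` ((\<lambda>v. {s \<in> S. v \<in> s}) ` V)"
    by (auto simp: atom_def image_image)
  moreover have "(\<lambda>v. {s \<in> S. v \<in> s}) ` V \<subseteq> Pow S" by auto
  then have "finite ((\<lambda>v. {s \<in> S. v \<in> s}) ` V)" using assms by (simp add: finite_subset)
  ultimately have "card (atom V S ` V) \<le> card ((\<lambda>v. {s \<in> S. v \<in> s}) ` V)"
    by (simp only: card_image_le)
  also have "\<dots> \<le> card (Pow S)" using assms by (intro card_mono) auto
  finally show ?thesis using assms by (simp add: card_Pow)
qed

lemma pair_block:
  assumes "u \<in> V" "v \<in> V"
  shows "{\<omega> \<in> V \<times> V. pair_label S \<omega> = pair_label S (u, v)} = atom V S u \<times> atom V S v"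
  by (auto simp: pair_label_def atom_def)

lemma cond_mean_pair:
  assumes "u \<in> V" "v \<in> V"
  shows "cond_mean (V \<times> V) (pair_label S) f (u, v) = pair_density f (atom V S u) (atom V S v)"
  unfolding cond_mean_def pair_density_def pair_block[OF assms] by (simp add: card_cartesian_product)

text \<open>Pairs of parts are counted through the vertex pairs they contain, so parts of unequal
  size need no special care.\<close>

definition irregular_pairs :: "real \<Rightarrow> 'v set \<Rightarrow> ('v \<times> 'v \<Rightarrow> real) \<Rightarrow> 'v set set \<Rightarrow> ('v \<times> 'v) set" where
  "irregular_pairs \<eta> V f S = {(u, v) \<in> V \<times> V. \<not> regular_pair \<eta> f (atom V S u) (atom V S v)}"

definition energy :: "'v set \<Rightarrow> ('v \<times> 'v \<Rightarrow> real) \<Rightarrow> 'v set set \<Rightarrow> real" where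
  "energy V f S = (\<Sum>\<omega>\<in>V \<times> V. (cond_mean (V \<times> V) (pair_label S) f \<omega>)\<^sup>2)"

text \<open>With the witnesses in \<open>S'\<close>, the indicator of \<open>X \<times> Y\<close> is
  constant on the blocks of \<open>S'\<close>, so the refined mean has the same sum over
  \<open>X \<times> Y\<close> as \<open>f\<close>. The discrepancy is therefore one between the two
  means, and Cauchy-Schwarz makes their squared distance on the block at least
  \<open>\<eta>\<^sup>2\<close> times its size. Pythagoras adds up the blocks.\<close>

lemma energy_increment:
  assumes fV: "finite V" and \<eta>: "0 < \<eta>" and sub: "S \<subseteq> S'"
    and wit: "\<And>u v. u \<in> V \<Longrightarrow> v \<in> V \<Longrightarrow> \<not> regular_pair \<eta> f (atom V S u) (atom V S v) \<Longrightarrow>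
      \<exists>X\<in>S'. \<exists>Y\<in>S'. X \<subseteq> atom V S u \<and> Y \<subseteq> atom V S v \<and>
        \<eta> * (real (card (atom V S u)) * real (card (atom V S v))) <
        \<bar>sum f (X \<times> Y) - pair_density f (atom V S u) (atom V S v) * (real (card X) * real (card Y))\<bar>"
  shows "energy V f S + \<eta>\<^sup>2 * real (card (irregular_pairs \<eta> V f S)) \<le> energy V f S'"
proof -
  let ?\<Omega> = "V \<times> V" and ?l = "pair_label S" and ?l' = "pair_label S'"
  let ?c = "cond_mean ?\<Omega> ?l f" and ?c' = "cond_mean ?\<Omega> ?l' f"
  let ?D = "\<lambda>\<omega>. ?c' \<omega> - ?c \<omega>" and ?I = "irregular_pairs \<eta> V f S"
  have fO: "finite ?\<Omega>" using fV by simp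
  have ref: "?l \<omega> = ?l \<omega>'" if "?l' \<omega> = ?l' \<omega>'" for \<omega> \<omega>'
    using that sub by (auto simp: pair_label_def split: prod.splits)
  have "\<eta>\<^sup>2 * real (card ?I) = (\<Sum>\<omega>\<in>?\<Omega>. \<eta>\<^sup>2 * of_bool (\<omega> \<in> ?I))"
  proof -
    have "?\<Omega> \<inter> ?I = ?I" by (auto simp: irregular_pairs_def)
    then show ?thesis using fO by (simp add: sum_distrib_left[symmetric])
  qed
  also have "\<dots> \<le> (\<Sum>\<omega>\<in>?\<Omega>. (?D \<omega>)\<^sup>2)"
    unfolding sum.image_gen[OF fO, of _ ?l]
  proof (rule sum_mono)
    fix c assume "c \<in> ?l ` ?\<Omega>"
    then obtain u v where uv: "u \<in> V" "v \<in> V" "c = ?l (u, v)" by auto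
    let ?A = "atom V S u" and ?B = "atom V S v"
    have blk: "{\<omega> \<in> ?\<Omega>. ?l \<omega> = c} = ?A \<times> ?B" unfolding uv(3) by (rule pair_block[OF uv(1,2)])
    have fin: "finite ?A" "finite ?B" using fV atom_sub finite_subset by metis+
    have pos: "0 < real (card ?A) * real (card ?B)"
    proof -
      have "?A \<noteq> {}" "?B \<noteq> {}" using atom_self[OF uv(1), of S] atom_self[OF uv(2), of S] by auto
      then show ?thesis using fin by (simp add: card_gt_0_iff)
    qed
    have c_const: "?c \<omega> = pair_density f ?A ?B" if "\<omega> \<in> ?A \<times> ?B" for \<omega>
      using that cond_mean_pair[OF uv(1,2), of S f] blk uv cond_mean_cong[of ?l \<omega> "(u, v)"]
      by (metis (mono_tags, lifting) mem_Collect_eq)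
    have irr: "\<omega> \<in> ?I \<longleftrightarrow> \<not> regular_pair \<eta> f ?A ?B" if "\<omega> \<in> ?A \<times> ?B" for \<omega>
      using that atom_sub[of V S] by (auto simp: irregular_pairs_def atom_eq)
    show "(\<Sum>\<omega>\<in>{\<omega> \<in> ?\<Omega>. ?l \<omega> = c}. \<eta>\<^sup>2 * of_bool (\<omega> \<in> ?I)) \<le> (\<Sum>\<omega>\<in>{\<omega> \<in> ?\<Omega>. ?l \<omega> = c}. (?D \<omega>)\<^sup>2)"
      unfolding blk
    proof (cases "regular_pair \<eta> f ?A ?B")
      case True
      then have "(\<Sum>\<omega>\<in>?A \<times> ?B. \<eta>\<^sup>2 * of_bool (\<omega> \<in> ?I)) = 0" using irr by (intro sum.neutral) auto
      then show "(\<Sum>\<omega>\<in>?A \<times> ?B. \<eta>\<^sup>2 * of_bool (\<omega> \<in> ?I)) \<le> (\<Sum>\<omega>\<in>?A \<times> ?B. (?D \<omega>)\<^sup>2)"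
        by (simp add: sum_nonneg)
    next
      case False
      from wit[OF uv(1,2) False] obtain X Y where XY: "X \<in> S'" "Y \<in> S'" "X \<subseteq> ?A" "Y \<subseteq> ?B"
        and big: "\<eta> * (real (card ?A) * real (card ?B)) < \<bar>sum f (X \<times> Y) - pair_density f ?A ?B * (real (card X) * real (card Y))\<bar>"
        by auto
      have ZO: "X \<times> Y \<subseteq> ?\<Omega>" using XY atom_sub[of V S u] atom_sub[of V S v] by blast
      have ZA: "X \<times> Y \<subseteq> ?A \<times> ?B" using XY by auto
      have "(\<Sum>\<omega>\<in>?\<Omega>. ?c' \<omega> * of_bool (\<omega> \<in> X \<times> Y)) = (\<Sum>\<omega>\<in>?\<Omega>. f \<omega> * of_bool (\<omega> \<in> X \<times> Y))"
      proof (rule sum_cond_mean_mult[OF fO])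
        fix \<omega> \<omega>' assume "?l' \<omega> = ?l' \<omega>'"
        then show "of_bool (\<omega> \<in> X \<times> Y) = (of_bool (\<omega>' \<in> X \<times> Y) :: real)"
          using XY by (auto simp: pair_label_def split: prod.splits)
      qed
      then have "sum ?c' (X \<times> Y) = sum f (X \<times> Y)"
        using ZO fO by (simp add: Int_absorb1)
      moreover have "sum ?c (X \<times> Y) = pair_density f ?A ?B * (real (card X) * real (card Y))"
      proof -
        have "sum ?c (X \<times> Y) = (\<Sum>\<omega>\<in>X \<times> Y. pair_density f ?A ?B)"
          using ZA c_const by (intro sum.cong refl) blast
        then show ?thesis by (simp add: card_cartesian_product mult_ac)
      qed
      ultimately have "\<eta> * (real (card ?A) * real (card ?B)) \<le> \<bar>sum ?D (X \<times> Y)\<bar>"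
        using big by (simp add: sum_subtractf)
      then have "(\<eta> * (real (card ?A) * real (card ?B)))\<^sup>2 \<le> \<bar>sum ?D (X \<times> Y)\<bar>\<^sup>2"
        using \<eta> pos by (intro power_mono) auto
      also have "\<dots> = (\<Sum>\<omega>\<in>X \<times> Y. 1 * ?D \<omega>)\<^sup>2" by simp
      also have "\<dots> \<le> (\<Sum>\<omega>\<in>X \<times> Y. 1\<^sup>2) * (\<Sum>\<omega>\<in>X \<times> Y. (?D \<omega>)\<^sup>2)"
        by (rule Cauchy_Schwarz_ineq_sum)
      also have "\<dots> \<le> (real (card ?A) * real (card ?B)) * (\<Sum>\<omega>\<in>?A \<times> ?B. (?D \<omega>)\<^sup>2)"
      proof (rule mult_mono)
        show "(\<Sum>\<omega>\<in>X \<times> Y. 1\<^sup>2) \<le> real (card ?A) * real (card ?B)"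
          using card_mono[OF _ ZA] fin by (simp add: card_cartesian_product flip: of_nat_mult)
        show "(\<Sum>\<omega>\<in>X \<times> Y. (?D \<omega>)\<^sup>2) \<le> (\<Sum>\<omega>\<in>?A \<times> ?B. (?D \<omega>)\<^sup>2)"
          using ZA fin by (intro sum_mono2) auto
      qed (use pos in \<open>auto intro: sum_nonneg\<close>)
      finally have "(real (card ?A) * real (card ?B)) * (\<eta>\<^sup>2 * (real (card ?A) * real (card ?B))) \<le>
         (real (card ?A) * real (card ?B)) * (\<Sum>\<omega>\<in>?A \<times> ?B. (?D \<omega>)\<^sup>2)"
        by (simp add: power2_eq_square mult_ac)
      then have "\<eta>\<^sup>2 * (real (card ?A) * real (card ?B)) \<le> (\<Sum>\<omega>\<in>?A \<times> ?B. (?D \<omega>)\<^sup>2)"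
        using pos by (rule mult_left_le_imp_le)
      moreover have "(\<Sum>\<omega>\<in>?A \<times> ?B. \<eta>\<^sup>2 * of_bool (\<omega> \<in> ?I)) = (\<Sum>\<omega>\<in>?A \<times> ?B. \<eta>\<^sup>2)"
        using irr False by (intro sum.cong refl) auto
      ultimately show "(\<Sum>\<omega>\<in>?A \<times> ?B. \<eta>\<^sup>2 * of_bool (\<omega> \<in> ?I)) \<le> (\<Sum>\<omega>\<in>?A \<times> ?B. (?D \<omega>)\<^sup>2)"
        by (simp add: card_cartesian_product mult_ac)
    qed
  qed
  also have "\<dots> = energy V f S' - energy V f S"
  proof -
    have "energy V f S' = energy V f S + (\<Sum>\<omega>\<in>?\<Omega>. (?D \<omega>)\<^sup>2)"
      unfolding energy_def by (rule sum_cond_mean_square_refine[OF fO]) (rule ref)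
    then show ?thesis by linarith
  qed
  finally show ?thesis by linarith
qed

lemma energy_bounds:
  assumes "finite V" "\<And>\<omega>. 0 \<le> f \<omega> \<and> f \<omega> \<le> 1"
  shows "0 \<le> energy V f S" "energy V f S \<le> (real (card V))\<^sup>2"
proof -
  show "0 \<le> energy V f S" unfolding energy_def by (simp add: sum_nonneg)
  have "energy V f S \<le> (\<Sum>\<omega>\<in>V \<times> V. 1)"
    unfolding energy_def using assms cond_mean_01[of "V \<times> V" _ f "pair_label S"]
    by (intro sum_mono) (auto intro!: power_le_one)
  then show "energy V f S \<le> (real (card V))\<^sup>2"
    by (simp add: card_cartesian_product power2_eq_square)
qed

text \<open>A pair of witnesses is added for each index in \<open>R\<close> and each pair of atoms.
  One refinement thus serves all \<open>f r\<close>, and its size depends only on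
  \<open>card S\<close> and \<open>card R\<close>.\<close>

lemma regularity_step:
  assumes fV: "finite V" and fR: "finite R" and \<eta>: "0 < \<eta>" and S: "S \<subseteq> Pow V"
  obtains S' where "S' \<subseteq> Pow V" "card S' \<le> card S + 2 * (card R * (2 ^ card S * 2 ^ card S))"
    "\<And>r. r \<in> R \<Longrightarrow> energy V (f r) S + \<eta>\<^sup>2 * real (card (irregular_pairs \<eta> V (f r) S)) \<le> energy V (f r) S'"
proof -
  have fS: "finite S" using S fV finite_subset by blast
  \<comment> \<open>A regular pair accepts any subsets as witnesses, for instance empty ones, so
    \<open>W\<close> can be chosen as a total function.\<close>
  define P where "P r A B XY \<longleftrightarrow> fst XY \<subseteq> A \<and> snd XY \<subseteq> B \<and> (\<not> regular_pair \<eta> (f r) A B \<longrightarrow>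
     \<eta> * (real (card A) * real (card B)) <
        \<bar>sum (f r) (fst XY \<times> snd XY) - pair_density (f r) A B * (real (card (fst XY)) * real (card (snd XY)))\<bar>)" for r A B XY
  have "\<exists>XY. P r A B XY" for r A B
  proof (cases "regular_pair \<eta> (f r) A B")
    case True
    then show ?thesis by (auto simp: P_def)
  next
    case False
    then show ?thesis unfolding P_def regular_pair_def by (auto simp: not_le)
  qed
  then obtain W where W: "\<And>r A B. P r A B (W r A B)" by metis
  define I where "I = R \<times> (atom V S ` V \<times> atom V S ` V)"
  have fI: "finite I" using fR fV by (auto simp: I_def)
  define X where "X = (\<lambda>(r, A, B). fst (W r A B)) ` I"
  define Y where "Y = (\<lambda>(r, A, B). snd (W r A B)) ` I"
  have cI: "card I \<le> card R * (2 ^ card S * 2 ^ card S)"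
    unfolding I_def card_cartesian_product using card_atoms_le[OF fS, of V] by (intro mult_le_mono) auto
  show ?thesis
  proof (rule that[of "S \<union> X \<union> Y"])
    have "fst (W r A B) \<subseteq> A" "snd (W r A B) \<subseteq> B" for r A B using W[of r A B] by (auto simp: P_def)
    then show "S \<union> X \<union> Y \<subseteq> Pow V"
      using S atom_sub[of V S] unfolding X_def Y_def I_def by (auto; meson atom_sub subset_iff)
    have "card (S \<union> X \<union> Y) \<le> card S + card X + card Y"
      using card_Un_le[of "S \<union> X" Y] card_Un_le[of S X] by simp
    also have "\<dots> \<le> card S + card I + card I"
      unfolding X_def Y_def by (intro add_mono card_image_le fI order_refl)
    finally show "card (S \<union> X \<union> Y) \<le> card S + 2 * (card R * (2 ^ card S * 2 ^ card S))" using cI by simp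
    fix r assume r: "r \<in> R"
    show "energy V (f r) S + \<eta>\<^sup>2 * real (card (irregular_pairs \<eta> V (f r) S)) \<le> energy V (f r) (S \<union> X \<union> Y)"
    proof (rule energy_increment[OF fV \<eta>])
      fix u v assume uv: "u \<in> V" "v \<in> V" "\<not> regular_pair \<eta> (f r) (atom V S u) (atom V S v)"
      let ?W = "W r (atom V S u) (atom V S v)"
      have "(r, atom V S u, atom V S v) \<in> I" using uv r by (auto simp: I_def)
      then have "fst ?W \<in> X" "snd ?W \<in> Y" unfolding X_def Y_def by force+
      moreover have "P r (atom V S u) (atom V S v) ?W" by (rule W)
      ultimately show "\<exists>X'\<in>S \<union> X \<union> Y. \<exists>Y'\<in>S \<union> X \<union> Y. X' \<subseteq> atom V S u \<and> Y' \<subseteq> atom V S v \<and>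
        \<eta> * (real (card (atom V S u)) * real (card (atom V S v))) <
        \<bar>sum (f r) (X' \<times> Y') - pair_density (f r) (atom V S u) (atom V S v) * (real (card X') * real (card Y'))\<bar>"
        using uv(3) unfolding P_def by blast
    qed auto
  qed
qed

text \<open>The energies of all \<open>f r\<close> are added. Their sum is at most
  \<open>card R\<close> times the square of \<open>card V\<close>, and each failing partition gains
  \<open>\<epsilon> * \<eta>\<^sup>2\<close> times that square, so the number of refinements is
  bounded. Iterating \<open>G\<close> bounds the generators independently of \<open>V\<close> and
  \<open>f\<close>.\<close>

theorem regularity:
  fixes \<epsilon> \<eta> :: real and R :: "'r set"
  assumes \<epsilon>: "0 < \<epsilon>" and \<eta>: "0 < \<eta>" and fR: "finite R"
  shows "\<exists>M. \<forall>(V :: 'v set) f. finite V \<longrightarrow> (\<forall>r \<omega>. 0 \<le> f r \<omega> \<and> f r \<omega> \<le> 1) \<longrightarrow>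
    (\<exists>S\<subseteq>Pow V. card S \<le> M \<and> (\<Sum>r\<in>R. real (card (irregular_pairs \<eta> V (f r) S))) \<le> \<epsilon> * (real (card V))\<^sup>2)"
proof -
  define G where "G s = s + 2 * (card R * (2 ^ s * 2 ^ s))" for s :: nat
  have G_mono: "G s \<le> G t" if "s \<le> t" for s t
    unfolding G_def using that by (intro add_mono mult_le_mono power_increasing) auto
  have G_ge: "s \<le> G s" for s by (simp add: G_def)
  have iter_mono: "(G ^^ t) 0 \<le> (G ^^ (t + d)) 0" for t d
    by (induction d) (auto intro: order_trans[OF _ G_ge])
  obtain T :: nat where T: "real (card R) / (\<epsilon> * \<eta>\<^sup>2) < real T" using reals_Archimedean2 by blast
  show ?thesis
  proof (intro exI[of _ "(G ^^ T) 0"] allI impI)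
    fix V :: "'v set" and f :: "'r \<Rightarrow> 'v \<times> 'v \<Rightarrow> real"
    assume fV: "finite V" and f: "\<forall>r \<omega>. 0 \<le> f r \<omega> \<and> f r \<omega> \<le> 1"
    let ?n2 = "(real (card V))\<^sup>2"
    let ?irr = "\<lambda>S. \<Sum>r\<in>R. real (card (irregular_pairs \<eta> V (f r) S))"
    let ?q = "\<lambda>S. \<Sum>r\<in>R. energy V (f r) S"
    show "\<exists>S\<subseteq>Pow V. card S \<le> (G ^^ T) 0 \<and> ?irr S \<le> \<epsilon> * ?n2"
    proof (rule ccontr)
      assume none: "\<not> (\<exists>S\<subseteq>Pow V. card S \<le> (G ^^ T) 0 \<and> ?irr S \<le> \<epsilon> * ?n2)"
      have "\<exists>S\<subseteq>Pow V. card S \<le> (G ^^ t) 0 \<and> real t * (\<epsilon> * \<eta>\<^sup>2 * ?n2) \<le> ?q S" if "t \<le> T" for t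
        using that
      proof (induction t)
        case 0
        show ?case using energy_bounds[OF fV, of "f _"] f by (intro exI[of _ "{}"]) (auto intro!: sum_nonneg)
      next
        case (Suc t)
        then obtain S where S: "S \<subseteq> Pow V" "card S \<le> (G ^^ t) 0" "real t * (\<epsilon> * \<eta>\<^sup>2 * ?n2) \<le> ?q S" by auto
        from iter_mono[of t "T - t"] Suc.prems S(2) have "card S \<le> (G ^^ T) 0" by simp
        with none S(1) have bad: "\<epsilon> * ?n2 < ?irr S" by force
        obtain S' where S': "S' \<subseteq> Pow V" "card S' \<le> G (card S)"
          "\<And>r. r \<in> R \<Longrightarrow> energy V (f r) S + \<eta>\<^sup>2 * real (card (irregular_pairs \<eta> V (f r) S)) \<le> energy V (f r) S'"
          using regularity_step[OF fV fR \<eta> S(1), of f] unfolding G_def by metis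
        have "?q S + \<eta>\<^sup>2 * ?irr S \<le> ?q S'"
          unfolding sum_distrib_left sum.distrib[symmetric] using S'(3) by (intro sum_mono) auto
        moreover have "\<eta>\<^sup>2 * (\<epsilon> * ?n2) \<le> \<eta>\<^sup>2 * ?irr S" using bad by (intro mult_left_mono) auto
        ultimately have "real (Suc t) * (\<epsilon> * \<eta>\<^sup>2 * ?n2) \<le> ?q S'" using S(3) by (simp add: algebra_simps)
        moreover have "card S' \<le> (G ^^ Suc t) 0" using S'(2) G_mono[OF S(2)] by simp
        ultimately show ?case using S'(1) by blast
      qed
      from this[OF order_refl] obtain S where S: "S \<subseteq> Pow V" "real T * (\<epsilon> * \<eta>\<^sup>2 * ?n2) \<le> ?q S" by auto
      have "?q S \<le> (\<Sum>r\<in>R. ?n2)" using energy_bounds[OF fV] f by (intro sum_mono) auto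
      then have "real T * (\<epsilon> * \<eta>\<^sup>2) * ?n2 \<le> real (card R) * ?n2" using S(2) by (simp add: mult_ac)
      \<comment> \<open>Needed to cancel the square of \<open>card V\<close>; over an empty
        \<open>V\<close> no pair is irregular.\<close>
      moreover have "card V \<noteq> 0"
      proof
        assume "card V = 0"
        then have "irregular_pairs \<eta> V (f r) {} = {}" for r using fV by (auto simp: irregular_pairs_def)
        then show False using none \<epsilon> by (auto dest!: spec[of _ "{}"])
      qed
      ultimately have "real T * (\<epsilon> * \<eta>\<^sup>2) \<le> real (card R)" by (simp add: mult_le_cancel_right)
      then show False using T \<epsilon> \<eta> by (simp add: pos_divide_less_eq)
    qed
  qed
qed

section \<open>Counting and coloured removal\<close>

lemma sum_PiE_insert:
  assumes "x \<notin> I"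
  shows "(\<Sum>z\<in>PiE (insert x I) A. F z) = (\<Sum>u\<in>A x. \<Sum>z\<in>PiE I A. F (z(x := u)))"
proof -
  have "(\<Sum>z\<in>PiE (insert x I) A. F z) = (\<Sum>(u, z)\<in>A x \<times> PiE I A. F (z(x := u)))"
    unfolding PiE_insert_eq
    by (subst sum.reindex[OF inj_combinator[OF assms]]) (simp add: case_prod_unfold)
  then show ?thesis by (simp add: sum.cartesian_product)
qed

text \<open>Maps need not be injective, and every pattern edge has its own relation; a colouring
  enters later as \<open>\<lambda>e. E (col e)\<close>.\<close>

definition homs :: "nat \<Rightarrow> (nat \<Rightarrow> 'v set) \<Rightarrow> (nat \<times> nat \<Rightarrow> 'v \<Rightarrow> 'v \<Rightarrow> bool) \<Rightarrow> (nat \<times> nat) set \<Rightarrow> (nat \<Rightarrow> 'v) set" where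
  "homs k A E p = {z \<in> PiE {..<k} A. \<forall>(i, j)\<in>p. E (i, j) (z i) (z j)}"

lemma card_homs_eq:
  assumes "\<And>i. i < k \<Longrightarrow> finite (A i)"
  shows "real (card (homs k A E p)) = (\<Sum>z\<in>PiE {..<k} A. of_bool (\<forall>(i, j)\<in>p. E (i, j) (z i) (z j)))"
proof -
  have "finite (PiE {..<k} A)" using assms by (intro finite_PiE) auto
  then show ?thesis by (simp add: homs_def Int_def)
qed

text \<open>Fix all vertices except those at \<open>a\<close> and \<open>b\<close>. No edge of
  \<open>p\<close> joins \<open>a\<close> and \<open>b\<close>, so the remaining conditions restrict
  \<open>u\<close> to \<open>X z\<close> and \<open>v\<close> to \<open>Y z\<close> independently.
  Regularity on \<open>X z \<times> Y z\<close> then compares imposing the new edge with multiplying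
  by its density.\<close>

lemma card_homs_insert:
  fixes \<eta> :: real
  assumes fA: "\<And>i. i < k \<Longrightarrow> finite (A i)" and ab: "a < b" "b < k" and p: "p \<subseteq> {(i, j). i < j}" "(a, b) \<notin> p"
    and reg: "regular_pair \<eta> (\<lambda>(u, v). of_bool (E (a, b) u v)) (A a) (A b)"
  shows "\<bar>real (card (homs k A E (insert (a, b) p))) - pair_density (\<lambda>(u, v). of_bool (E (a, b) u v)) (A a) (A b) * real (card (homs k A E p))\<bar>
    \<le> \<eta> * (\<Prod>i<k. real (card (A i)))"
proof -
  let ?f = "\<lambda>(u, v). of_bool (E (a, b) u v) :: real"
  let ?d = "pair_density ?f (A a) (A b)"
  define I where "I = {..<k} - {a, b}"
  have k_eq: "{..<k} = insert a (insert b I)" and notin: "a \<notin> insert b I" "b \<notin> I"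
    using ab by (auto simp: I_def)
  have fI: "finite I" by (simp add: I_def)
  let ?ok = "\<lambda>z. \<forall>(i, j)\<in>p. E (i, j) (z i) (z j)"
  define X where "X z = {u \<in> A a. \<forall>(i, j)\<in>p. (i = a \<longrightarrow> E (i, j) u (z j)) \<and> (j = a \<longrightarrow> E (i, j) (z i) u)}" for z
  define Y where "Y z = {v \<in> A b. \<forall>(i, j)\<in>p. (i = b \<longrightarrow> E (i, j) v (z j)) \<and> (j = b \<longrightarrow> E (i, j) (z i) v)}" for z
  define P0 where "P0 z \<longleftrightarrow> (\<forall>(i, j)\<in>p. i \<noteq> a \<and> i \<noteq> b \<and> j \<noteq> a \<and> j \<noteq> b \<longrightarrow> E (i, j) (z i) (z j))" for z
  have split: "?ok (z(b := v, a := u)) \<longleftrightarrow> u \<in> X z \<and> v \<in> Y z \<and> P0 z" if "u \<in> A a" "v \<in> A b" for z u v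
  proof -
    have "E (i, j) ((z(b := v, a := u)) i) ((z(b := v, a := u)) j) \<longleftrightarrow>
      ((i = a \<longrightarrow> E (i, j) u (z j)) \<and> (j = a \<longrightarrow> E (i, j) (z i) u)) \<and>
      ((i = b \<longrightarrow> E (i, j) v (z j)) \<and> (j = b \<longrightarrow> E (i, j) (z i) v)) \<and>
      (i \<noteq> a \<and> i \<noteq> b \<and> j \<noteq> a \<and> j \<noteq> b \<longrightarrow> E (i, j) (z i) (z j))" if ij: "(i, j) \<in> p" for i j
    proof -
      have "i < j" "(i, j) \<noteq> (a, b)" using p ij by auto
      then consider "i = a" "j \<noteq> a" "j \<noteq> b" | "j = a" "i \<noteq> a" "i \<noteq> b" | "i = b" "j \<noteq> a" "j \<noteq> b" | "j = b" "i \<noteq> a" "i \<noteq> b"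
        | "i \<noteq> a" "i \<noteq> b" "j \<noteq> a" "j \<noteq> b" using ab by force
      then show ?thesis by cases (use ab in auto)
    qed
    note eq = this
    have "?ok (z(b := v, a := u)) \<longleftrightarrow> (\<forall>(i, j)\<in>p. ((i = a \<longrightarrow> E (i, j) u (z j)) \<and> (j = a \<longrightarrow> E (i, j) (z i) u)) \<and>
      ((i = b \<longrightarrow> E (i, j) v (z j)) \<and> (j = b \<longrightarrow> E (i, j) (z i) v)) \<and>
      (i \<noteq> a \<and> i \<noteq> b \<and> j \<noteq> a \<and> j \<noteq> b \<longrightarrow> E (i, j) (z i) (z j)))"
    proof (intro ball_cong refl)
      fix e assume "e \<in> p"
      then show "(case e of (i, j) \<Rightarrow> E (i, j) ((z(b := v, a := u)) i) ((z(b := v, a := u)) j)) \<longleftrightarrow>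
        (case e of (i, j) \<Rightarrow> ((i = a \<longrightarrow> E (i, j) u (z j)) \<and> (j = a \<longrightarrow> E (i, j) (z i) u)) \<and>
        ((i = b \<longrightarrow> E (i, j) v (z j)) \<and> (j = b \<longrightarrow> E (i, j) (z i) v)) \<and>
        (i \<noteq> a \<and> i \<noteq> b \<and> j \<noteq> a \<and> j \<noteq> b \<longrightarrow> E (i, j) (z i) (z j)))"
        using eq[of "fst e" "snd e"] by (cases e) (simp only: prod.case prod.sel)
    qed
    also have "\<dots> \<longleftrightarrow> (\<forall>(i, j)\<in>p. (i = a \<longrightarrow> E (i, j) u (z j)) \<and> (j = a \<longrightarrow> E (i, j) (z i) u)) \<and>
      (\<forall>(i, j)\<in>p. (i = b \<longrightarrow> E (i, j) v (z j)) \<and> (j = b \<longrightarrow> E (i, j) (z i) v)) \<and> P0 z"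
      unfolding P0_def by (simp only: case_prod_unfold ball_conj_distrib)
    finally show ?thesis using that unfolding X_def Y_def by simp
  qed
  have sum_split: "(\<Sum>z\<in>PiE {..<k} A. F z) = (\<Sum>z\<in>PiE I A. \<Sum>u\<in>A a. \<Sum>v\<in>A b. F (z(b := v, a := u)))" for F :: "_ \<Rightarrow> real"
  proof -
    have "(\<Sum>z\<in>PiE {..<k} A. F z) = (\<Sum>u\<in>A a. \<Sum>v\<in>A b. \<Sum>z\<in>PiE I A. F (z(b := v, a := u)))"
      unfolding k_eq sum_PiE_insert[OF notin(1)] sum_PiE_insert[OF notin(2)] ..
    also have "\<dots> = (\<Sum>u\<in>A a. \<Sum>z\<in>PiE I A. \<Sum>v\<in>A b. F (z(b := v, a := u)))"
      by (rule sum.cong[OF refl], rule sum.swap)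
    also have "\<dots> = (\<Sum>z\<in>PiE I A. \<Sum>u\<in>A a. \<Sum>v\<in>A b. F (z(b := v, a := u)))"
      by (rule sum.swap)
    finally show ?thesis .
  qed
  have fAa: "finite (A a)" "finite (A b)" using fA ab by auto
  have inner: "\<bar>\<Sum>u\<in>A a. \<Sum>v\<in>A b. of_bool (?ok (z(b := v, a := u))) * (?f (u, v) - ?d)\<bar> \<le> \<eta> * (real (card (A a)) * real (card (A b)))" for z
  proof -
    have sub: "X z \<subseteq> A a" "Y z \<subseteq> A b" by (auto simp: X_def Y_def)
    have "(\<Sum>u\<in>A a. \<Sum>v\<in>A b. of_bool (?ok (z(b := v, a := u))) * (?f (u, v) - ?d)) =
      (\<Sum>u\<in>A a. \<Sum>v\<in>A b. of_bool (u \<in> X z \<and> v \<in> Y z \<and> P0 z) * (?f (u, v) - ?d))"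
      by (intro sum.cong refl) (simp only: split)
    also have "\<dots> = (\<Sum>(u, v)\<in>A a \<times> A b. of_bool (u \<in> X z \<and> v \<in> Y z \<and> P0 z) * (?f (u, v) - ?d))"
      by (rule sum.cartesian_product)
    also have "\<dots> = (\<Sum>\<omega>\<in>X z \<times> Y z. of_bool (P0 z) * (?f \<omega> - ?d))"
      using sub fAa by (intro sum.mono_neutral_cong_right) auto
    also have "\<dots> = of_bool (P0 z) * (sum ?f (X z \<times> Y z) - ?d * (real (card (X z)) * real (card (Y z))))"
      by (simp add: sum_distrib_left[symmetric] sum_subtractf card_cartesian_product mult_ac)
    finally have "\<bar>\<Sum>u\<in>A a. \<Sum>v\<in>A b. of_bool (?ok (z(b := v, a := u))) * (?f (u, v) - ?d)\<bar> \<le>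
      \<bar>sum ?f (X z \<times> Y z) - ?d * (real (card (X z)) * real (card (Y z)))\<bar>" by (simp add: abs_mult)
    also have "\<dots> \<le> \<eta> * (real (card (A a)) * real (card (A b)))"
      using reg sub unfolding regular_pair_def by blast
    finally show ?thesis .
  qed
  have "real (card (homs k A E (insert (a, b) p))) - ?d * real (card (homs k A E p)) =
    (\<Sum>z\<in>PiE {..<k} A. of_bool (?ok z) * (?f (z a, z b) - ?d))"
  proof -
    have "real (card (homs k A E q)) = (\<Sum>z\<in>PiE {..<k} A. of_bool (\<forall>(i, j)\<in>q. E (i, j) (z i) (z j)))" for q
      by (intro card_homs_eq fA)
    note eq = this
    show ?thesis
      unfolding eq sum_distrib_left sum_subtractf[symmetric]
      by (intro sum.cong refl) (auto simp: of_bool_def)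
  qed
  also have "\<dots> = (\<Sum>z\<in>PiE I A. \<Sum>u\<in>A a. \<Sum>v\<in>A b. of_bool (?ok (z(b := v, a := u))) * (?f (u, v) - ?d))"
    unfolding sum_split using ab by (intro sum.cong refl) simp
  finally have eq: "real (card (homs k A E (insert (a, b) p))) - ?d * real (card (homs k A E p)) = \<dots>" .
  have "\<bar>real (card (homs k A E (insert (a, b) p))) - ?d * real (card (homs k A E p))\<bar>
      \<le> (\<Sum>z\<in>PiE I A. \<eta> * (real (card (A a)) * real (card (A b))))"
    unfolding eq
    by (rule order_trans[OF sum_abs]) (intro sum_mono inner)
  also have "\<dots> = \<eta> * (real (card (A a)) * real (card (A b))) * real (card (PiE I A))" by simp
  also have "\<dots> = \<eta> * (\<Prod>i<k. real (card (A i)))"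
    unfolding k_eq using notin fI by (simp add: card_PiE)
  finally show ?thesis .
qed

text \<open>Edges are inserted one by one, each with a factor of at least \<open>\<theta>\<close>
  and a new error \<open>\<eta>\<close>; since \<open>\<theta> \<le> 1\<close>, earlier errors do
  not grow.\<close>

lemma counting_lemma:
  fixes \<eta> \<theta> :: real
  assumes fA: "\<And>i. i < k \<Longrightarrow> finite (A i)" and fp: "finite p" and p: "p \<subseteq> {(i, j). i < j \<and> j < k}"
    and \<theta>: "0 \<le> \<theta>" "\<theta> \<le> 1" and \<eta>: "0 \<le> \<eta>"
    and reg: "\<And>i j. (i, j) \<in> p \<Longrightarrow> regular_pair \<eta> (\<lambda>(u, v). of_bool (E (i, j) u v)) (A i) (A j)"
    and dens: "\<And>i j. (i, j) \<in> p \<Longrightarrow> \<theta> \<le> pair_density (\<lambda>(u, v). of_bool (E (i, j) u v)) (A i) (A j)"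
  shows "(\<theta> ^ card p - real (card p) * \<eta>) * (\<Prod>i<k. real (card (A i))) \<le> real (card (homs k A E p))"
  using fp p reg dens
proof (induction p rule: finite_induct)
  case empty
  show ?case by (simp add: homs_def card_PiE)
next
  case (insert e p)
  obtain a b where e: "e = (a, b)" by (cases e)
  let ?d = "pair_density (\<lambda>(u, v). of_bool (E (a, b) u v)) (A a) (A b)" and ?P = "\<Prod>i<k. real (card (A i))"
  have ab: "a < b" "b < k" using insert.prems(1) e by auto
  have P: "0 \<le> ?P" by (intro prod_nonneg) simp
  have IH: "(\<theta> ^ card p - real (card p) * \<eta>) * ?P \<le> real (card (homs k A E p))"
    by (rule insert.IH) (use insert.prems in auto)
  have d: "\<theta> \<le> ?d" using insert.prems(3)[of a b] e by simp
  have "\<theta> * ((\<theta> ^ card p - real (card p) * \<eta>) * ?P) \<le> \<theta> * real (card (homs k A E p))"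
    using IH \<theta> by (intro mult_left_mono) auto
  also have "\<dots> \<le> ?d * real (card (homs k A E p))" using d by (intro mult_right_mono) auto
  finally have 1: "\<theta> * ((\<theta> ^ card p - real (card p) * \<eta>) * ?P) \<le> ?d * real (card (homs k A E p))" .
  have "\<theta> * (real (card p) * \<eta> * ?P) \<le> 1 * (real (card p) * \<eta> * ?P)"
    using \<theta> \<eta> P by (intro mult_right_mono) auto
  then have 2: "\<theta> ^ Suc (card p) * ?P - real (card p) * \<eta> * ?P \<le> \<theta> * ((\<theta> ^ card p - real (card p) * \<eta>) * ?P)"
    by (simp add: algebra_simps)
  have "\<bar>real (card (homs k A E (insert (a, b) p))) - ?d * real (card (homs k A E p))\<bar> \<le> \<eta> * ?P"
    using insert.prems insert.hyps e ab by (intro card_homs_insert fA) auto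
  then have "\<theta> ^ Suc (card p) * ?P - real (card p) * \<eta> * ?P - \<eta> * ?P \<le> real (card (homs k A E (insert (a, b) p)))"
    using 1 2 by linarith
  then show ?case using insert.hyps by (simp add: e algebra_simps)
qed

section \<open>Exceptional pairs and the removal lemma\<close>

lemma card_small_atoms_le:
  assumes fV: "finite V" and fS: "finite S" and \<rho>: "0 \<le> \<rho>"
  shows "real (card {v \<in> V. real (card (atom V S v)) < \<rho>}) \<le> 2 ^ card S * \<rho>"
proof -
  let ?T = "{A \<in> atom V S ` V. real (card A) < \<rho>}"
  have "{v \<in> V. real (card (atom V S v)) < \<rho>} \<subseteq> \<Union>?T"
    using atom_self[of _ V S] by fastforce
  moreover have fT: "finite ?T" using fV by simp
  moreover have "finite (\<Union>?T)"
    by (rule finite_subset[OF _ fV]) (use atom_sub[of V S] in auto)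
  ultimately have "card {v \<in> V. real (card (atom V S v)) < \<rho>} \<le> card (\<Union>?T)" by (intro card_mono)
  also have "\<dots> \<le> (\<Sum>A\<in>?T. card A)"
    using card_UN_le[OF fT, of "\<lambda>A. A"] by simp
  finally have "real (card {v \<in> V. real (card (atom V S v)) < \<rho>}) \<le> (\<Sum>A\<in>?T. real (card A))"
    unfolding of_nat_sum[symmetric] by (rule of_nat_mono)
  also have "\<dots> \<le> (\<Sum>A\<in>?T. \<rho>)" by (intro sum_mono) auto
  also have "\<dots> = real (card ?T) * \<rho>" by simp
  also have "\<dots> \<le> 2 ^ card S * \<rho>"
  proof (rule mult_right_mono[OF _ \<rho>])
    have "card ?T \<le> card (atom V S ` V)" using fV by (intro card_mono) auto
    also have "\<dots> \<le> 2 ^ card S" by (rule card_atoms_le[OF fS])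
    finally have "card ?T \<le> 2 ^ card S" .
    from of_nat_mono[OF this, where 'a = real] show "real (card ?T) \<le> 2 ^ card S" by simp
  qed
  finally show ?thesis .
qed

text \<open>Within a block, counting related pairs amounts to summing the block density over all
  pairs, and on the blocks in question this density is below \<open>\<theta>\<close>.\<close>

lemma card_sparse_pairs_le:
  assumes fV: "finite V" and \<theta>: "0 \<le> \<theta>"
  shows "real (card {(u, v) \<in> V \<times> V. E u v \<and> pair_density (\<lambda>(u, v). of_bool (E u v)) (atom V S u) (atom V S v) < \<theta>})
    \<le> \<theta> * (real (card V))\<^sup>2"
proof -
  let ?f = "\<lambda>(u, v). of_bool (E u v) :: real" and ?\<Omega> = "V \<times> V"
  let ?c = "cond_mean ?\<Omega> (pair_label S) ?f"
  let ?T = "{(u, v) \<in> V \<times> V. E u v \<and> pair_density ?f (atom V S u) (atom V S v) < \<theta>}"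
  have fO: "finite ?\<Omega>" using fV by simp
  have "real (card ?T) = (\<Sum>\<omega>\<in>?\<Omega>. of_bool (\<omega> \<in> ?T))"
    using fO by (simp add: Int_def) (rule arg_cong[where f = card], auto)
  also have "\<dots> = (\<Sum>\<omega>\<in>?\<Omega>. ?f \<omega> * of_bool (?c \<omega> < \<theta>))"
    by (intro sum.cong refl) (auto simp: cond_mean_pair)
  also have "\<dots> = (\<Sum>\<omega>\<in>?\<Omega>. ?c \<omega> * of_bool (?c \<omega> < \<theta>))"
    by (rule sum_cond_mean_mult[OF fO, symmetric]) (use cond_mean_cong in metis)
  also have "\<dots> \<le> (\<Sum>\<omega>\<in>?\<Omega>. \<theta>)" using \<theta> by (intro sum_mono) (auto simp: of_bool_def)
  also have "\<dots> = \<theta> * (real (card V))\<^sup>2"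
    by (simp add: card_cartesian_product power2_eq_square)
  finally show ?thesis .
qed

text \<open>A graph without isolated vertices on \<open>{..<k}\<close>, each edge stored once in
  increasing order. Because every vertex lies on an edge, removing pairs controls the position of
  every vertex.\<close>

definition pattern :: "nat \<Rightarrow> (nat \<times> nat) set \<Rightarrow> bool" where
  "pattern k p \<longleftrightarrow> p \<subseteq> {(i, j). i < j \<and> j < k} \<and> (\<forall>i<k. \<exists>e\<in>p. i = fst e \<or> i = snd e)"

lemma pattern_finite: "pattern k p \<Longrightarrow> finite p"
  by (rule finite_subset[of _ "{..<k} \<times> {..<k}"]) (auto simp: pattern_def)

text \<open>One set \<open>D\<close> of ordered pairs is removed from all relations at once, and it
  serves all patterns on at most \<open>K\<close> vertices with all their colourings.\<close>

definition hom_removal :: "nat \<Rightarrow> real \<Rightarrow> 'r set \<Rightarrow> 'v set \<Rightarrow> ('r \<Rightarrow> 'v \<Rightarrow> 'v \<Rightarrow> bool) \<Rightarrow> ('v \<times> 'v) set \<Rightarrow> bool" where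
  "hom_removal K \<delta> R V E D \<longleftrightarrow> D \<subseteq> V \<times> V \<and> (\<forall>k\<le>K. \<forall>p col x. pattern k p \<longrightarrow> col ` p \<subseteq> R \<longrightarrow> x ` {..<k} \<subseteq> V \<longrightarrow>
     (\<forall>(i, j)\<in>p. E (col (i, j)) (x i) (x j) \<and> (x i, x j) \<notin> D) \<longrightarrow>
     \<delta> * real (card V) ^ k \<le> real (card (homs k (\<lambda>_. V) (\<lambda>e. E (col e)) p)))"

text \<open>\<open>D\<close> collects the pairs that touch a small atom or lie in irregular or
  sparse pairs of atoms. A pattern map avoiding \<open>D\<close> sends its vertices into large atoms
  that are regular and dense along all pattern edges, and the counting lemma finds many maps into
  these atoms, some of which may coincide.\<close>

theorem coloured_removal:
  fixes \<epsilon> :: real and R :: "'r set"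
  assumes \<epsilon>: "0 < \<epsilon>" and fR: "finite R"
  shows "\<exists>\<delta>>0. \<forall>(V :: 'v set) (E :: 'r \<Rightarrow> 'v \<Rightarrow> 'v \<Rightarrow> bool). finite V \<longrightarrow>
    (\<exists>D. hom_removal K \<delta> R V E D \<and> real (card D) \<le> \<epsilon> * (real (card V))\<^sup>2)"
proof -
  define \<theta> where "\<theta> = min 1 (\<epsilon> / (4 * (real (card R) + 1)))"
  have \<theta>: "0 < \<theta>" "\<theta> \<le> 1" using \<epsilon> by (auto simp: \<theta>_def)
  \<comment> \<open>A pattern has at most \<open>K\<^sup>2\<close> edges, so the regularity errors
    use up at most half of \<open>\<theta> ^ (K\<^sup>2)\<close>.\<close>
  define \<eta> where "\<eta> = \<theta> ^ (K\<^sup>2) / (2 * (real (K\<^sup>2) + 1))"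
  have \<eta>: "0 < \<eta>" using \<theta> by (simp add: \<eta>_def add_nonneg_pos)
  have "\<exists>M. \<forall>(V :: 'v set) f. finite V \<longrightarrow> (\<forall>r \<omega>. 0 \<le> f r \<omega> \<and> f r \<omega> \<le> 1) \<longrightarrow>
    (\<exists>S\<subseteq>Pow V. card S \<le> M \<and> (\<Sum>r\<in>R. real (card (irregular_pairs \<eta> V (f r) S))) \<le> \<epsilon> / 4 * (real (card V))\<^sup>2)"
    using \<epsilon> \<eta> fR by (intro regularity) auto
  then obtain M where M: "\<forall>(V :: 'v set) f. finite V \<longrightarrow> (\<forall>r \<omega>. 0 \<le> f r \<omega> \<and> f r \<omega> \<le> 1) \<longrightarrow>
    (\<exists>S\<subseteq>Pow V. card S \<le> M \<and> (\<Sum>r\<in>R. real (card (irregular_pairs \<eta> V (f r) S))) \<le> \<epsilon> / 4 * (real (card V))\<^sup>2)"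
    by (rule exE)
  \<comment> \<open>There are at most \<open>2 ^ M\<close> atoms, so the small ones cover at most a
    proportion \<open>\<epsilon> / 8\<close> of \<open>V\<close>.\<close>
  define \<rho> where "\<rho> = min 1 (\<epsilon> / (8 * 2 ^ M))"
  have \<rho>: "0 < \<rho>" "\<rho> \<le> 1" using \<epsilon> by (auto simp: \<rho>_def)
  define \<delta> where "\<delta> = \<theta> ^ (K\<^sup>2) / 2 * \<rho> ^ K"
  have \<delta>: "0 < \<delta>" using \<theta> \<rho> by (simp add: \<delta>_def)
  show ?thesis
  proof (intro exI[of _ \<delta>] conjI \<delta> allI impI)
    fix V :: "'v set" and E :: "'r \<Rightarrow> 'v \<Rightarrow> 'v \<Rightarrow> bool"
    assume fV: "finite V"
    define f where "f r = (\<lambda>(u, v). of_bool (E r u v) :: real)" for r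
    obtain S where S: "S \<subseteq> Pow V" "card S \<le> M"
      and irr: "(\<Sum>r\<in>R. real (card (irregular_pairs \<eta> V (f r) S))) \<le> \<epsilon> / 4 * (real (card V))\<^sup>2"
    proof -
      have "\<forall>r \<omega>. 0 \<le> f r \<omega> \<and> f r \<omega> \<le> 1" by (simp add: f_def case_prod_unfold)
      with M[THEN spec, THEN spec, THEN mp, OF fV, of f] show ?thesis using that by blast
    qed
    have fS: "finite S" using S(1) fV finite_subset by blast
    let ?n = "real (card V)"
    define small where "small = {v \<in> V. real (card (atom V S v)) < \<rho> * ?n}"
    define sparse where "sparse r = {(u, v) \<in> V \<times> V. E r u v \<and> pair_density (f r) (atom V S u) (atom V S v) < \<theta>}" for r
    define D where "D = small \<times> V \<union> V \<times> small \<union> (\<Union>r\<in>R. irregular_pairs \<eta> V (f r) S) \<union> (\<Union>r\<in>R. sparse r)"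
    have cs: "real (card small) \<le> \<epsilon> / 8 * ?n"
    proof -
      have "real (card small) \<le> 2 ^ card S * (\<rho> * ?n)"
        unfolding small_def using \<rho> by (intro card_small_atoms_le fV fS) auto
      also have "\<dots> \<le> 2 ^ M * (\<epsilon> / (8 * 2 ^ M) * ?n)"
        using S(2) \<rho> by (intro mult_mono power_increasing mult_right_mono) (auto simp: \<rho>_def)
      finally show ?thesis by simp
    qed
    have csp: "(\<Sum>r\<in>R. real (card (sparse r))) \<le> \<epsilon> / 4 * ?n\<^sup>2"
    proof -
      have "(\<Sum>r\<in>R. real (card (sparse r))) \<le> (\<Sum>r\<in>R. \<theta> * ?n\<^sup>2)"
        unfolding sparse_def f_def using \<theta> by (intro sum_mono card_sparse_pairs_le fV) auto
      also have "\<dots> = (real (card R) * \<theta>) * ?n\<^sup>2" by simp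
      also have "\<dots> \<le> \<epsilon> / 4 * ?n\<^sup>2"
      proof (rule mult_right_mono)
        have "real (card R) * \<theta> \<le> (real (card R) + 1) * (\<epsilon> / (4 * (real (card R) + 1)))"
          using \<theta> by (intro mult_mono) (auto simp: \<theta>_def)
        also have "\<dots> = \<epsilon> / 4"
        proof -
          have "q * (\<epsilon> / (4 * q)) = \<epsilon> / 4" if "q \<noteq> 0" for q :: real using that by simp
          moreover have "real (card R) + 1 \<noteq> 0" by linarith
          ultimately show ?thesis .
        qed
        finally show "real (card R) * \<theta> \<le> \<epsilon> / 4" .
      qed simp
      finally show ?thesis .
    qed
    have "card D \<le> card (small \<times> V) + card (V \<times> small) + (\<Sum>r\<in>R. card (irregular_pairs \<eta> V (f r) S)) + (\<Sum>r\<in>R. card (sparse r))"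
      unfolding D_def using fR
      by (intro order_trans[OF card_Un_le] add_mono card_UN_le order_refl)
    from of_nat_mono[OF this, where 'a = real]
    have "real (card D) \<le> real (card small) * ?n + ?n * real (card small)
       + (\<Sum>r\<in>R. real (card (irregular_pairs \<eta> V (f r) S))) + (\<Sum>r\<in>R. real (card (sparse r)))"
      by (simp add: card_cartesian_product)
    also have "\<dots> \<le> \<epsilon> / 8 * ?n * ?n + ?n * (\<epsilon> / 8 * ?n) + \<epsilon> / 4 * ?n\<^sup>2 + \<epsilon> / 4 * ?n\<^sup>2"
      using cs csp irr by (intro add_mono mult_right_mono mult_left_mono) auto
    also have "\<dots> \<le> \<epsilon> * ?n\<^sup>2" using \<epsilon> by (simp add: power2_eq_square)
    finally have cD: "real (card D) \<le> \<epsilon> * ?n\<^sup>2" .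
    have DV: "D \<subseteq> V \<times> V" by (auto simp: D_def small_def sparse_def irregular_pairs_def)
    have "\<delta> * ?n ^ k \<le> real (card (homs k (\<lambda>_. V) (\<lambda>e. E (col e)) p))"
      if k: "k \<le> K" and pat: "pattern k p" and col: "col ` p \<subseteq> R" and x: "x ` {..<k} \<subseteq> V"
        and hom: "\<forall>(i, j)\<in>p. E (col (i, j)) (x i) (x j) \<and> (x i, x j) \<notin> D" for k p col x
    proof -
      have p: "p \<subseteq> {(i, j). i < j \<and> j < k}" and cov: "\<forall>i<k. \<exists>e\<in>p. i = fst e \<or> i = snd e"
        using pat by (simp_all add: pattern_def)
      define A where "A i = atom V S (x i)" for i
      have fA: "finite (A i)" for i unfolding A_def using atom_sub fV finite_subset by metis
      have pk: "p \<subseteq> {..<k} \<times> {..<k}" using p by auto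
      then have fp: "finite p" by (rule finite_subset) simp
      have "card p \<le> k * k" using card_mono[OF _ pk] by (simp add: card_cartesian_product)
      also have "\<dots> \<le> K\<^sup>2" using k by (simp add: power2_eq_square mult_le_mono)
      finally have cp: "card p \<le> K\<^sup>2" .
      have big: "\<rho> * ?n \<le> real (card (A i))" if ik: "i < k" for i
      proof -
        \<comment> \<open>The pair on a pattern edge at \<open>i\<close> avoids \<open>D\<close>,
          and \<open>D\<close> contains all pairs touching a small atom.\<close>
        obtain e where e: "e \<in> p" "i = fst e \<or> i = snd e" using cov ik by blast
        have "fst e \<in> {..<k}" "snd e \<in> {..<k}" using pk e(1) by auto
        then have xV: "x (fst e) \<in> V" "x (snd e) \<in> V" using x by blast+
        have "(x (fst e), x (snd e)) \<notin> D" using hom e(1) by (cases e) auto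
        then have "x i \<notin> small" using e(2) xV by (auto simp: D_def)
        then show ?thesis using x ik by (auto simp: small_def A_def)
      qed
      have factor: "\<theta> ^ (K\<^sup>2) / 2 \<le> \<theta> ^ card p - real (card p) * \<eta>"
      proof -
        have "real (card p) * \<eta> \<le> (real (K\<^sup>2) + 1) * \<eta>"
          using of_nat_mono[OF cp, where 'a = real] \<eta> by (intro mult_right_mono) linarith+
        also have "\<dots> = \<theta> ^ (K\<^sup>2) / 2"
        proof -
          have "q * (c / (2 * q)) = c / 2" if "q \<noteq> 0" for q c :: real using that by simp
          moreover have "real (K\<^sup>2) + 1 \<noteq> 0" by linarith
          ultimately show ?thesis unfolding \<eta>_def .
        qed
        finally have "real (card p) * \<eta> \<le> \<theta> ^ (K\<^sup>2) / 2" .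
        moreover have "\<theta> ^ (K\<^sup>2) \<le> \<theta> ^ card p" using cp \<theta> by (intro power_decreasing) auto
        ultimately show ?thesis by linarith
      qed
      have "\<rho> ^ K * ?n ^ k \<le> (\<rho> * ?n) ^ k"
        unfolding power_mult_distrib using \<rho> k by (intro mult_right_mono power_decreasing) auto
      also have "\<dots> \<le> (\<Prod>i<k. real (card (A i)))"
      proof -
        have "(\<Prod>i<k. \<rho> * ?n) \<le> (\<Prod>i<k. real (card (A i)))" using big \<rho> by (intro prod_mono) auto
        then show ?thesis by simp
      qed
      finally have parts: "\<rho> ^ K * ?n ^ k \<le> (\<Prod>i<k. real (card (A i)))" .
      have "0 \<le> \<theta> ^ (K\<^sup>2) / 2" using \<theta> by simp
      then have "0 \<le> \<theta> ^ card p - real (card p) * \<eta>" using factor by linarith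
      then have "\<theta> ^ (K\<^sup>2) / 2 * (\<rho> ^ K * ?n ^ k) \<le>
         (\<theta> ^ card p - real (card p) * \<eta>) * (\<Prod>i<k. real (card (A i)))"
        using \<rho> by (intro mult_mono[OF factor parts]) auto
      also have "\<dots> \<le> real (card (homs k A (\<lambda>e. E (col e)) p))"
      proof (rule counting_lemma[OF fA fp p])
        show "0 \<le> \<theta>" "\<theta> \<le> 1" "0 \<le> \<eta>" using \<theta> \<eta> by auto
        fix i j assume ij: "(i, j) \<in> p"
        then have r: "col (i, j) \<in> R" and xV: "x i \<in> V" "x j \<in> V" using col x pk by auto
        have E: "E (col (i, j)) (x i) (x j)" "(x i, x j) \<notin> D" using hom ij by auto
        show "regular_pair \<eta> (\<lambda>(u, v). of_bool (E (col (i, j)) u v)) (A i) (A j)"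
          using E(2) r xV unfolding D_def irregular_pairs_def f_def A_def by blast
        show "\<theta> \<le> pair_density (\<lambda>(u, v). of_bool (E (col (i, j)) u v)) (A i) (A j)"
          using E r xV unfolding D_def sparse_def f_def A_def by (auto simp: not_less)
      qed
      also have "\<dots> \<le> real (card (homs k (\<lambda>_. V) (\<lambda>e. E (col e)) p))"
      proof -
        have "homs k A (\<lambda>e. E (col e)) p \<subseteq> homs k (\<lambda>_. V) (\<lambda>e. E (col e)) p"
          unfolding homs_def A_def using atom_sub[of V S] by (auto simp: PiE_iff)
        moreover have "finite (homs k (\<lambda>_. V) (\<lambda>e. E (col e)) p)"
          unfolding homs_def using fV by (auto intro: finite_subset[OF _ finite_PiE[of "{..<k}" "\<lambda>_. V"]])
        ultimately show ?thesis by (simp add: card_mono)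
      qed
      finally show ?thesis by (simp add: \<delta>_def mult.assoc)
    qed
    then have "hom_removal K \<delta> R V E D" unfolding hom_removal_def using DV by blast
    with cD show "\<exists>D. hom_removal K \<delta> R V E D \<and> real (card D) \<le> \<epsilon> * (real (card V))\<^sup>2" by blast
  qed
qed

section \<open>Packings of graphs\<close>

lemma verts_eq_Union_edges: "is_graph H \<Longrightarrow> verts H = \<Union>(edges H)"
  by (auto simp: is_graph_def)

lemma graph_eq_edges: "is_graph H \<Longrightarrow> H = (\<Union>(edges H), edges H)"
  using verts_eq_Union_edges[of H] by (cases H) auto

lemma finite_edges: "is_graph H \<Longrightarrow> finite (edges H)"
  by (rule finite_subset[of _ "Pow (verts H)"]) (auto simp: is_graph_def)

lemma edges_nonempty: "is_graph H \<Longrightarrow> edges H \<noteq> {}"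
  by (auto simp: is_graph_def)

lemma card_verts_le:
  assumes "is_graph H"
  shows "card (verts H) \<le> 2 * card (edges H)"
proof -
  have "card (\<Union>(edges H)) \<le> (\<Sum>e\<in>edges H. card e)"
    using card_UN_le[OF finite_edges[OF assms], of "\<lambda>e. e"] by simp
  also have "\<dots> = (\<Sum>e\<in>edges H. 2)" using assms by (intro sum.cong) (auto simp: is_graph_def)
  finally show ?thesis by (simp add: verts_eq_Union_edges[OF assms] mult.commute)
qed

lemma card_verts_ge_2:
  assumes "is_graph H"
  shows "2 \<le> card (verts H)"
proof -
  obtain e where "e \<in> edges H" using edges_nonempty[OF assms] by auto
  then show ?thesis using assms card_mono[of "verts H" e] by (auto simp: is_graph_def)
qed

lemma card_edges_le:
  assumes "is_graph G"
  shows "card (edges G) \<le> (card (verts G))\<^sup>2"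
proof -
  have "edges G \<subseteq> (\<lambda>(u, v). {u, v}) ` (verts G \<times> verts G)"
  proof
    fix e assume "e \<in> edges G"
    then have "e \<subseteq> verts G" "card e = 2" using assms by (auto simp: is_graph_def)
    then show "e \<in> (\<lambda>(u, v). {u, v}) ` (verts G \<times> verts G)" by (auto simp: card_2_iff)
  qed
  moreover have fin: "finite (verts G \<times> verts G)" using assms by (simp add: is_graph_def)
  ultimately have "card (edges G) \<le> card (verts G \<times> verts G)"
    by (meson card_image_le card_mono finite_imageI order_trans)
  then show ?thesis by (simp add: card_cartesian_product power2_eq_square)
qed

lemma copies_graph: "H \<in> copies F G \<Longrightarrow> is_graph H" "H \<in> copies F G \<Longrightarrow> verts H \<subseteq> verts G"
  "H \<in> copies F G \<Longrightarrow> edges H \<subseteq> edges G"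
  by (auto simp: copies_def subgraph_def)

text \<open>Weak duality on a subfamily \<open>C\<close>: used with a cover built from
  \<open>y\<close> for the small copies and with a constant cover for the large ones.\<close>

lemma fractional_packing_le_cover:
  assumes G: "is_graph G" and \<phi>: "is_fractional_packing F G \<phi>" and C: "C \<subseteq> copies F G"
    and c: "\<And>e. e \<in> edges G \<Longrightarrow> 0 \<le> c e" and cov: "\<And>H. H \<in> C \<Longrightarrow> 1 \<le> sum c (edges H)"
  shows "sum \<phi> C \<le> sum c (edges G)"
proof -
  have fC: "finite C" using C finite_copies[OF G] finite_subset by blast
  have \<phi>0: "0 \<le> \<phi> H" if "H \<in> copies F G" for H
    using \<phi> that by (auto simp: is_fractional_packing_def)
  have "sum \<phi> C \<le> (\<Sum>H\<in>C. \<Sum>e\<in>edges G. of_bool (e \<in> edges H) * (c e * \<phi> H))"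
  proof (rule sum_mono)
    fix H assume H: "H \<in> C"
    have "(\<Sum>e\<in>edges G. of_bool (e \<in> edges H) * (c e * \<phi> H)) = sum c (edges H) * \<phi> H"
      unfolding sum_distrib_right using copies_graph(3)[of H F G] H C finite_edges[OF G]
      by (intro sum.mono_neutral_cong_right) auto
    moreover have "1 * \<phi> H \<le> sum c (edges H) * \<phi> H"
      by (intro mult_right_mono cov[OF H] \<phi>0 subsetD[OF C H])
    ultimately show "\<phi> H \<le> (\<Sum>e\<in>edges G. of_bool (e \<in> edges H) * (c e * \<phi> H))" by simp
  qed
  also have "\<dots> = (\<Sum>e\<in>edges G. c e * (\<Sum>H\<in>{H \<in> C. e \<in> edges H}. \<phi> H))"
    by (subst sum.swap) (simp add: sum_of_bool_filter[OF fC] sum_distrib_left)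
  also have "\<dots> \<le> (\<Sum>e\<in>edges G. c e * 1)"
  proof (intro sum_mono mult_left_mono c)
    fix e assume e: "e \<in> edges G"
    have "(\<Sum>H\<in>{H \<in> C. e \<in> edges H}. \<phi> H) \<le> (\<Sum>H\<in>{H \<in> copies F G. e \<in> edges H}. \<phi> H)"
    proof (rule sum_mono2)
      show "finite {H \<in> copies F G. e \<in> edges H}" using finite_copies[OF G, of F] by simp
    qed (use C \<phi>0 in auto)
    also have "\<dots> \<le> 1" using \<phi> e by (auto simp: is_fractional_packing_def)
    finally show "(\<Sum>H\<in>{H \<in> C. e \<in> edges H}. \<phi> H) \<le> 1" .
  qed
  finally show ?thesis by simp
qed

section \<open>Copies of graphs as images of patterns\<close>

definition pattern_graph :: "nat \<Rightarrow> (nat \<times> nat) set \<Rightarrow> (nat \<Rightarrow> 'a) \<Rightarrow> 'a ugraph" where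
  "pattern_graph k p z = (z ` {..<k}, (\<lambda>(i, j). {z i, z j}) ` p)"

lemma pattern_edge_inj:
  assumes "pattern k p" "inj_on z {..<k}"
  shows "inj_on (\<lambda>(i, j). {z i, z j}) p"
proof (rule inj_onI, clarify)
  fix i j i' j' assume ij: "(i, j) \<in> p" "(i', j') \<in> p" "{z i, z j} = {z i', z j'}"
  then have lt: "i < j" "j < k" "i' < j'" "j' < k" using assms(1) by (auto simp: pattern_def)
  have eq: "z a = z b \<longleftrightarrow> a = b" if "a < k" "b < k" for a b using assms(2) that by (auto simp: inj_on_def)
  show "i = i' \<and> j = j'" using ij(3) lt eq[of i i'] eq[of i j'] eq[of j i'] eq[of j j']
    by (auto simp: doubleton_eq_iff)
qed

lemma pattern_graph_edge_iff:
  assumes "pattern k p" "inj_on z {..<k}" "i < k" "j < k"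
  shows "{z i, z j} \<in> edges (pattern_graph k p z) \<longleftrightarrow> (i, j) \<in> p \<or> (j, i) \<in> p"
proof
  have eq: "z a = z b \<longleftrightarrow> a = b" if "a < k" "b < k" for a b using assms(2) that by (auto simp: inj_on_def)
  assume "{z i, z j} \<in> edges (pattern_graph k p z)"
  then obtain a b where ab: "(a, b) \<in> p" "{z i, z j} = {z a, z b}" by (auto simp: pattern_graph_def)
  then have "a < k" "b < k" using assms(1) by (auto simp: pattern_def)
  then show "(i, j) \<in> p \<or> (j, i) \<in> p"
    using ab assms(3,4) eq by (auto simp: doubleton_eq_iff)
qed (force simp: pattern_graph_def insert_commute)

lemma is_graph_pattern_graph:
  assumes p: "pattern k p" and z: "inj_on z {..<k}" and k: "0 < k"
  shows "is_graph (pattern_graph k p z)"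
  unfolding is_graph_def pattern_graph_def fst_conv snd_conv
proof (intro conjI ballI)
  show "finite (z ` {..<k})" "z ` {..<k} \<noteq> {}" using k by auto
  fix e assume "e \<in> (\<lambda>(i, j). {z i, z j}) ` p"
  then obtain i j where ij: "(i, j) \<in> p" "e = {z i, z j}" by auto
  then have lt: "i < j" "j < k" using p by (auto simp: pattern_def)
  then show "e \<subseteq> z ` {..<k}" using ij by auto
  have "z i \<noteq> z j" using z lt by (auto simp: inj_on_def)
  then show "card e = 2" using ij by simp
next
  fix v assume "v \<in> z ` {..<k}"
  then obtain i where i: "i < k" "v = z i" by auto
  then obtain e where "e \<in> p" "i = fst e \<or> i = snd e" using p by (auto simp: pattern_def)
  then show "\<exists>e\<in>(\<lambda>(i, j). {z i, z j}) ` p. v \<in> e" using i by (intro bexI[of _ "{z (fst e), z (snd e)}"]) force+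
qed

lemma graph_iso_pattern_graph:
  assumes p: "pattern k p" and x: "inj_on x {..<k}" and z: "inj_on z {..<k}"
    and iso: "graph_iso (pattern_graph k p x) K"
  shows "graph_iso (pattern_graph k p z) K"
proof -
  obtain f where f: "bij_betw f (x ` {..<k}) (verts K)"
    "\<forall>u\<in>x ` {..<k}. \<forall>v\<in>x ` {..<k}. {u, v} \<in> edges (pattern_graph k p x) \<longleftrightarrow> {f u, f v} \<in> edges K"
    using iso by (auto simp: graph_iso_def pattern_graph_def)
  define g where "g = f \<circ> x \<circ> the_inv_into {..<k} z"
  have g: "g (z i) = f (x i)" if "i < k" for i
    using that by (simp add: g_def the_inv_into_f_f[OF z])
  have "bij_betw g (z ` {..<k}) (verts K)"
    unfolding g_def
    by (intro bij_betw_trans[OF bij_betw_the_inv_into[OF inj_on_imp_bij_betw[OF z]]] bij_betw_trans[OF inj_on_imp_bij_betw[OF x]] f(1))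
  moreover have "{z i, z j} \<in> edges (pattern_graph k p z) \<longleftrightarrow> {g (z i), g (z j)} \<in> edges K" if "i < k" "j < k" for i j
    using f(2) that g pattern_graph_edge_iff[OF p x that] pattern_graph_edge_iff[OF p z that] by auto
  ultimately show ?thesis
    unfolding graph_iso_def by (intro exI[of _ g]) (auto simp: pattern_graph_def)
qed

lemma graph_enumeration:
  assumes "is_graph H"
  obtains p x where "pattern (card (verts H)) p" "inj_on x {..<card (verts H)}" "pattern_graph (card (verts H)) p x = H"
proof -
  let ?k = "card (verts H)"
  have "finite (verts H)" using assms by (simp add: is_graph_def)
  then obtain x where x: "bij_betw x {..<?k} (verts H)"
    using ex_bij_betw_nat_finite[of "verts H"] by (auto simp: atLeast0LessThan)
  define p where "p = {(i, j). i < j \<and> j < ?k \<and> {x i, x j} \<in> edges H}"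
  have img: "x ` {..<?k} = verts H" and inj: "inj_on x {..<?k}" using x by (auto simp: bij_betw_def)
  have edge: "\<exists>(i, j)\<in>p. e = {x i, x j}" if e: "e \<in> edges H" for e
  proof -
    have "e \<subseteq> verts H" "card e = 2" using assms e by (auto simp: is_graph_def)
    then obtain u v where uv: "e = {u, v}" "u \<noteq> v" "u \<in> verts H" "v \<in> verts H" by (auto simp: card_2_iff)
    then obtain i j where ij: "u = x i" "v = x j" "i < ?k" "j < ?k" using img by blast
    then have "i \<noteq> j" using uv by auto
    then consider "i < j" | "j < i" by linarith
    then show ?thesis
    proof cases
      case 1
      then have "(i, j) \<in> p" "e = {x i, x j}" using uv ij e by (auto simp: p_def)
      then show ?thesis by blast
    next
      case 2
      then have "(j, i) \<in> p" "e = {x j, x i}" using uv ij e by (auto simp: p_def insert_commute)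
      then show ?thesis by blast
    qed
  qed
  show ?thesis
  proof (rule that[of p x])
    show "pattern ?k p" unfolding pattern_def
    proof (intro conjI allI impI)
      fix i assume i: "i < ?k"
      then have "x i \<in> verts H" using img by auto
      then obtain e where e: "e \<in> edges H" "x i \<in> e" using assms unfolding is_graph_def by blast
      from edge[OF e(1)] obtain a b where ab: "(a, b) \<in> p" "e = {x a, x b}" by auto
      then have "a < ?k" "b < ?k" by (auto simp: p_def)
      then have "i = a \<or> i = b" using e(2) ab(2) i inj by (auto simp: inj_on_def)
      then show "\<exists>e\<in>p. i = fst e \<or> i = snd e" using ab(1) by force
    qed (auto simp: p_def)
    have "(\<lambda>(i, j). {x i, x j}) ` p = edges H" using edge by (force simp: p_def)
    then show "pattern_graph ?k p x = H" using img by (simp add: pattern_graph_def)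
  qed (rule inj)
qed

text \<open>A map with \<open>z i = z j\<close> is determined by its values away from
  \<open>i\<close>, and there are at most \<open>k\<^sup>2\<close> choices of
  \<open>(i, j)\<close>.\<close>

lemma card_noninjective_le:
  assumes fV: "finite V"
  shows "card {z \<in> PiE {..<k} (\<lambda>_. V). \<not> inj_on z {..<k}} \<le> k\<^sup>2 * card V ^ (k - 1)"
proof -
  let ?P = "PiE {..<k} (\<lambda>_. V)"
  define T where "T = (\<lambda>(i, j). {z \<in> ?P. z i = z j})"
  define J where "J = {(i, j). i < k \<and> j < k \<and> i \<noteq> j}"
  have J: "J \<subseteq> {..<k} \<times> {..<k}" by (auto simp: J_def)
  then have fJ: "finite J" by (rule finite_subset) simp
  have "card J \<le> k\<^sup>2" using card_mono[OF _ J] by (simp add: card_cartesian_product power2_eq_square)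
  have "card (T e) \<le> card V ^ (k - 1)" if "e \<in> J" for e
  proof -
    obtain i j where e: "e = (i, j)" and ij: "i < k" "j < k" "i \<noteq> j" using \<open>e \<in> J\<close> by (auto simp: J_def)
    let ?I = "{..<k} - {i}" and ?r = "\<lambda>z. restrict z ({..<k} - {i})"
    have "inj_on ?r (T e)"
    proof (rule inj_onI)
      fix z z' assume z: "z \<in> T e" "z' \<in> T e" "?r z = ?r z'"
      have eq: "z a = z' a" if "a < k" "a \<noteq> i" for a using fun_cong[OF z(3), of a] that by simp
      then have "z i = z' i" using z ij by (simp add: T_def e)
      then have "z a = z' a" if "a < k" for a using eq that by (cases "a = i") auto
      then show "z = z'" using z by (intro PiE_ext[of z "{..<k}" "\<lambda>_. V" z']) (auto simp: T_def e)
    qed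
    moreover have "?r ` T e \<subseteq> PiE ?I (\<lambda>_. V)" by (auto simp: T_def e intro!: restrict_PiE_iff[THEN iffD2])
    ultimately have "card (T e) \<le> card (PiE ?I (\<lambda>_. V))"
      using fV by (intro card_inj_on_le[of ?r] finite_PiE) auto
    also have "\<dots> = card V ^ (k - 1)" using ij by (simp add: card_PiE)
    finally show ?thesis .
  qed
  moreover have "{z \<in> ?P. \<not> inj_on z {..<k}} \<subseteq> (\<Union>e\<in>J. T e)"
    by (auto simp: inj_on_def T_def J_def)
  moreover have "finite (\<Union>e\<in>J. T e)"
    using fJ fV by (auto simp: T_def intro!: finite_subset[OF _ finite_PiE[of "{..<k}" "\<lambda>_. V"]])
  ultimately have "card {z \<in> ?P. \<not> inj_on z {..<k}} \<le> card (\<Union>e\<in>J. T e)" by (intro card_mono)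
  also have "\<dots> \<le> (\<Sum>e\<in>J. card (T e))" by (rule card_UN_le[OF fJ])
  also have "\<dots> \<le> (\<Sum>e\<in>J. card V ^ (k - 1))" using \<open>\<And>e. e \<in> J \<Longrightarrow> card (T e) \<le> card V ^ (k - 1)\<close> by (rule sum_mono)
  also have "\<dots> \<le> k\<^sup>2 * card V ^ (k - 1)" using \<open>card J \<le> k\<^sup>2\<close> by simp
  finally show ?thesis .
qed

text \<open>Edges are coloured by rounding \<open>m * y e\<close>. An injective map that preserves the edges and colours of
  a copy of low \<open>y\<close>-value spans another copy of low \<open>y\<close>-value, and few maps are not injective.\<close>

lemma light_copy_pattern:
  fixes G :: "'a ugraph" and y :: "'a set \<Rightarrow> real"
  assumes G: "is_graph G" and y: "\<And>e. 0 \<le> y e" "\<And>e. y e \<le> 1" and m: "0 < m" "2 * real M \<le> \<gamma> * real m"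
    and H: "H \<in> copies F G" "card (edges H) \<le> M" "sum y (edges H) \<le> 1 - \<gamma>" and k: "k = card (verts H)"
    and L: "L = {H' \<in> copies F G. card (edges H') \<le> M \<and> card (verts H') = k \<and> sum y (edges H') \<le> 1 - \<gamma> / 2}"
    and E: "E = (\<lambda>r u v. {u, v} \<in> edges G \<and> nat \<lfloor>real m * y {u, v}\<rfloor> = r)"
  obtains p col x where "pattern k p" "col ` p \<subseteq> {..m}" "x ` {..<k} \<subseteq> verts G"
    "\<And>i j. (i, j) \<in> p \<Longrightarrow> E (col (i, j)) (x i) (x j)" "\<And>i j. (i, j) \<in> p \<Longrightarrow> {x i, x j} \<in> edges H"
    "card (homs k (\<lambda>_. verts G) (\<lambda>e. E (col e)) p) \<le> card L * k ^ k + k\<^sup>2 * card (verts G) ^ (k - 1)"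
proof -
  have Hg: "is_graph H" by (rule copies_graph(1)[OF H(1)])
  obtain p x where p: "pattern k p" and x: "inj_on x {..<k}" and Hp: "pattern_graph k p x = H"
    using graph_enumeration[OF Hg] k by metis
  define col where "col = (\<lambda>(i, j). nat \<lfloor>real m * y {x i, x j}\<rfloor>)"
  have fp: "finite p" by (rule pattern_finite[OF p])
  have xe: "{x i, x j} \<in> edges H" if "(i, j) \<in> p" for i j
    unfolding Hp[symmetric] pattern_graph_def using that by force
  have k0: "0 < k" using card_verts_ge_2[OF Hg] k by simp
  have fV: "finite (verts G)" using G by (simp add: is_graph_def)
  let ?homs = "homs k (\<lambda>_. verts G) (\<lambda>e. E (col e)) p"
  have cp: "card p = card (edges H)"
    unfolding Hp[symmetric] pattern_graph_def using card_image[OF pattern_edge_inj[OF p x]] by simp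
  have in_L: "pattern_graph k p z \<in> L" if z: "z \<in> ?homs" "inj_on z {..<k}" for z
  proof -
    let ?Z = "pattern_graph k p z"
    have E': "{z i, z j} \<in> edges G" "nat \<lfloor>real m * y {z i, z j}\<rfloor> = nat \<lfloor>real m * y {x i, x j}\<rfloor>" if "(i, j) \<in> p" for i j
      using z(1) that by (auto simp: homs_def E col_def)
    have Zg: "is_graph ?Z" by (rule is_graph_pattern_graph[OF p z(2) k0])
    have edges_Z: "edges ?Z = (\<lambda>(i, j). {z i, z j}) ` p" and verts_Z: "verts ?Z = z ` {..<k}"
      by (simp_all add: pattern_graph_def)
    have sub: "subgraph ?Z G"
      using Zg E'(1) z(1) unfolding subgraph_def edges_Z verts_Z by (auto simp: homs_def PiE_iff)
    obtain K where K: "K \<in> F" "graph_iso H K" using H(1) by (auto simp: copies_def)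
    have "graph_iso ?Z K" using graph_iso_pattern_graph[OF p x z(2)] K(2) Hp by simp
    then have cop: "?Z \<in> copies F G" using K(1) sub by (auto simp: copies_def)
    have cZ: "card (edges ?Z) \<le> M"
      unfolding edges_Z using card_image[OF pattern_edge_inj[OF p z(2)]] cp H(2) by simp
    have "sum y (edges ?Z) = (\<Sum>(i, j)\<in>p. y {z i, z j})"
      unfolding edges_Z by (subst sum.reindex[OF pattern_edge_inj[OF p z(2)]]) (simp add: case_prod_unfold)
    also have "\<dots> \<le> (\<Sum>(i, j)\<in>p. y {x i, x j} + 1 / real m)"
    proof (rule sum_mono)
      fix e assume e: "e \<in> p"
      obtain i j where ij: "e = (i, j)" by (cases e)
      \<comment> \<open>Equal colours mean equal integer parts after scaling, so an edge value rises
        by less than \<open>1 / m\<close>. Over at most \<open>M\<close> edges this amounts to at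
        most \<open>\<gamma> / 2\<close>.\<close>
      have "real m * y {z i, z j} < real m * y {x i, x j} + 1"
      proof -
        have "0 \<le> real m * y {z i, z j}" "0 \<le> real m * y {x i, x j}" using y by simp_all
        then have "\<lfloor>real m * y {z i, z j}\<rfloor> = \<lfloor>real m * y {x i, x j}\<rfloor>" using E'(2)[of i j] e ij by (simp add: eq_nat_nat_iff)
        then show ?thesis by linarith
      qed
      then have "y {z i, z j} \<le> y {x i, x j} + 1 / real m" using m(1) by (simp add: field_simps)
      then show "(case e of (i, j) \<Rightarrow> y {z i, z j}) \<le> (case e of (i, j) \<Rightarrow> y {x i, x j} + 1 / real m)"
        by (simp add: ij)
    qed
    also have "\<dots> = sum y (edges H) + real (card p) / real m"
    proof -
      have "sum y (edges H) = (\<Sum>(i, j)\<in>p. y {x i, x j})"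
        unfolding Hp[symmetric] pattern_graph_def snd_conv
        by (subst sum.reindex[OF pattern_edge_inj[OF p x]]) (simp add: case_prod_unfold)
      then show ?thesis by (simp add: case_prod_unfold sum.distrib)
    qed
    also have "\<dots> \<le> 1 - \<gamma> / 2"
    proof -
      have "2 * real (card p) \<le> \<gamma> * real m" using m(2) cp H(2) by linarith
      then have "real (card p) / real m \<le> \<gamma> / 2" using m(1) by (simp add: field_simps)
      then show ?thesis using H(3) by linarith
    qed
    finally have "sum y (edges ?Z) \<le> 1 - \<gamma> / 2" .
    moreover have "card (verts ?Z) = k" unfolding verts_Z using card_image[OF z(2)] by simp
    ultimately show ?thesis unfolding L using cop cZ by simp
  qed
  have fL: "finite L" unfolding L using finite_copies[OF G, of F] by simp
  \<comment> \<open>An injective map takes its values in the copy that it spans, so a copy in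
    \<open>L\<close> accounts for at most \<open>k ^ k\<close> maps.\<close>
  have "?homs \<subseteq> (\<Union>H'\<in>L. PiE {..<k} (\<lambda>_. verts H')) \<union> {z \<in> PiE {..<k} (\<lambda>_. verts G). \<not> inj_on z {..<k}}"
  proof
    fix z assume z: "z \<in> ?homs"
    show "z \<in> (\<Union>H'\<in>L. PiE {..<k} (\<lambda>_. verts H')) \<union> {z \<in> PiE {..<k} (\<lambda>_. verts G). \<not> inj_on z {..<k}}"
    proof (cases "inj_on z {..<k}")
      case True
      have "z \<in> PiE {..<k} (\<lambda>_. verts (pattern_graph k p z))"
        using z by (auto simp: homs_def pattern_graph_def PiE_iff)
      then show ?thesis using in_L[OF z True] by blast
    qed (use z in \<open>auto simp: homs_def\<close>)
  qed
  moreover have fL': "finite (\<Union>H'\<in>L. PiE {..<k} (\<lambda>_. verts H'))"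
  proof (intro finite_UN_I fL finite_PiE)
    fix H' assume "H' \<in> L"
    then have "is_graph H'" unfolding L using copies_graph(1) by blast
    then show "finite (verts H')" by (simp add: is_graph_def)
  qed simp
  moreover have "finite {z \<in> PiE {..<k} (\<lambda>_. verts G). \<not> inj_on z {..<k}}"
    using fV by (auto intro: finite_subset[OF _ finite_PiE[of "{..<k}" "\<lambda>_. verts G"]])
  ultimately have "card ?homs \<le> card ((\<Union>H'\<in>L. PiE {..<k} (\<lambda>_. verts H')) \<union> {z \<in> PiE {..<k} (\<lambda>_. verts G). \<not> inj_on z {..<k}})"
    by (intro card_mono) auto
  also have "\<dots> \<le> card (\<Union>H'\<in>L. PiE {..<k} (\<lambda>_. verts H')) + card {z \<in> PiE {..<k} (\<lambda>_. verts G). \<not> inj_on z {..<k}}"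
    by (rule card_Un_le)
  also have "card (\<Union>H'\<in>L. PiE {..<k} (\<lambda>_. verts H')) \<le> (\<Sum>H'\<in>L. card (PiE {..<k} (\<lambda>_. verts H')))"
    by (rule card_UN_le[OF fL])
  also have "\<dots> = (\<Sum>H'\<in>L. k ^ k)" by (rule sum.cong) (auto simp: L card_PiE)
  also have "\<dots> = card L * k ^ k" by simp
  finally have "card ?homs \<le> card L * k ^ k + k\<^sup>2 * card (verts G) ^ (k - 1)"
    using card_noninjective_le[OF fV, of k] by linarith
  moreover have "col ` p \<subseteq> {..m}"
  proof clarify
    fix i j assume "(i, j) \<in> p"
    have "real m * y {x i, x j} \<le> real m * 1" using y(2) by (intro mult_left_mono) auto
    then have "\<lfloor>real m * y {x i, x j}\<rfloor> \<le> int m" by (simp add: floor_le_iff)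
    then show "col (i, j) \<le> m" by (simp add: col_def)
  qed
  moreover have "x ` {..<k} \<subseteq> verts G"
    using copies_graph(2)[OF H(1)] unfolding Hp[symmetric] by (simp add: pattern_graph_def)
  moreover have "E (col (i, j)) (x i) (x j)" if "(i, j) \<in> p" for i j
    using xe[OF that] copies_graph(3)[OF H(1)] by (auto simp: E col_def)
  ultimately show ?thesis using that[OF p] xe by blast
qed

text \<open>Two distinct edges span at least three vertices, so at most \<open>n ^ (k - 3)\<close>
  vertex sets of size \<open>k\<close> contain both, and each carries at most
  \<open>2 ^ (2 ^ k)\<close> edge sets. One factor \<open>n\<close> is saved against the
  cap.\<close>

lemma card_copies_containing_le:
  assumes G: "is_graph G" and e: "e \<in> edges G" "f \<in> edges G" "e \<noteq> f" and n: "n = card (verts G)" and k: "2 \<le> k"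
  shows "real (card {H \<in> copies F G. card (verts H) = k \<and> e \<in> edges H \<and> f \<in> edges H}) / real n ^ (k - 2)
    \<le> 2 ^ (2 ^ k) / real n"
proof -
  let ?T = "{H \<in> copies F G. card (verts H) = k \<and> e \<in> edges H \<and> f \<in> edges H}"
  let ?W = "{W. W \<subseteq> verts G \<and> e \<union> f \<subseteq> W \<and> card W = k}" and ?s = "card (e \<union> f)"
  have fV: "finite (verts G)" using G by (simp add: is_graph_def)
  have ef: "card e = 2" "card f = 2" "e \<subseteq> verts G" "f \<subseteq> verts G" using G e by (auto simp: is_graph_def)
  have fin_ef: "finite e" "finite f" using ef card.infinite by fastforce+
  have n0: "0 < n" using G n by (simp add: is_graph_def card_gt_0_iff)
  have "?s \<noteq> 2"
  proof
    assume "?s = 2"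
    then have "e = e \<union> f" "f = e \<union> f" using ef fin_ef by (intro card_subset_eq; auto)+
    then show False using e(3) by auto
  qed
  moreover have "2 \<le> ?s" using card_mono[of "e \<union> f" e] fin_ef ef by auto
  ultimately have s3: "3 \<le> ?s" by linarith
  have fW: "finite ?W" by (rule finite_subset[of _ "Pow (verts G)"]) (use fV in auto)
  have cT: "card ?T \<le> card ?W * 2 ^ (2 ^ k)"
  proof -
    have "?T \<subseteq> Sigma ?W (\<lambda>W. Pow (Pow W))"
    proof
      fix H assume H: "H \<in> ?T"
      then have Hg: "is_graph H" "verts H \<subseteq> verts G" using copies_graph[of H F G] by simp_all
      then have "edges H \<subseteq> Pow (verts H)" by (auto simp: is_graph_def)
      then show "H \<in> Sigma ?W (\<lambda>W. Pow (Pow W))" using H Hg by (cases H) auto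
    qed
    moreover have "finite (Pow (Pow W))" if "W \<in> ?W" for W using that fV finite_subset by blast
    ultimately have "card ?T \<le> card (Sigma ?W (\<lambda>W. Pow (Pow W)))"
      using fW by (intro card_mono finite_SigmaI) auto
    also have "\<dots> = (\<Sum>W\<in>?W. card (Pow (Pow W)))"
      using fW fV by (intro card_SigmaI) (auto dest: finite_subset)
    also have "\<dots> = (\<Sum>W\<in>?W. 2 ^ (2 ^ k))"
      using fV by (intro sum.cong refl) (auto simp: card_Pow dest: finite_subset)
    finally show ?thesis by simp
  qed
  show ?thesis
  proof (cases "?s \<le> k")
    case True
    have "card ?W \<le> card {U. U \<subseteq> verts G \<and> card U = k - ?s}"
    proof (rule card_inj_on_le[of "\<lambda>W. W - (e \<union> f)"])
      show "inj_on (\<lambda>W. W - (e \<union> f)) ?W" by (rule inj_onI) blast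
      show "(\<lambda>W. W - (e \<union> f)) ` ?W \<subseteq> {U. U \<subseteq> verts G \<and> card U = k - ?s}"
        using fin_ef by (auto simp: card_Diff_subset simp del: Un_subset_iff)
      show "finite {U. U \<subseteq> verts G \<and> card U = k - ?s}" using fV by simp
    qed
    also have "\<dots> = n choose (k - ?s)" using n_subsets[OF fV] n by simp
    also have "\<dots> \<le> n ^ (k - ?s)"
      by (cases "k - ?s \<le> n") (simp_all add: binomial_le_pow binomial_eq_0)
    also have "\<dots> \<le> n ^ (k - 3)" using n0 s3 by (intro power_increasing) auto
    finally have "card ?T \<le> n ^ (k - 3) * 2 ^ (2 ^ k)" using cT order_trans mult_le_mono1 by blast
    from of_nat_mono[OF this, where 'a = real]
    have "real (card ?T) / real n ^ (k - 2) \<le> real n ^ (k - 3) * 2 ^ (2 ^ k) / real n ^ (k - 2)"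
      by (intro divide_right_mono) auto
    also have "\<dots> = 2 ^ (2 ^ k) / real n"
    proof -
      have "k - 2 = Suc (k - 3)" using True s3 by linarith
      then show ?thesis using n0 by simp
    qed
    finally show ?thesis .
  next
    case False
    have "?W = {}"
    proof (rule ccontr)
      assume "?W \<noteq> {}"
      then obtain W where "W \<subseteq> verts G" "e \<union> f \<subseteq> W" "card W = k" by auto
      then show False using False card_mono[of W "e \<union> f"] fV finite_subset by metis
    qed
    then have "card ?T = 0" using cT by (simp only: card.empty)
    then show ?thesis by (simp only: of_nat_0 div_0) simp
  qed
qed

text \<open>The constant \<open>1 / M\<close> on all edges covers every copy with more than
  \<open>M\<close> edges, whatever the family is.\<close>

lemma small_copies_fractional_bound:
  fixes G :: "'a ugraph" and F :: "'b ugraph set"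
  assumes G: "is_graph G" and M: "0 < M"
    and C: "C = {H \<in> copies F G. card (edges H) \<le> M}"
    and c: "\<And>e. e \<in> edges G \<Longrightarrow> 0 \<le> c e" and cov: "\<And>H. H \<in> C \<Longrightarrow> 1 \<le> sum c (edges H)"
  shows "fractional_packing_number F G \<le> sum c (edges G) + (real (card (verts G)))\<^sup>2 / real M"
proof -
  obtain \<phi> where \<phi>: "is_fractional_packing F G \<phi>" "weight F G \<phi> = fractional_packing_number F G"
    using fractional_packing_number_attained(1)[OF G] by blast
  have "sum \<phi> (copies F G - C) \<le> (\<Sum>e\<in>edges G. 1 / real M)"
  proof (rule fractional_packing_le_cover[OF G \<phi>(1)])
    fix H assume "H \<in> copies F G - C"
    then have "M \<le> card (edges H)" by (auto simp: C)
    then show "1 \<le> (\<Sum>e\<in>edges H. 1 / real M)" using M by simp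
  qed auto
  also have "\<dots> = real (card (edges G)) / real M" by simp
  also have "\<dots> \<le> (real (card (verts G)))\<^sup>2 / real M"
    using of_nat_mono[OF card_edges_le[OF G], where 'a = real] by (intro divide_right_mono) auto
  finally have large: "sum \<phi> (copies F G - C) \<le> (real (card (verts G)))\<^sup>2 / real M" .
  have "sum \<phi> C \<le> sum c (edges G)"
    by (rule fractional_packing_le_cover[OF G \<phi>(1) _ c cov]) (auto simp: C)
  moreover have "weight F G \<phi> = sum \<phi> (copies F G - C) + sum \<phi> C"
    unfolding weight_def using finite_copies[OF G] by (intro sum.subset_diff) (auto simp: C)
  ultimately show ?thesis using large \<phi>(2) by linarith
qed

lemma spread_packing_codegree:
  fixes G :: "'a ugraph" and F :: "'b ugraph set"
  assumes G: "is_graph G" and n: "n = card (verts G)" and uv: "u \<in> edges G" "v \<in> edges G" "u \<noteq> v" and \<kappa>: "0 \<le> \<kappa>"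
    and C: "C = {H \<in> copies F G. card (edges H) \<le> M}"
    and \<psi>: "\<And>H. H \<in> C \<Longrightarrow> \<psi> H \<le> \<kappa> / real n ^ (card (verts H) - 2)"
  shows "sum \<psi> {H \<in> C. u \<in> edges H \<and> v \<in> edges H} \<le> (\<Sum>k\<in>{2..2 * M}. \<kappa> * 2 ^ (2 ^ k)) / real n"
proof -
  let ?C' = "{H \<in> C. u \<in> edges H \<and> v \<in> edges H}"
  have fF: "finite (copies F G)" by (rule finite_copies[OF G])
  then have fC: "finite ?C'" by (simp add: C)
  \<comment> \<open>Without isolated vertices, \<open>M\<close> edges span at most
    \<open>2 * M\<close> vertices, so the range of \<open>k\<close> is bounded in terms of
    \<open>M\<close>.\<close>
  have range: "(\<lambda>H. card (verts H)) ` ?C' \<subseteq> {2..2 * M}"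
  proof clarify
    fix H assume "H \<in> C"
    then have "is_graph H" "card (edges H) \<le> M" unfolding C using copies_graph(1) by blast+
    then show "card (verts H) \<in> {2..2 * M}"
      using card_verts_ge_2[of H] card_verts_le[of H] by auto
  qed
  have "sum \<psi> ?C' = (\<Sum>k\<in>{2..2 * M}. sum \<psi> {H \<in> ?C'. card (verts H) = k})"
    by (rule sum.group[symmetric, OF fC _ range]) simp
  also have "\<dots> \<le> (\<Sum>k\<in>{2..2 * M}. \<kappa> * (2 ^ (2 ^ k) / real n))"
  proof (rule sum_mono)
    fix k :: nat assume "k \<in> {2..2 * M}"
    then have k: "2 \<le> k" by simp
    let ?T = "{H \<in> copies F G. card (verts H) = k \<and> u \<in> edges H \<and> v \<in> edges H}"
    have "sum \<psi> {H \<in> ?C'. card (verts H) = k} \<le> (\<Sum>H\<in>{H \<in> ?C'. card (verts H) = k}. \<kappa> / real n ^ (k - 2))"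
    proof (rule sum_mono)
      fix H assume H: "H \<in> {H \<in> ?C'. card (verts H) = k}"
      then show "\<psi> H \<le> \<kappa> / real n ^ (k - 2)" using \<psi>[of H] by simp
    qed
    also have "\<dots> \<le> (\<Sum>H\<in>?T. \<kappa> / real n ^ (k - 2))"
    proof (rule sum_mono2)
      show "finite ?T" using fF by simp
    qed (use \<kappa> in \<open>auto simp: C\<close>)
    also have "\<dots> = \<kappa> * (real (card ?T) / real n ^ (k - 2))" by simp
    also have "\<dots> \<le> \<kappa> * (2 ^ (2 ^ k) / real n)"
      using card_copies_containing_le[OF G uv n k] \<kappa> by (intro mult_left_mono) auto
    finally show "sum \<psi> {H \<in> ?C'. card (verts H) = k} \<le> \<kappa> * (2 ^ (2 ^ k) / real n)" .
  qed
  also have "\<dots> = (\<Sum>k\<in>{2..2 * M}. \<kappa> * 2 ^ (2 ^ k)) / real n"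
    by (simp add: sum_divide_distrib)
  finally show ?thesis .
qed

text \<open>Graphs without isolated vertices are determined by their edges, so copies in \<open>G\<close> can be
  treated as hyperedges on the vertex set \<open>edges G\<close>.\<close>

lemma spread_packing_rounding:
  fixes G :: "'a ugraph" and F :: "'b ugraph set"
  assumes nib: "\<forall>(V :: 'a set set) E w N. weighted_hypergraph V E w M \<delta> \<longrightarrow> card V \<le> N \<longrightarrow> N\<^sub>0 \<le> N \<longrightarrow>
     (\<exists>P\<subseteq>E. pairwise disjnt P \<and> sum w E - \<epsilon> * real N \<le> real (card P))"
    and G: "is_graph G" and N: "(card (verts G))\<^sup>2 = N" "N\<^sub>0 \<le> N"
    and C: "C = {H \<in> copies F G. card (edges H) \<le> M}"
    and \<psi>0: "\<And>H. H \<in> C \<Longrightarrow> 0 \<le> \<psi> H"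
    and deg: "\<And>e. e \<in> edges G \<Longrightarrow> sum \<psi> {H \<in> C. e \<in> edges H} \<le> 1"
    and codeg: "\<And>u v. u \<in> edges G \<Longrightarrow> v \<in> edges G \<Longrightarrow> u \<noteq> v \<Longrightarrow> sum \<psi> {H \<in> C. u \<in> edges H \<and> v \<in> edges H} \<le> \<delta>"
  shows "sum \<psi> C - \<epsilon> * real N \<le> real (packing_number F G)"
proof -
  have fC: "finite C" using finite_copies[OF G, of F] by (simp add: C)
  have Cg: "is_graph H" "edges H \<subseteq> edges G" if "H \<in> C" for H
    using that copies_graph(1,3)[of H F G] by (simp_all add: C)
  have inv: "(\<Union>(edges H), edges H) = H" if "H \<in> C" for H using graph_eq_edges[OF Cg(1)[OF that]] by simp
  then have inj: "inj_on edges C" by (metis inj_onI)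
  define w where "w e = \<psi> (\<Union>e, e)" for e
  have w_sum: "(\<Sum>e\<in>edges ` C. of_bool (P e) * w e) = sum \<psi> {H \<in> C. P (edges H)}" for P
  proof -
    have "(\<Sum>e\<in>edges ` C. of_bool (P e) * w e) = (\<Sum>H\<in>C. of_bool (P (edges H)) * \<psi> H)"
      unfolding sum.reindex[OF inj] o_def w_def by (intro sum.cong refl) (simp only: inv)
    then show ?thesis by (simp only: sum_of_bool_filter[OF fC])
  qed
  have "weighted_hypergraph (edges G) (edges ` C) w M \<delta>"
  proof
    show "finite (edges G)" by (rule finite_edges[OF G])
    fix e assume "e \<in> edges ` C"
    then obtain H where H: "H \<in> C" "e = edges H" by auto
    show "e \<subseteq> edges G" "e \<noteq> {}" "card e \<le> M" using Cg[OF H(1)] edges_nonempty[of H] H by (auto simp: C)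
    show "0 \<le> w e" unfolding w_def H(2) inv[OF H(1)] by (rule \<psi>0[OF H(1)])
  next
    fix v assume "v \<in> edges G"
    then show "(\<Sum>e\<in>edges ` C. of_bool (v \<in> e) * w e) \<le> 1" unfolding w_sum by (rule deg)
  next
    fix u v assume "u \<in> edges G" "v \<in> edges G" "u \<noteq> v"
    then show "(\<Sum>e\<in>edges ` C. of_bool (u \<in> e \<and> v \<in> e) * w e) \<le> \<delta>" unfolding w_sum by (rule codeg)
  qed
  moreover have "card (edges G) \<le> N" using card_edges_le[OF G] N by simp
  ultimately obtain P where P: "P \<subseteq> edges ` C" "pairwise disjnt P" "sum w (edges ` C) - \<epsilon> * real N \<le> real (card P)"
    using nib[THEN spec, THEN spec, THEN spec, THEN spec, of "edges G" "edges ` C" w N] N(2) by blast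
  define Q where "Q = {H \<in> C. edges H \<in> P}"
  have QC: "Q \<subseteq> C" by (auto simp: Q_def)
  have "edges ` Q = P" using P(1) by (auto simp: Q_def)
  then have "card P = card Q" using card_image[OF inj_on_subset[OF inj QC]] by simp
  moreover have "is_packing F G Q"
    unfolding is_packing_def
  proof (intro conjI pairwiseI)
    show "Q \<subseteq> copies F G" using QC by (auto simp: C)
    fix H H' assume H: "H \<in> Q" "H' \<in> Q" "H \<noteq> H'"
    then have "edges H \<noteq> edges H'" using inj QC by (meson inj_on_def subsetD)
    then show "edges H \<inter> edges H' = {}" using P(2) H by (auto simp: Q_def pairwise_def disjnt_def)
  qed
  then have "card Q \<le> packing_number F G" by (rule packing_number_attained(2)[OF G])
  moreover have "sum w (edges ` C) = sum \<psi> C" using w_sum[of "\<lambda>_. True"] by simp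
  ultimately show ?thesis using P(3) by linarith
qed

theorem theorem1p2:
  fixes F :: "'b ugraph set"
  assumes "\<forall>K\<in>F. is_graph K"
  shows "\<forall>\<epsilon>::real. \<epsilon> > 0 \<longrightarrow>
    (\<exists>N::nat. \<forall>n>N. \<forall>G::'a ugraph. is_graph G \<and> card (verts G) = n \<longrightarrow>
       fractional_packing_number F G - real (packing_number F G) < \<epsilon> * (real n)\<^sup>2)"
proof (intro allI impI)
  fix \<epsilon> :: real assume \<epsilon>: "0 < \<epsilon>"
  obtain M :: nat where M: "8 / \<epsilon> < real M" using reals_Archimedean2 by blast
  then have M0: "0 < M" using \<epsilon> by (smt (verit) divide_pos_pos of_nat_0_less_iff)
  \<comment> \<open>Scaling by \<open>1 / (1 - \<gamma>)\<close> costs a factor of at most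
    \<open>1 + 2 * \<gamma>\<close> since \<open>\<gamma> \<le> 1 / 2\<close>, and
    \<open>2 * \<gamma>\<close> is at most \<open>\<epsilon> / 8\<close>.\<close>
  define \<gamma> where "\<gamma> = min (1 / 2) (\<epsilon> / 16)"
  have \<gamma>: "0 < \<gamma>" "\<gamma> \<le> 1 / 2" "2 * \<gamma> \<le> \<epsilon> / 8" using \<epsilon> by (auto simp: \<gamma>_def)
  \<comment> \<open>Enough colours to keep the rounding error over \<open>M\<close> edges below
    \<open>\<gamma> / 2\<close>.\<close>
  obtain m :: nat where m: "2 * real M / \<gamma> < real m" using reals_Archimedean2 by blast
  then have m': "0 < m" "2 * real M \<le> \<gamma> * real m"
    using \<gamma> M0 by (smt (verit) divide_nonneg_pos of_nat_0_less_iff of_nat_0_le_iff, simp add: pos_divide_less_eq mult.commute)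
  define K where "K = 2 * M"
  have "\<exists>\<delta>>0. \<forall>(V :: 'a set) (E :: nat \<Rightarrow> 'a \<Rightarrow> 'a \<Rightarrow> bool). finite V \<longrightarrow>
    (\<exists>D. hom_removal K \<delta> {..m} V E D \<and> real (card D) \<le> \<epsilon> / 8 * (real (card V))\<^sup>2)"
    using \<epsilon> by (intro coloured_removal) auto
  then obtain \<delta>r where \<delta>r: "0 < \<delta>r" and removal: "\<And>(V :: 'a set) E. finite V \<Longrightarrow>
    \<exists>D. hom_removal K \<delta>r {..m} V E D \<and> real (card D) \<le> \<epsilon> / 8 * (real (card V))\<^sup>2"
    by blast
  \<comment> \<open>Large enough that light copies, those with \<open>y\<close>-value at most
    \<open>1 - \<gamma> / 2\<close>, are limited by the total weight to a number accounting for at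
    most a third of the \<open>\<delta>r * n ^ k\<close> maps promised by removal.\<close>
  define \<kappa> where "\<kappa> = 6 * real K ^ K / (\<gamma> * \<delta>r)"
  have \<kappa>: "0 < \<kappa>" using \<gamma> \<delta>r M0 by (simp add: \<kappa>_def K_def)
  have "\<exists>\<delta>>0. \<exists>N\<^sub>0. \<forall>(V :: 'a set set) E w N. weighted_hypergraph V E w M \<delta> \<longrightarrow> card V \<le> N \<longrightarrow> N\<^sub>0 \<le> N \<longrightarrow>
     (\<exists>P\<subseteq>E. pairwise disjnt P \<and> sum w E - \<epsilon> / 8 * real N \<le> real (card P))"
    using \<epsilon> by (intro nibble) auto
  then obtain \<delta>n N\<^sub>0 where \<delta>n: "0 < \<delta>n" and nib: "\<forall>(V :: 'a set set) E w N. weighted_hypergraph V E w M \<delta>n \<longrightarrow> card V \<le> N \<longrightarrow> N\<^sub>0 \<le> N \<longrightarrow>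
     (\<exists>P\<subseteq>E. pairwise disjnt P \<and> sum w E - \<epsilon> / 8 * real N \<le> real (card P))"
    by (elim exE conjE) (rule that)
  define A where "A = (\<Sum>k\<in>{2..2 * M}. \<kappa> * 2 ^ (2 ^ k))"
  obtain N1 :: nat where N1: "A / \<delta>n < real N1" using reals_Archimedean2 by blast
  \<comment> \<open>Beyond this bound, maps that are not injective account for at most another
    third.\<close>
  obtain N2 :: nat where N2: "3 * real (K\<^sup>2) / \<delta>r < real N2" using reals_Archimedean2 by blast
  define N where "N = max N\<^sub>0 (max N1 N2)"
  show "\<exists>N::nat. \<forall>n>N. \<forall>G::'a ugraph. is_graph G \<and> card (verts G) = n \<longrightarrow>
       fractional_packing_number F G - real (packing_number F G) < \<epsilon> * (real n)\<^sup>2"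
  proof (intro exI[of _ N] allI impI, elim conjE)
    fix n :: nat and G :: "'a ugraph"
    assume n: "N < n" and G: "is_graph G" and cG: "card (verts G) = n"
    have n0: "0 < n" using n by simp
    have nN: "N\<^sub>0 \<le> n" "A / \<delta>n \<le> real n" "3 * real (K\<^sup>2) / \<delta>r \<le> real n"
      using n N1 N2 by (auto simp: N_def)
    have n_sq: "n \<le> n\<^sup>2" by (simp add: power2_eq_square)
    have fV: "finite (verts G)" using G by (simp add: is_graph_def)
    define C where "C = {H \<in> copies F G. card (edges H) \<le> M}"
    have fC: "finite C" using finite_copies[OF G, of F] by (simp add: C_def)
    have C_graph: "is_graph H" "edges H \<subseteq> edges G" "card (edges H) \<le> M" "H \<in> copies F G" if "H \<in> C" for H
      using that copies_graph(1,3)[of H F G] by (simp_all add: C_def)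
    define cap where "cap H = \<kappa> / real n ^ (card (verts H) - 2)" for H :: "'a ugraph"
    have cap0: "0 \<le> cap H" for H using \<kappa> by (simp add: cap_def)
    obtain y where y: "\<And>e. 0 \<le> y e" "\<And>e. y e \<le> 1"
      and deg: "\<And>e. e \<in> edges G \<Longrightarrow> (\<Sum>H\<in>{H \<in> C. e \<in> edges H}. cap H * max 0 (1 - sum y (edges H))) \<le> 1"
      and dual: "sum y (edges G) \<le> (\<Sum>H\<in>C. cap H * max 0 (1 - sum y (edges H)))"
    proof (rule capped_fractional_matching[OF finite_edges[OF G] fC, of edges cap])
      show "edges H \<subseteq> edges G" if "H \<in> C" for H by (rule C_graph(2)[OF that])
      show "0 \<le> cap H" for H by (rule cap0)
    qed (rule that)
    define \<psi> where "\<psi> H = cap H * max 0 (1 - sum y (edges H))" for H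
    have \<psi>0: "0 \<le> \<psi> H" for H using cap0 by (simp add: \<psi>_def)
    have \<psi>_le: "\<psi> H \<le> \<kappa> / real n ^ (card (verts H) - 2)" for H
    proof -
      have "max 0 (1 - sum y (edges H)) \<le> 1" using y(1) by (simp add: sum_nonneg)
      then show ?thesis unfolding \<psi>_def using mult_left_mono[OF _ cap0, of _ 1 H] by (simp add: cap_def)
    qed
    have deg\<psi>: "sum \<psi> {H \<in> C. e \<in> edges H} \<le> 1" if "e \<in> edges G" for e
      using deg[OF that] unfolding \<psi>_def .
    \<comment> \<open>Every copy has an edge and every edge carries load at most \<open>1\<close>,
      so the total weight is at most the number of edges.\<close>
    have "sum \<psi> C \<le> (\<Sum>H\<in>C. \<Sum>e\<in>edges G. of_bool (e \<in> edges H) * \<psi> H)"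
    proof (rule sum_mono)
      fix H assume H: "H \<in> C"
      have "1 \<le> card (edges H)"
        using edges_nonempty[OF C_graph(1)[OF H]] finite_edges[OF C_graph(1)[OF H]] by (simp add: Suc_le_eq card_gt_0_iff)
      then have "1 * \<psi> H \<le> real (card (edges H)) * \<psi> H" using \<psi>0 by (intro mult_right_mono) auto
      then show "\<psi> H \<le> (\<Sum>e\<in>edges G. of_bool (e \<in> edges H) * \<psi> H)"
        unfolding sum_of_bool_mem[OF finite_edges[OF G]] using C_graph(2)[OF H] by (simp add: Int_absorb2)
    qed
    also have "\<dots> = (\<Sum>e\<in>edges G. sum \<psi> {H \<in> C. e \<in> edges H})"
      by (subst sum.swap) (simp only: sum_of_bool_filter[OF fC])
    also have "\<dots> \<le> (\<Sum>e\<in>edges G. 1)" by (intro sum_mono deg\<psi>)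
    also have "\<dots> \<le> (real n)\<^sup>2"
      using of_nat_mono[OF card_edges_le[OF G], where 'a = real] by (simp add: cG)
    finally have \<psi>_sum: "sum \<psi> C \<le> (real n)\<^sup>2" .
    define E where "E = (\<lambda>r u v. {u, v} \<in> edges G \<and> nat \<lfloor>real m * y {u, v}\<rfloor> = r)"
    obtain D where D: "hom_removal K \<delta>r {..m} (verts G) E D" "real (card D) \<le> \<epsilon> / 8 * (real n)\<^sup>2"
      using removal[OF fV, of E] unfolding cG by blast
    have DV: "D \<subseteq> verts G \<times> verts G" using D(1) by (simp add: hom_removal_def)
    have rem: "\<delta>r * real n ^ k \<le> real (card (homs k (\<lambda>_. verts G) (\<lambda>e. E (col e)) p))"
      if "k \<le> K" "pattern k p" "col ` p \<subseteq> {..m}" "x ` {..<k} \<subseteq> verts G"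
         "\<forall>(i, j)\<in>p. E (col (i, j)) (x i) (x j) \<and> (x i, x j) \<notin> D" for k p col x
      using D(1) that unfolding hom_removal_def cG by blast
    define del where "del e \<longleftrightarrow> (\<exists>(u, v)\<in>D. e = {u, v})" for e
    \<comment> \<open>A deleted edge covers a copy alone. A copy without deleted edges must have
      \<open>y\<close>-value at least \<open>1 - \<gamma>\<close>, for otherwise removal would yield
      more maps than light copies and non-injective maps together allow.\<close>
    define c where "c e = (if del e then 1 else y e / (1 - \<gamma>))" for e
    have c0: "0 \<le> c e" for e using y(1) \<gamma> by (simp add: c_def)
    have cov: "1 \<le> sum c (edges H)" if H: "H \<in> C" for H
    proof (cases "\<exists>e\<in>edges H. del e")
      case True
      then obtain e where e: "e \<in> edges H" "del e" by auto
      have "c e \<le> sum c (edges H)"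
        using e(1) finite_edges[OF C_graph(1)[OF H]] c0 by (intro member_le_sum) auto
      then show ?thesis using e(2) by (simp add: c_def)
    next
      case False
      then have "sum c (edges H) = sum y (edges H) / (1 - \<gamma>)"
        unfolding sum_divide_distrib by (intro sum.cong) (auto simp: c_def)
      moreover have "1 - \<gamma> \<le> sum y (edges H)"
      proof (rule ccontr)
        assume "\<not> 1 - \<gamma> \<le> sum y (edges H)"
        then have light: "sum y (edges H) \<le> 1 - \<gamma>" by simp
        define k where "k = card (verts H)"
        have k: "2 \<le> k" "k \<le> K"
          using card_verts_ge_2[OF C_graph(1)[OF H]] card_verts_le[OF C_graph(1)[OF H]] C_graph(3)[OF H]
          by (auto simp: k_def K_def)
        define L where "L = {H' \<in> copies F G. card (edges H') \<le> M \<and> card (verts H') = k \<and> sum y (edges H') \<le> 1 - \<gamma> / 2}"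
        obtain p col x where p: "pattern k p" "col ` p \<subseteq> {..m}" "x ` {..<k} \<subseteq> verts G"
          and px: "\<And>i j. (i, j) \<in> p \<Longrightarrow> E (col (i, j)) (x i) (x j)" "\<And>i j. (i, j) \<in> p \<Longrightarrow> {x i, x j} \<in> edges H"
          and homs: "card (homs k (\<lambda>_. verts G) (\<lambda>e. E (col e)) p) \<le> card L * k ^ k + k\<^sup>2 * n ^ (k - 1)"
          using light_copy_pattern[OF G y m' C_graph(4,3)[OF H] light k_def L_def E_def] unfolding cG by metis
        have "\<forall>(i, j)\<in>p. E (col (i, j)) (x i) (x j) \<and> (x i, x j) \<notin> D"
        proof clarify
          fix i j assume ij: "(i, j) \<in> p"
          have "(x i, x j) \<notin> D"
          proof
            assume "(x i, x j) \<in> D"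
            then have "del {x i, x j}" unfolding del_def by blast
            then show False using False px(2)[OF ij] by blast
          qed
          then show "E (col (i, j)) (x i) (x j) \<and> (x i, x j) \<notin> D" using px(1)[OF ij] by simp
        qed
        from rem[OF k(2) p this] of_nat_mono[OF homs, where 'a = real]
        have low: "\<delta>r * real n ^ k \<le> real (card L) * real k ^ k + (real k)\<^sup>2 * real n ^ (k - 1)" by simp
        have LC: "L \<subseteq> C" by (auto simp: L_def C_def)
        have "real (card L) * (\<kappa> / real n ^ (k - 2) * (\<gamma> / 2)) = (\<Sum>H'\<in>L. \<kappa> / real n ^ (k - 2) * (\<gamma> / 2))" by simp
        also have "\<dots> \<le> sum \<psi> L"
        proof (rule sum_mono)
          fix H' assume "H' \<in> L"
          then have "card (verts H') = k" "sum y (edges H') \<le> 1 - \<gamma> / 2" by (simp_all add: L_def)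
          then have H': "card (verts H') = k" "\<gamma> / 2 \<le> max 0 (1 - sum y (edges H'))" by linarith+
          then show "\<kappa> / real n ^ (k - 2) * (\<gamma> / 2) \<le> \<psi> H'"
            using mult_left_mono[OF H'(2) cap0[of H']] by (simp add: \<psi>_def cap_def)
        qed
        also have "\<dots> \<le> sum \<psi> C" using LC fC \<psi>0 by (intro sum_mono2) auto
        also have "\<dots> \<le> (real n)\<^sup>2" by (rule \<psi>_sum)
        finally have "real (card L) * (\<kappa> * \<gamma> / 2) \<le> (real n)\<^sup>2 * real n ^ (k - 2)"
          using n0 by (simp add: field_simps)
        also have "\<dots> = real n ^ k" by (simp only: power_add[symmetric] le_add_diff_inverse[OF k(1)])
        finally have "real (card L) * (3 * real K ^ K) \<le> \<delta>r * real n ^ k"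
        proof -
          assume *: "real (card L) * (\<kappa> * \<gamma> / 2) \<le> real n ^ k"
          have "\<kappa> * \<gamma> / 2 = 3 * real K ^ K / \<delta>r" using \<gamma> \<delta>r by (simp add: \<kappa>_def field_simps)
          then have "real (card L) * (3 * real K ^ K) / \<delta>r \<le> real n ^ k" using * by simp
          then show ?thesis using \<delta>r by (simp add: pos_divide_le_eq mult.commute)
        qed
        moreover have "real (card L) * real k ^ k \<le> real (card L) * real K ^ K"
        proof (rule mult_left_mono)
          have "real k ^ k \<le> real K ^ k" using k by (intro power_mono) auto
          also have "\<dots> \<le> real K ^ K" using k by (intro power_increasing) auto
          finally show "real k ^ k \<le> real K ^ K" .
        qed simp
        ultimately have "3 * (real (card L) * real k ^ k) \<le> \<delta>r * real n ^ k" by simp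
        moreover have "3 * ((real k)\<^sup>2 * real n ^ (k - 1)) \<le> \<delta>r * real n ^ k"
        proof -
          have "(real k)\<^sup>2 \<le> real (K\<^sup>2)" using k by (simp add: power_mono)
          moreover have "3 * real (K\<^sup>2) \<le> \<delta>r * real n" using nN(3) \<delta>r by (simp add: pos_divide_le_eq mult.commute)
          ultimately have "3 * (real k)\<^sup>2 \<le> \<delta>r * real n" by linarith
          then have "3 * (real k)\<^sup>2 * real n ^ (k - 1) \<le> \<delta>r * real n * real n ^ (k - 1)" by (intro mult_right_mono) auto
          also have "real n * real n ^ (k - 1) = real n ^ k" using k by (cases k) auto
          then have "\<delta>r * real n * real n ^ (k - 1) = \<delta>r * real n ^ k" by (simp add: mult.assoc)
          finally show ?thesis by (simp add: mult.assoc)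
        qed
        moreover have "0 < \<delta>r * real n ^ k" using \<delta>r n0 by simp
        ultimately show False using low by linarith
      qed
      ultimately show ?thesis using \<gamma> by simp
    qed
    have "sum c (edges G) \<le> (\<Sum>e\<in>edges G. of_bool (del e) * 1 + y e / (1 - \<gamma>))"
      using y(1) \<gamma> by (intro sum_mono) (auto simp: c_def)
    also have "\<dots> = real (card {e \<in> edges G. del e}) + sum y (edges G) / (1 - \<gamma>)"
      unfolding sum.distrib sum_of_bool_filter[OF finite_edges[OF G]] by (simp add: sum_divide_distrib)
    also have "\<dots> \<le> \<epsilon> / 8 * (real n)\<^sup>2 + (sum \<psi> C + \<epsilon> / 8 * (real n)\<^sup>2)"
    proof (rule add_mono)
      have fD: "finite D" using DV fV finite_subset by blast
      have "{e \<in> edges G. del e} \<subseteq> (\<lambda>(u, v). {u, v}) ` D" by (auto simp: del_def)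
      then have "card {e \<in> edges G. del e} \<le> card D"
        using fD by (meson card_image_le card_mono finite_imageI order_trans)
      then show "real (card {e \<in> edges G. del e}) \<le> \<epsilon> / 8 * (real n)\<^sup>2" using D(2) by linarith
      have S0: "0 \<le> sum \<psi> C" using \<psi>0 by (intro sum_nonneg)
      have "sum y (edges G) / (1 - \<gamma>) \<le> sum \<psi> C / (1 - \<gamma>)"
        using dual \<gamma> unfolding \<psi>_def by (intro divide_right_mono) auto
      also have "\<dots> \<le> sum \<psi> C * (1 + 2 * \<gamma>)"
      proof -
        have "0 \<le> \<gamma> * (1 - 2 * \<gamma>)" using \<gamma> by (intro mult_nonneg_nonneg) auto
        then have "1 \<le> (1 + 2 * \<gamma>) * (1 - \<gamma>)" by (simp add: algebra_simps)
        from mult_left_mono[OF this S0] show ?thesis using \<gamma> by (simp add: pos_divide_le_eq mult.assoc)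
      qed
      also have "\<dots> = sum \<psi> C + 2 * \<gamma> * sum \<psi> C" by (simp add: algebra_simps)
      also have "2 * \<gamma> * sum \<psi> C \<le> \<epsilon> / 8 * (real n)\<^sup>2"
        using \<gamma> \<psi>_sum S0 \<epsilon> by (intro mult_mono) auto
      finally show "sum y (edges G) / (1 - \<gamma>) \<le> sum \<psi> C + \<epsilon> / 8 * (real n)\<^sup>2" by simp
    qed
    finally have c_sum: "sum c (edges G) \<le> \<epsilon> / 8 * (real n)\<^sup>2 + (sum \<psi> C + \<epsilon> / 8 * (real n)\<^sup>2)" .
    have "fractional_packing_number F G \<le> sum c (edges G) + (real n)\<^sup>2 / real M"
      using small_copies_fractional_bound[OF G M0 C_def c0 cov] unfolding cG .
    moreover have "(real n)\<^sup>2 / real M \<le> \<epsilon> / 8 * (real n)\<^sup>2"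
    proof -
      have "1 / real M \<le> \<epsilon> / 8" using M \<epsilon> M0 by (simp add: field_simps)
      from mult_right_mono[OF this, of "(real n)\<^sup>2"] show ?thesis by simp
    qed
    \<comment> \<open>The nibble is run with \<open>N = n\<^sup>2\<close>, which bounds the number
      of edges however sparse \<open>G\<close> is.\<close>
    moreover have "sum \<psi> C - \<epsilon> / 8 * real (n\<^sup>2) \<le> real (packing_number F G)"
    proof (rule spread_packing_rounding[OF nib G _ _ C_def \<psi>0 deg\<psi>])
      show "(card (verts G))\<^sup>2 = n\<^sup>2" "N\<^sub>0 \<le> n\<^sup>2" using cG nN(1) n_sq by auto
      fix u v assume "u \<in> edges G" "v \<in> edges G" "u \<noteq> v"
      then have "sum \<psi> {H \<in> C. u \<in> edges H \<and> v \<in> edges H} \<le> A / real n"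
        unfolding A_def using \<kappa> \<psi>_le by (intro spread_packing_codegree[OF G cG[symmetric] _ _ _ _ C_def]) auto
      also have "\<dots> \<le> \<delta>n" using nN(2) \<delta>n n0 by (simp add: field_simps)
      finally show "sum \<psi> {H \<in> C. u \<in> edges H \<and> v \<in> edges H} \<le> \<delta>n" .
    qed
    \<comment> \<open>There are four losses of \<open>\<epsilon> / 8\<close>, from large copies,
      deleted edges, scaling and the nibble; positivity makes the final inequality strict.\<close>
    moreover have "0 < \<epsilon> * (real n)\<^sup>2" using \<epsilon> n0 by simp
    ultimately show "fractional_packing_number F G - real (packing_number F G) < \<epsilon> * (real n)\<^sup>2"
      using c_sum unfolding of_nat_power by linarith
  qed
qed

end
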